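(* Let $c\in C(0,\infty)$ be non-increasing with $c(0+)>0$, and assume $\Pi_S(0,\infty)=\infty$. 1) Let $\Omega=(0,\infty)\times[0,\infty)^d\times([0,\infty)^d\setminus\{0\})$. For $(t,u,v)\in\Omega$, $$\mathsf P\{\tau_c\in \mathrm dt,\ X(\tau_c-)\in \mathrm du,\ \Delta_X(\tau_c)\in \mathrm dv\}=\mathbf 1\{0\le c(t)-\|u\|<\|v\|\}\,\mathrm dt\,\mathsf P\{X(t)\in \mathrm du\}\,\Pi(\mathrm dv),$$ and $$\mathsf P\{\tau_c\in \mathrm dt,\ X(\tau_c-)\in \mathrm du,\ \Delta_X(\tau_c)=0\}=\mathsf P\{\tau_c\in \mathrm dt,\ S(\tau_c)=c(\tau_c)\}\,\mathsf P\{X(t)\in \mathrm du\mid S(t)=c(t)\}.$$ 2) For $t>0$, $s\in[0,c(t)]$, $z>c(t)-s$, and $u,v\in[0,\infty)^d$, $$\mathsf P\{X(\tau_c-)\in \mathrm du,\ \Delta_X(\tau_c)\in \mathrm dv\mid \tau_c=t,\ S(\tau_c-)=s,\ \Delta_S(\tau_c)=z\}=\mathsf P\{X(t)\in \mathrm du\mid S(t)=s\}\,\Pi_z(\mathrm dv),$$ with $\Pi_z(\mathrm dv)=\mathsf P\{V\in \mathrm dv\mid \|V\|=z\}$, where $V$ is a random vector following the distribution $$\nu_a(\mathrm dv)=\frac{\mathbf 1\{\|v\|>a\}\,\Pi(\mathrm dv)}{\overline\Pi_S(a)},$$ with $a\in(0,z)$ a fixed number. The conditional probability measure $\Pi_z(\mathrm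 dv)$ is independent of the choice of $a\in(0,z)$. Furthermore, $$\mathsf P\{X(\tau_c-)\in \mathrm du\mid \tau_c=t,\ \Delta_S(\tau_c)=0\}=\mathsf P\{X(t)\in \mathrm du\mid S(t)=c(t)\}.$$
   Context: $\|x\|=\sum_i|x_i|$ is the $L^1$ norm on $\mathbb R^d$. $X=(X_1,\dots,X_d)$ is a Lévy process taking values in $[0,\infty)^d$, with Lévy measure $\Pi$ (having no mass at $\{0\}$) and Laplace exponent $\int(1-e^{-\langle\theta,x\rangle})\,\Pi(\mathrm dx)$, $\theta\in[0,\infty)^d$ (i.e. $\mathsf E[e^{-\langle\theta,X(t)\rangle}]=\exp(-t\int(1-e^{-\langle\theta,x\rangle})\Pi(\mathrm dx))$, so there is no drift). $\Delta_X(t)=X(t)-X(t-)$ is the jump process of $X$. $S=\|X\|=X_1+\cdots+X_d$ is a subordinator (non-decreasing Lévy process) with Lévy measure $\Pi_S(\mathrm dx)=\int_{[0,\infty)^d}\mathbf 1\{\|z\|\in \mathrm dx\}\,\Pi(\mathrm dz)$, $x\in(0,\infty)$, and jump process $\Delta_S=\|\Delta_X\|$; $\overline\Pi_S(x)=\Pi_S(x,\infty)$. $C(0,\infty)$ is the set of continuous real functions on $(0,\infty)$, and for $c\in C(0,\infty)$, $\tau_c=\inf\{t>0:S(t)>c(t)\}$, with $\inf\emptyset=\infty$. Equalities between differentials are equalities of measures.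
   Formalization: As S(t) has no atoms, P{X(t)∈du | S(t)=c(t)} is not determined; both identities using it are shown for versions of P{X(t)∈du | S(t)=s} weakly continuous at (t,c(t)) from r<t, s<c(t), and in general for some version changed only on s=c(t). *)

theory Defs
  imports "HOL-Probability.Probability"
begin

definition l1norm :: "real ^ 'n \<Rightarrow> real" where
  "l1norm x = (\<Sum>i\<in>UNIV. \<bar>x $ i\<bar>)"

definition orthant :: "(real ^ 'n) set" where
  "orthant = {x. \<forall>i. 0 \<le> x $ i}"

definition left_lim :: "(real \<Rightarrow> 'b::t2_space) \<Rightarrow> real \<Rightarrow> 'b" where
  "left_lim f t = Lim (at_left t) f"

definition jump :: "(real \<Rightarrow> 'b::real_normed_vector) \<Rightarrow> real \<Rightarrow> 'b" where
  "jump f t = f t - left_lim f t"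

text \<open>The time index is real; only times \<open>t \<ge> 0\<close> are meaningful. All sample paths are
  right-continuous with left limits, so that passage times and pre-passage values are measurable
  without completing the probability space.\<close>

locale levy_process = prob_space M for M :: "'a measure" +
  fixes X :: "real \<Rightarrow> 'a \<Rightarrow> 'b::euclidean_space"
  assumes random_vector: "0 \<le> t \<Longrightarrow> X t \<in> borel_measurable M"
    and start: "AE \<omega> in M. X 0 \<omega> = 0"
    and right_cont: "\<omega> \<in> space M \<Longrightarrow> 0 \<le> t \<Longrightarrow> ((\<lambda>r. X r \<omega>) \<longlongrightarrow> X t \<omega>) (at_right t)"
    and left_limits: "\<omega> \<in> space M \<Longrightarrow> 0 < t \<Longrightarrow> \<exists>l. ((\<lambda>r. X r \<omega>) \<longlongrightarrow> l) (at_left t)"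
    and indep_increments:
      "0 \<le> time 0 \<Longrightarrow> (\<And>i. i < n \<Longrightarrow> time i \<le> time (Suc i)) \<Longrightarrow>
        indep_vars (\<lambda>_. borel) (\<lambda>i \<omega>. X (time (Suc i)) \<omega> - X (time i) \<omega>) {..<(n::nat)}"
    and stationary_increments:
      "0 \<le> s \<Longrightarrow> 0 \<le> t \<Longrightarrow> distr M borel (\<lambda>\<omega>. X (s + t) \<omega> - X s \<omega>) = distr M borel (X t)"

text \<open>A driftless Levy process in the orthant with Levy measure \<open>Pm\<close>. The integrability assumption
  is finiteness of the Laplace exponent, without which the Bochner integral would be \<open>0\<close>.\<close>

locale orthant_levy_process = levy_process M X
  for M :: "'a measure" and X :: "real \<Rightarrow> 'a \<Rightarrow> real ^ 'n" +
  fixes Pm :: "(real ^ 'n) measure"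
  assumes in_orthant: "\<omega> \<in> space M \<Longrightarrow> 0 \<le> t \<Longrightarrow> X t \<omega> \<in> orthant"
    and sets_Pm: "sets Pm = sets borel"
    and Pm_orthant: "emeasure Pm (- orthant) = 0"
    and Pm_zero: "emeasure Pm {0} = 0"
    and exponent_finite: "\<theta> \<in> orthant \<Longrightarrow> integrable Pm (\<lambda>x. 1 - exp (- (\<theta> \<bullet> x)))"
    and laplace: "\<theta> \<in> orthant \<Longrightarrow> 0 \<le> t \<Longrightarrow>
      expectation (\<lambda>\<omega>. exp (- (\<theta> \<bullet> X t \<omega>))) = exp (- t * (\<integral>x. 1 - exp (- (\<theta> \<bullet> x)) \<partial>Pm))"

text \<open>\<open>Pi_S\<close>. No restriction to \<open>(0,\<infinity>)\<close> is needed, since the Levy measure has no mass at \<open>0\<close>.\<close>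

definition norm_levy :: "(real ^ 'n) measure \<Rightarrow> real measure" where
  "norm_levy Pm = distr Pm borel l1norm"

definition nu :: "(real ^ 'n) measure \<Rightarrow> real \<Rightarrow> (real ^ 'n) measure" where
  "nu Pm a = density Pm (\<lambda>v. indicator {v. a < l1norm v} v / emeasure (norm_levy Pm) {a<..})"

definition norm_proc :: "(real \<Rightarrow> 'a \<Rightarrow> real ^ 'n) \<Rightarrow> real \<Rightarrow> 'a \<Rightarrow> real" where
  "norm_proc X t \<omega> = l1norm (X t \<omega>)"

definition first_passage :: "(real \<Rightarrow> 'a \<Rightarrow> real) \<Rightarrow> (real \<Rightarrow> real) \<Rightarrow> 'a \<Rightarrow> ereal" where
  "first_passage S c \<omega> = Inf (ereal ` {t. 0 < t \<and> c t < S t \<omega>})"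

text \<open>The event that the passage time of \<open>S = \<parallel>X\<parallel>\<close> lies in \<open>(0,\<infinity>)\<close>, and on that event the passage
  time as a real number, followed by \<open>X(\<tau>-)\<close>, \<open>\<Delta>_X(\<tau>)\<close>, \<open>S(\<tau>)\<close>, \<open>S(\<tau>-)\<close> and \<open>\<Delta>_S(\<tau>)\<close>.\<close>

definition passes :: "'a measure \<Rightarrow> (real \<Rightarrow> 'a \<Rightarrow> real ^ 'n) \<Rightarrow> (real \<Rightarrow> real) \<Rightarrow> 'a set" where
  "passes M X c = {\<omega> \<in> space M. 0 < first_passage (norm_proc X) c \<omega> \<and>
                                first_passage (norm_proc X) c \<omega> < \<infinity>}"

definition tau :: "(real \<Rightarrow> 'a \<Rightarrow> real ^ 'n) \<Rightarrow> (real \<Rightarrow> real) \<Rightarrow> 'a \<Rightarrow> real" where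
  "tau X c \<omega> = real_of_ereal (first_passage (norm_proc X) c \<omega>)"

definition pre_X :: "(real \<Rightarrow> 'a \<Rightarrow> real ^ 'n) \<Rightarrow> (real \<Rightarrow> real) \<Rightarrow> 'a \<Rightarrow> real ^ 'n" where
  "pre_X X c \<omega> = left_lim (\<lambda>r. X r \<omega>) (tau X c \<omega>)"

definition jump_X :: "(real \<Rightarrow> 'a \<Rightarrow> real ^ 'n) \<Rightarrow> (real \<Rightarrow> real) \<Rightarrow> 'a \<Rightarrow> real ^ 'n" where
  "jump_X X c \<omega> = jump (\<lambda>r. X r \<omega>) (tau X c \<omega>)"

definition at_S :: "(real \<Rightarrow> 'a \<Rightarrow> real ^ 'n) \<Rightarrow> (real \<Rightarrow> real) \<Rightarrow> 'a \<Rightarrow> real" where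
  "at_S X c \<omega> = norm_proc X (tau X c \<omega>) \<omega>"

definition pre_S :: "(real \<Rightarrow> 'a \<Rightarrow> real ^ 'n) \<Rightarrow> (real \<Rightarrow> real) \<Rightarrow> 'a \<Rightarrow> real" where
  "pre_S X c \<omega> = left_lim (\<lambda>r. norm_proc X r \<omega>) (tau X c \<omega>)"

definition jump_S :: "(real \<Rightarrow> 'a \<Rightarrow> real ^ 'n) \<Rightarrow> (real \<Rightarrow> real) \<Rightarrow> 'a \<Rightarrow> real" where
  "jump_S X c \<omega> = jump (\<lambda>r. norm_proc X r \<omega>) (tau X c \<omega>)"

text \<open>\<open>K\<close> is a regular version of \<open>P{Z \<in> dz | Y = y}\<close> for \<open>y\<close> in the Borel set \<open>R\<close>. Here \<open>Y\<close> and \<open>Z\<close>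
  are defined on the event \<open>E\<close> only.\<close>

definition reg_cond_distr ::
  "'a measure \<Rightarrow> 'a set \<Rightarrow> ('a \<Rightarrow> 'b::topological_space) \<Rightarrow> ('a \<Rightarrow> 'c::topological_space)
    \<Rightarrow> 'b set \<Rightarrow> ('b \<Rightarrow> 'c measure) \<Rightarrow> bool" where
  "reg_cond_distr M E Y Z R K \<longleftrightarrow>
    K \<in> measurable (restrict_space borel R) (prob_algebra borel) \<and>
    (\<forall>A\<in>sets borel. \<forall>B\<in>sets borel. A \<subseteq> R \<longrightarrow>
      emeasure M {\<omega> \<in> E. Y \<omega> \<in> A \<and> Z \<omega> \<in> B} =
        (\<integral>\<^sup>+ y. emeasure (K y) B * indicator A y \<partial>distr (restrict_space M E) borel Y))"

text \<open>\<open>K t s\<close> is a version of \<open>P{X(t) \<in> du | S(t) = s}\<close>, measurable jointly in \<open>(t, s)\<close>.\<close>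

definition cond_family ::
  "'a measure \<Rightarrow> (real \<Rightarrow> 'a \<Rightarrow> real ^ 'n) \<Rightarrow> (real \<Rightarrow> real \<Rightarrow> (real ^ 'n) measure) \<Rightarrow> bool" where
  "cond_family M X K \<longleftrightarrow>
    (\<lambda>(t, s). K t s) \<in> measurable (restrict_space borel ({0<..} \<times> UNIV)) (prob_algebra borel) \<and>
    (\<forall>t>0. reg_cond_distr M (space M) (norm_proc X t) (X t) UNIV (K t))"

text \<open>\<open>P{\<tau> \<in> dt, S(\<tau>) = c(\<tau>)}\<close>\<close>

definition creep_law ::
  "'a measure \<Rightarrow> (real \<Rightarrow> 'a \<Rightarrow> real ^ 'n) \<Rightarrow> (real \<Rightarrow> real) \<Rightarrow> real measure" where
  "creep_law M X c =
    distr (restrict_space M {\<omega> \<in> passes M X c. at_S X c \<omega> = c (tau X c \<omega>)}) borel (tau X c)"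

text \<open>The law of \<open>S(t)\<close> has no atoms when \<open>Pi_S\<close> is infinite, so at each single \<open>t\<close> the value
  \<open>K t (c t)\<close> of a version is arbitrary, although \<open>c\<close> may be hit continuously with positive
  probability. The condition below says that \<open>K\<close> is
  a version for which conditioning on \<open>S(t) = c(t)\<close> is meaningful pointwise: for almost every \<open>t\<close>
  under the creeping law, \<open>K t (c t)\<close> is the weak limit of \<open>K r y\<close> as \<open>(r, y)\<close> tends to \<open>(t, c t)\<close>
  with \<open>r < t\<close> and \<open>y < c t\<close>.\<close>

definition cont_along ::
  "'a measure \<Rightarrow> (real \<Rightarrow> 'a \<Rightarrow> real ^ 'n) \<Rightarrow> (real \<Rightarrow> real)
    \<Rightarrow> (real \<Rightarrow> real \<Rightarrow> (real ^ 'n) measure) \<Rightarrow> bool" where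
  "cont_along M X c K \<longleftrightarrow>
    (AE t in creep_law M X c. \<forall>f :: real ^ 'n \<Rightarrow> real. continuous_on UNIV f \<longrightarrow> bounded (range f) \<longrightarrow>
      ((\<lambda>(r, y). \<integral>u. f u \<partial>K r y) \<longlongrightarrow> (\<integral>u. f u \<partial>K t (c t)))
        (at (t, c t) within ({0<..<t} \<times> {..<c t})))"

text \<open>The two identities that involve \<open>P{X(t) \<in> du | S(t) = c(t)}\<close>: first
  \<open>P{\<tau> \<in> dt, X(\<tau>-) \<in> du, \<Delta>_X(\<tau>) = 0} = P{\<tau> \<in> dt, S(\<tau>) = c(\<tau>)} P{X(t) \<in> du | S(t) = c(t)}\<close>, then
  \<open>P{X(\<tau>-) \<in> du | \<tau> = t, \<Delta>_S(\<tau>) = 0} = P{X(t) \<in> du | S(t) = c(t)}\<close>.\<close>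

definition creep_joint ::
  "'a measure \<Rightarrow> (real \<Rightarrow> 'a \<Rightarrow> real ^ 'n) \<Rightarrow> (real \<Rightarrow> real)
    \<Rightarrow> (real \<Rightarrow> real \<Rightarrow> (real ^ 'n) measure) \<Rightarrow> bool" where
  "creep_joint M X c K \<longleftrightarrow>
    (\<forall>C\<in>sets borel. C \<subseteq> {0<..} \<times> orthant \<longrightarrow>
      emeasure M {\<omega> \<in> passes M X c. (tau X c \<omega>, pre_X X c \<omega>) \<in> C \<and> jump_X X c \<omega> = 0} =
        (\<integral>\<^sup>+ t. emeasure (K t (c t)) {u. (t, u) \<in> C} \<partial>creep_law M X c))"

definition creep_cond ::
  "'a measure \<Rightarrow> (real \<Rightarrow> 'a \<Rightarrow> real ^ 'n) \<Rightarrow> (real \<Rightarrow> real)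
    \<Rightarrow> (real \<Rightarrow> real \<Rightarrow> (real ^ 'n) measure) \<Rightarrow> bool" where
  "creep_cond M X c K \<longleftrightarrow>
    reg_cond_distr M (passes M X c) (\<lambda>\<omega>. (tau X c \<omega>, jump_S X c \<omega>)) (pre_X X c)
      ({0<..} \<times> {0}) (\<lambda>(t, z). K t (c t))"

end

theory Submission
  imports Defs "HOL-Real_Asymp.Real_Asymp"
begin

text \<open>Let \<open>S = \<parallel>X\<parallel>\<close> and let \<open>T(y)\<close> be the passage time of \<open>S\<close> over the constant level \<open>y\<close>. A jump of \<open>S\<close>
  at time \<open>t\<close> is the passage over exactly the levels \<open>y\<close> between \<open>S(t-)\<close> and \<open>S(t)\<close>, so integrating
  over \<open>y\<close> against \<open>exp (- y) dy\<close> replaces sums over jumps and avoids the Poisson structure of the jump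
  measure. On a time grid the Laplace transform of \<open>(T(y), X(T(y)-), \<Delta>\<^sub>X(T(y)))\<close> under
  \<open>P \<otimes> exp (- y) dy\<close> is a geometric series that needs only two independent increments; its limit
  identifies the law as \<open>exp (- \<parallel>u\<parallel>) (1 - exp (- \<parallel>v\<parallel>)) dt P{X(t) \<in> du} \<Pi>(dv)\<close>.

  A jump across the boundary \<open>c\<close> at time \<open>t\<close> makes \<open>\<tau>\<^sub>c = t\<close>, since \<open>c\<close> is non-increasing. Dividing by the weight
  therefore gives the first identity. As \<open>S - c\<close> is strictly increasing, almost surely no jump ends on the
  boundary, so creeping is the event \<open>\<Delta>\<^sub>X(\<tau>\<^sub>c) = 0\<close>. On it \<open>X(\<tau>\<^sub>c-)\<close> is approximated by \<open>X\<close> at the grid point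
  before \<open>\<tau>\<^sub>c\<close>, where conditioning on \<open>S\<close> is exact.\<close>

subsection \<open>Determining classes for finite measures\<close>

text \<open>The exponential weight makes the crossing weight of a jump a product in u and v and a
  mere shift of the Laplace argument by \<open>ones\<close>. With psi for
  \<open>laplace_exp\<close>, both transforms are (psi(theta + ones) - psi(theta)) / (alpha +
  psi(beta + ones)). Absence of drift enters in the numerator: psi is a pure integral over
  \<open>Pm\<close>, hence so is its difference, whereas a drift would add levels that are crossed
  without a jump. Infinite activity makes S strictly increasing, so that touching the boundary at
  time r already means passage by time r. The obstacle is creeping. For a single t the event S(t) =
  c(t) may be null, so a conditional law given S(t) is not pinned down on the graph of c. Either its
  continuity from below selects the value there, or the values on the graph are replaced by a
  disintegration of the law of (tau, X(tau-)) under creeping. The replacement must leave a valid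
  conditional law at those t where S(t) = c(t) has positive probability.\<close>

lemma closed_indicator_limit:
  fixes C :: "'a::metric_space set"
  assumes "closed C"
  obtains f :: "nat \<Rightarrow> 'a \<Rightarrow> real"
  where "\<And>n. continuous_on UNIV (f n)" "\<And>n x. 0 \<le> f n x" "\<And>n x. f n x \<le> 1"
    "\<And>x. (\<lambda>n. f n x) \<longlonglongrightarrow> indicator C x"
proof (cases "C = {}")
  case True
  \<comment> \<open>\<open>infdist\<close> to the empty set is 0 by convention, so the functions
    used below would tend to 1 instead of 0.\<close>
  then show ?thesis using that[of "\<lambda>_ _. 0"] by simp
next
  case False
  define f where "f n x = max 0 (1 - real n * infdist x C)" for n x
  have lim: "(\<lambda>n. f n x) \<longlonglongrightarrow> indicator C x" for x
  proof (cases "x \<in> C")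
    case True
    then show ?thesis by (simp add: f_def)
  next
    case out: False
    then have d: "0 < infdist x C"
      using False assms by (metis in_closed_iff_infdist_zero infdist_nonneg less_eq_real_def)
    have "\<forall>\<^sub>F n in sequentially. f n x = 0"
    proof -
      obtain N where N: "1 < real N * infdist x C" using reals_Archimedean3[OF d] by blast
      have "f n x = 0" if "n \<ge> N" for n
      proof -
        have "real N * infdist x C \<le> real n * infdist x C"
          using that d by (intro mult_right_mono) auto
        with N show ?thesis by (simp add: f_def)
      qed
      then show ?thesis using eventually_sequentially by blast
    qed
    then show ?thesis using out by (simp add: tendsto_eventually)
  qed
  show ?thesis
    by (rule that[of f]) (auto simp: f_def infdist_nonneg lim[unfolded f_def] intro!: continuous_intros)
qed

lemma finite_measure_eqI_closed:
  fixes M N :: "'a::metric_space measure"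
  assumes "finite_measure M" "sets M = sets borel" "sets N = sets borel"
    and eq: "\<And>C. closed C \<Longrightarrow> emeasure M C = emeasure N C"
  shows "M = N"
proof (rule measure_eqI_generator_eq[where E="Collect closed" and \<Omega>=UNIV and A="\<lambda>_. UNIV"])
  interpret finite_measure M by fact
  show "Int_stable (Collect closed)" by (auto simp: Int_stable_def)
  show "sets M = sigma_sets UNIV (Collect closed)" "sets N = sigma_sets UNIV (Collect closed)"
    using assms by (simp_all add: borel_eq_closed)
  show "emeasure M UNIV \<noteq> \<infinity>" by simp
qed (use eq in auto)

lemma finite_measure_eqI_continuous:
  fixes M N :: "'a::metric_space measure"
  assumes fin: "finite_measure M" and sM: "sets M = sets borel" and sN: "sets N = sets borel"
    and eq: "\<And>f. continuous_on UNIV f \<Longrightarrow> (\<And>x. 0 \<le> f x) \<Longrightarrow> (\<And>x. f x \<le> 1) \<Longrightarrow>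
      (\<integral>\<^sup>+x. ennreal (f x) \<partial>M) = (\<integral>\<^sup>+x. ennreal (f x) \<partial>N)"
  shows "M = N"
proof (rule finite_measure_eqI_closed[OF fin sM sN])
  fix C :: "'a set" assume C: "closed C"
  then have [measurable]: "C \<in> sets M" "C \<in> sets N" using sM sN by auto
  \<comment> \<open>Finiteness of \<open>N\<close> comes from the constant test function 1.\<close>
  have "emeasure M UNIV = emeasure N UNIV"
    using eq[of "\<lambda>_. 1"] sM sN by (simp add: sets_eq_imp_space_eq)
  then have fN: "emeasure N UNIV < \<infinity>"
    using finite_measure.emeasure_finite[OF fin, of UNIV] by (simp add: top.not_eq_extremum)
  obtain f :: "nat \<Rightarrow> 'a \<Rightarrow> real" where f: "\<And>n. continuous_on UNIV (f n)" "\<And>n x. 0 \<le> f n x" "\<And>n x. f n x \<le> 1"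
    "\<And>x. (\<lambda>n. f n x) \<longlonglongrightarrow> indicator C x" using closed_indicator_limit[OF C] by metis
  have lim: "(\<lambda>n. \<integral>\<^sup>+x. ennreal (f n x) \<partial>L) \<longlonglongrightarrow> emeasure L C"
    if sL: "sets L = sets borel" and finL: "emeasure L UNIV < \<infinity>" for L :: "'a measure"
  proof -
    have CL: "C \<in> sets L" using sL C by auto
    have "(\<lambda>n. \<integral>\<^sup>+x. ennreal (f n x) \<partial>L) \<longlonglongrightarrow> (\<integral>\<^sup>+x. ennreal (indicator C x) \<partial>L)"
    proof (rule nn_integral_dominated_convergence[where w="\<lambda>_. 1"])
      show "(\<lambda>x. ennreal (f j x)) \<in> borel_measurable L" for j
        using borel_measurable_continuous_onI[OF f(1)[of j]] sL
        by (metis measurable_cong_sets measurable_compose[OF _ measurable_ennreal])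
      show "(\<lambda>x. ennreal (indicator C x)) \<in> borel_measurable L" using CL by measurable
      show "(\<integral>\<^sup>+ x. 1 \<partial>L) < \<infinity>" using finL sL by (simp add: sets_eq_imp_space_eq)
      show "AE x in L. (\<lambda>n. ennreal (f n x)) \<longlonglongrightarrow> ennreal (indicator C x)"
        using f(2,4) by (intro AE_I2 tendsto_ennrealI) auto
      show "\<And>j. AE x in L. ennreal (f j x) \<le> 1" using f(3) by (auto simp: ennreal_le_1)
    qed auto
    then show ?thesis using CL by (simp add: ennreal_indicator)
  qed
  have "(\<lambda>n. \<integral>\<^sup>+x. ennreal (f n x) \<partial>M) \<longlonglongrightarrow> emeasure M C"
    using lim[OF sM] finite_measure.emeasure_finite[OF fin, of UNIV] by (simp add: top.not_eq_extremum)
  moreover have "(\<lambda>n. \<integral>\<^sup>+x. ennreal (f n x) \<partial>M) \<longlonglongrightarrow> emeasure N C"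
    using lim[OF sN fN] by (simp add: eq[OF f(1) f(2) f(3)])
  ultimately show "emeasure M C = emeasure N C" using LIMSEQ_unique by blast
qed

lemma finite_measure_eqI_rectangles:
  fixes M N :: "('a::second_countable_topology \<times> 'b::second_countable_topology) measure"
  assumes "finite_measure M" "sets M = sets borel" "sets N = sets borel"
    and eq: "\<And>A B. A \<in> sets borel \<Longrightarrow> B \<in> sets borel \<Longrightarrow> emeasure M (A \<times> B) = emeasure N (A \<times> B)"
  shows "M = N"
proof (rule measure_eqI_generator_eq[where \<Omega>=UNIV and A="\<lambda>_. UNIV"
      and E="{a \<times> b | a b. a \<in> sets (borel::'a measure) \<and> b \<in> sets (borel::'b measure)}"])
  interpret finite_measure M by fact
  show "Int_stable {a \<times> b |a b. a \<in> sets (borel::'a measure) \<and> b \<in> sets (borel::'b measure)}"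
    by (rule Int_stable_pair_measure_generator)
  show "sets M = sigma_sets UNIV {a \<times> b |a b. a \<in> sets borel \<and> b \<in> sets borel}"
    "sets N = sigma_sets UNIV {a \<times> b |a b. a \<in> sets borel \<and> b \<in> sets borel}"
    using assms(2,3) by (simp_all add: borel_prod[symmetric] sets_pair_measure)
  show "range (\<lambda>_. UNIV) \<subseteq> {a \<times> b |a b. a \<in> sets (borel::'a measure) \<and> b \<in> sets (borel::'b measure)}"
    by (auto intro!: exI[of _ UNIV])
  show "emeasure M UNIV \<noteq> \<infinity>" by simp
qed (use eq in auto)

text \<open>One factor at a time is upgraded from continuous functions to indicators while the other
  serves as a density: first \<open>g\<close> is the weight and the laws of the first coordinate
  agree, then \<open>indicator A\<close> is the weight for the second. Product test functions are
  what the grid argument for creeping delivers.\<close>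

lemma finite_measure_eqI_continuous_prod:
  fixes M N :: "('a::{metric_space,second_countable_topology} \<times>
    'b::{metric_space,second_countable_topology}) measure"
  assumes fin: "finite_measure M" and sM[measurable_cong]: "sets M = sets borel"
    and sN[measurable_cong]: "sets N = sets borel"
    and eq: "\<And>f g. continuous_on UNIV f \<Longrightarrow> (\<And>x. 0 \<le> f x) \<Longrightarrow> (\<And>x. f x \<le> 1) \<Longrightarrow>
      continuous_on UNIV g \<Longrightarrow> (\<And>x. 0 \<le> g x) \<Longrightarrow> (\<And>x. g x \<le> 1) \<Longrightarrow>
      (\<integral>\<^sup>+z. ennreal (f (fst z)) * ennreal (g (snd z)) \<partial>M) =
      (\<integral>\<^sup>+z. ennreal (f (fst z)) * ennreal (g (snd z)) \<partial>N)"
  shows "M = N"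
proof -
  have fb: "f \<in> borel_measurable borel" if "continuous_on UNIV f" for f :: "'c::metric_space \<Rightarrow> real"
    using that by (rule borel_measurable_continuous_onI)
  have finM: "emeasure M UNIV < \<infinity>"
    using finite_measure.emeasure_finite[OF fin, of UNIV] by (simp add: top.not_eq_extremum)
  have [simp]: "space M = UNIV" "space N = UNIV" using sM sN by (auto dest: sets_eq_imp_space_eq)
  have [measurable]: "fst \<in> M \<rightarrow>\<^sub>M (borel :: 'a measure)" "snd \<in> M \<rightarrow>\<^sub>M (borel :: 'b measure)"
    "fst \<in> N \<rightarrow>\<^sub>M (borel :: 'a measure)" "snd \<in> N \<rightarrow>\<^sub>M (borel :: 'b measure)"
    by (simp_all add: measurable_cong_sets[OF sM refl] measurable_cong_sets[OF sN refl]
        borel_prod[symmetric])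
  have bound: "finite_measure (distr (density M w) borel h)"
    if "h \<in> M \<rightarrow>\<^sub>M borel" "\<And>z. w z \<le> 1" "w \<in> borel_measurable M"
    for w :: "'a \<times> 'b \<Rightarrow> ennreal" and h :: "'a \<times> 'b \<Rightarrow> 'c::topological_space"
  proof (rule finite_measureI)
    have "emeasure (distr (density M w) borel h) UNIV = (\<integral>\<^sup>+z. w z \<partial>M)"
      using that by (simp add: emeasure_distr emeasure_density)
    also have "\<dots> \<le> (\<integral>\<^sup>+z. 1 \<partial>M)" by (intro nn_integral_mono that)
    also have "\<dots> < \<infinity>" using finM by simp
    finally show "emeasure (distr (density M w) borel h) (space (distr (density M w) borel h)) \<noteq> \<infinity>"
      by simp
  qed
  have step1: "(\<integral>\<^sup>+z. indicator A (fst z) * ennreal (g (snd z)) \<partial>M) =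
      (\<integral>\<^sup>+z. indicator A (fst z) * ennreal (g (snd z)) \<partial>N)"
    if A[measurable]: "A \<in> sets borel" and g: "continuous_on UNIV g" "\<And>x. 0 \<le> g x" "\<And>x. g x \<le> 1" for A g
  proof -
    note [measurable] = fb[OF g(1)]
    have "distr (density M (\<lambda>z. ennreal (g (snd z)))) borel fst =
        distr (density N (\<lambda>z. ennreal (g (snd z)))) borel fst"
    proof (rule finite_measure_eqI_continuous)
      show "finite_measure (distr (density M (\<lambda>z. ennreal (g (snd z)))) borel fst)"
        by (rule bound) (use g in \<open>auto simp: ennreal_le_1\<close>)
      fix f :: "'a \<Rightarrow> real" assume f: "continuous_on UNIV f" "\<And>x. 0 \<le> f x" "\<And>x. f x \<le> 1"
      note [measurable] = fb[OF f(1)]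
      show "(\<integral>\<^sup>+x. ennreal (f x) \<partial>distr (density M (\<lambda>z. ennreal (g (snd z)))) borel fst) =
        (\<integral>\<^sup>+x. ennreal (f x) \<partial>distr (density N (\<lambda>z. ennreal (g (snd z)))) borel fst)"
        using eq[OF f g] by (simp add: nn_integral_distr nn_integral_density mult.commute)
    qed auto
    then have "emeasure (distr (density M (\<lambda>z. ennreal (g (snd z)))) borel fst) A =
      emeasure (distr (density N (\<lambda>z. ennreal (g (snd z)))) borel fst) A" by simp
    moreover have "indicator (fst -` A) z = (indicator A (fst z) :: ennreal)" for z :: "'a \<times> 'b"
      by (auto simp: indicator_def)
    moreover have "fst -` A \<in> sets M" "fst -` A \<in> sets N"
      using measurable_sets[of fst M borel A] measurable_sets[of fst N borel A] by simp_all
    ultimately show ?thesis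
      by (simp add: emeasure_distr emeasure_density mult.commute)
  qed
  show ?thesis
  proof (rule finite_measure_eqI_rectangles[OF fin sM sN])
    fix A :: "'a set" and B :: "'b set" assume [measurable]: "A \<in> sets borel" and B[measurable]: "B \<in> sets borel"
    have "distr (density M (\<lambda>z. indicator A (fst z))) borel snd =
        distr (density N (\<lambda>z. indicator A (fst z))) borel snd"
    proof (rule finite_measure_eqI_continuous)
      show "finite_measure (distr (density M (\<lambda>z. indicator A (fst z))) borel snd)"
        by (rule bound) (auto simp: indicator_def)
      fix g :: "'b \<Rightarrow> real" assume g: "continuous_on UNIV g" "\<And>x. 0 \<le> g x" "\<And>x. g x \<le> 1"
      note [measurable] = fb[OF g(1)]
      show "(\<integral>\<^sup>+x. ennreal (g x) \<partial>distr (density M (\<lambda>z. indicator A (fst z))) borel snd) =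
        (\<integral>\<^sup>+x. ennreal (g x) \<partial>distr (density N (\<lambda>z. indicator A (fst z))) borel snd)"
        using step1[OF _ g, of A] by (simp add: nn_integral_distr nn_integral_density)
    qed auto
    then have "emeasure (distr (density M (\<lambda>z. indicator A (fst z))) borel snd) B =
        emeasure (distr (density N (\<lambda>z. indicator A (fst z))) borel snd) B" by simp
    moreover have "indicator A (fst z) * indicator (snd -` B) z = (indicator (A \<times> B) z :: ennreal)" for z
      by (cases z) (auto simp: indicator_def)
    moreover have "snd -` B \<in> sets M" "snd -` B \<in> sets N"
      using measurable_sets[of snd M borel B] measurable_sets[of snd N borel B] by simp_all
    moreover have "A \<times> B \<in> sets M" "A \<times> B \<in> sets N" by (simp_all add: sM sN borel_Times)
    ultimately show "emeasure M (A \<times> B) = emeasure N (A \<times> B)"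
      by (simp add: emeasure_distr emeasure_density)
  qed
qed

subsection \<open>Uniqueness of Laplace transforms\<close>

text \<open>The algebra that Stone-Weierstrass provides after the substitution y_b = exp (- x_b).
  Nonnegative coordinates of theta keep each term bounded on the orthant, hence integrable for
  finite measures living there.\<close>

inductive exp_sum :: "('a::euclidean_space \<Rightarrow> real) \<Rightarrow> bool" where
  exp_sum_term: "(\<And>b. b \<in> Basis \<Longrightarrow> 0 \<le> \<theta> \<bullet> b) \<Longrightarrow> exp_sum (\<lambda>x. a * exp (- (\<theta> \<bullet> x)))"
| exp_sum_add: "exp_sum f \<Longrightarrow> exp_sum g \<Longrightarrow> exp_sum (\<lambda>x. f x + g x)"

lemma exp_sum_const: "exp_sum (\<lambda>x. a)"
proof -
  have "exp_sum (\<lambda>x::'a. a * exp (- (0 \<bullet> x)))" by (rule exp_sum_term) simp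
  then show ?thesis by simp
qed

lemma exp_sum_sum: "finite I \<Longrightarrow> (\<And>i. i \<in> I \<Longrightarrow> exp_sum (f i)) \<Longrightarrow> exp_sum (\<lambda>x. \<Sum>i\<in>I. f i x)"
proof (induction I rule: finite_induct)
  case empty
  then show ?case using exp_sum_const[of 0] by simp
next
  case (insert i I)
  then have "exp_sum (\<lambda>x. f i x + (\<Sum>i\<in>I. f i x))" by (intro exp_sum_add) simp_all
  then show ?case using insert by simp
qed

lemma exp_sum_mult:
  assumes "exp_sum f" "exp_sum g"
  shows "exp_sum (\<lambda>x. f x * g x)"
  using assms(1)
proof induction
  case (exp_sum_term \<theta> a)
  show ?case using assms(2)
  proof induction
    case t: (exp_sum_term \<eta> b)
    have "exp_sum (\<lambda>x. (a * b) * exp (- ((\<theta> + \<eta>) \<bullet> x)))"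
      by (rule exp_sum.exp_sum_term) (use exp_sum_term t in \<open>auto simp: inner_add_left\<close>)
    moreover have "(a * b) * exp (- ((\<theta> + \<eta>) \<bullet> x)) =
        a * exp (- (\<theta> \<bullet> x)) * (b * exp (- (\<eta> \<bullet> x)))" for x
      by (simp add: inner_add_left exp_add[symmetric])
    ultimately show ?case by simp
  next
    case (exp_sum_add f g)
    then have "exp_sum (\<lambda>x. a * exp (- (\<theta> \<bullet> x)) * f x + a * exp (- (\<theta> \<bullet> x)) * g x)"
      by (intro exp_sum.exp_sum_add)
    then show ?case by (simp add: distrib_left)
  qed
next
  case (exp_sum_add f h)
  then have "exp_sum (\<lambda>x. f x * g x + h x * g x)" by (intro exp_sum.exp_sum_add)
  then show ?case by (simp add: distrib_right)
qed

text \<open>A linear form becomes a combination of terms whose theta is a basis vector, and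
  multiplying terms adds their exponents, so polynomials stay within the class.\<close>

lemma exp_sum_polynomial:
  fixes p :: "'a::euclidean_space \<Rightarrow> real"
  assumes "real_polynomial_function p"
  shows "exp_sum (\<lambda>x. p (\<Sum>b\<in>Basis. exp (- (x \<bullet> b)) *\<^sub>R b))"
  using assms
proof induction
  case (linear f)
  then interpret bounded_linear f .
  have "exp_sum (\<lambda>x. \<Sum>b\<in>Basis. f b * exp (- (b \<bullet> x)))"
    by (intro exp_sum_sum exp_sum_term finite_Basis) (auto simp: inner_Basis)
  then show ?case by (simp add: sum scaleR mult.commute inner_commute)
next
  case (const c)
  show ?case by (rule exp_sum_const)
next
  case (add f g)
  then show ?case by (intro exp_sum_add)
next
  case (mult f g)
  then show ?case by (intro exp_sum_mult)
qed

lemma exp_sum_integrable: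
  fixes M :: "'a::euclidean_space measure"
  assumes "exp_sum f" "finite_measure M" and sM[measurable_cong]: "sets M = sets borel"
    and pos: "AE x in M. \<forall>b\<in>Basis. 0 \<le> x \<bullet> b"
  shows "integrable M f"
  using assms(1)
proof induction
  case (exp_sum_term \<theta> a)
  interpret finite_measure M by fact
  show ?case
  proof (rule integrable_const_bound[where B="\<bar>a\<bar>"])
    show "AE x in M. norm (a * exp (- (\<theta> \<bullet> x))) \<le> \<bar>a\<bar>"
      using pos
    proof eventually_elim
      case (elim x)
      have "0 \<le> \<theta> \<bullet> x" 
        by (subst euclidean_inner) (intro sum_nonneg mult_nonneg_nonneg exp_sum_term elim[rule_format])
      then show ?case by (simp add: abs_mult mult_left_le)
    qed
  qed measurable
qed auto

text \<open>The map sending x to the vector of all exp (- x_b) carries the orthant into a compact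
  cube, where continuous functions are uniform limits of polynomials, that is, of exponential sums,
  whose integrals agree. So the images of both measures coincide, and a left inverse of the map
  brings the equality back.\<close>

lemma finite_measure_eqI_laplace:
  fixes M N :: "'a::euclidean_space measure"
  assumes fM: "finite_measure M" and fN: "finite_measure N"
    and sM[measurable_cong]: "sets M = sets borel" and sN[measurable_cong]: "sets N = sets borel"
    and pM: "AE x in M. \<forall>b\<in>Basis. 0 \<le> x \<bullet> b" and pN: "AE x in N. \<forall>b\<in>Basis. 0 \<le> x \<bullet> b"
    and eq: "\<And>\<theta>. (\<And>b. b \<in> Basis \<Longrightarrow> 0 \<le> \<theta> \<bullet> b) \<Longrightarrow>
      (\<integral>\<^sup>+x. ennreal (exp (- (\<theta> \<bullet> x))) \<partial>M) = (\<integral>\<^sup>+x. ennreal (exp (- (\<theta> \<bullet> x))) \<partial>N)"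
  shows "M = N"
proof -
  define E where "E x = (\<Sum>b\<in>Basis. exp (- (x \<bullet> b)) *\<^sub>R b)" for x :: 'a
  \<comment> \<open>Left inverse of \<open>E\<close> on the whole space; its values off the range of
    \<open>E\<close> are immaterial.\<close>
  define F where "F y = (\<Sum>b\<in>Basis. (- ln (y \<bullet> b)) *\<^sub>R b)" for y :: 'a
  have FE: "F (E x) = x" for x
    by (simp add: F_def E_def inner_sum_left inner_Basis if_distrib sum.delta euclidean_representation cong: if_cong)
  have E[measurable]: "E \<in> borel \<rightarrow>\<^sub>M borel" unfolding E_def by measurable
  have F[measurable]: "F \<in> borel \<rightarrow>\<^sub>M borel" unfolding F_def by measurable
  have fst_eq: "integral\<^sup>L M f = integral\<^sup>L N f" if "exp_sum f" for f
    using that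
  proof induction
    case (exp_sum_term \<theta> a)
    have "(\<integral>x. exp (- (\<theta> \<bullet> x)) \<partial>M) = (\<integral>x. exp (- (\<theta> \<bullet> x)) \<partial>N)"
      using eq[OF exp_sum_term] by (simp add: integral_eq_nn_integral)
    then show ?case by simp
  next
    case (exp_sum_add f g)
    then show ?case
      by (simp add: exp_sum_integrable[OF _ fM sM pM] exp_sum_integrable[OF _ fN sN pN])
  qed
  define Q where "Q = cbox (0::'a) One"
  have EQ: "E x \<in> Q" if "\<forall>b\<in>Basis. 0 \<le> x \<bullet> b" for x
    using that by (auto simp: Q_def mem_box E_def inner_sum_left inner_Basis if_distrib sum.delta cong: if_cong)
  interpret M: finite_measure M by fact
  interpret N: finite_measure N by fact
  have "distr M borel E = distr N borel E"
  proof (rule finite_measure_eqI_continuous)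
    show "finite_measure (distr M borel E)" by (rule M.finite_measure_distr) measurable
    fix f :: "'a \<Rightarrow> real" assume f: "continuous_on UNIV f" "\<And>x. 0 \<le> f x" "\<And>x. f x \<le> 1"
    have [measurable]: "f \<in> borel_measurable borel" using f(1) by (rule borel_measurable_continuous_onI)
    have int: "integrable L (\<lambda>x. f (E x))" if "finite_measure L" "sets L = sets borel" for L
    proof -
      interpret L: finite_measure L by fact
      note [measurable_cong] = that(2)
      show ?thesis by (rule L.integrable_const_bound[where B=1]) (use f in auto)
    qed
    have near: "\<bar>(\<integral>x. f (E x) \<partial>M) - (\<integral>x. f (E x) \<partial>N)\<bar> \<le> e * (measure M UNIV + measure N UNIV)" if e: "0 < e" for e
    proof -
      obtain p where p: "real_polynomial_function p" "\<And>x. x \<in> Q \<Longrightarrow> \<bar>f x - p x\<bar> < e"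
        using Stone_Weierstrass_real_polynomial_function[OF _ continuous_on_subset[OF f(1)] e, of Q]
        by (auto simp: Q_def)
      have es: "exp_sum (\<lambda>x. p (E x))" unfolding E_def by (rule exp_sum_polynomial[OF p(1)])
      have one: "\<bar>(\<integral>x. f (E x) \<partial>L) - (\<integral>x. p (E x) \<partial>L)\<bar> \<le> e * measure L UNIV"
        if L: "finite_measure L" "sets L = sets borel" "AE x in L. \<forall>b\<in>Basis. 0 \<le> x \<bullet> b" for L
      proof -
        interpret L: finite_measure L by fact
        have "\<bar>(\<integral>x. f (E x) \<partial>L) - (\<integral>x. p (E x) \<partial>L)\<bar> = \<bar>\<integral>x. f (E x) - p (E x) \<partial>L\<bar>"
          by (subst Bochner_Integration.integral_diff[OF int[OF L(1,2)] exp_sum_integrable[OF es L]]) simp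
        also have "\<dots> \<le> (\<integral>x. \<bar>f (E x) - p (E x)\<bar> \<partial>L)" by (rule integral_abs_bound)
        also have "\<dots> \<le> (\<integral>x. e \<partial>L)"
        proof (rule integral_mono_AE)
          show "integrable L (\<lambda>x. \<bar>f (E x) - p (E x)\<bar>)"
            using int[OF L(1,2)] exp_sum_integrable[OF es L] by auto
          show "AE x in L. \<bar>f (E x) - p (E x)\<bar> \<le> e"
            using L(3) by eventually_elim (use p(2) EQ in fastforce)
        qed auto
        finally show ?thesis using L(2) by (simp add: sets_eq_imp_space_eq mult.commute)
      qed
      have "\<bar>(\<integral>x. f (E x) \<partial>M) - (\<integral>x. f (E x) \<partial>N)\<bar> \<le> e * measure M UNIV + e * measure N UNIV"
        using one[OF fM sM pM] one[OF fN sN pN] fst_eq[OF es] by linarith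
      then show ?thesis by (simp add: distrib_left)
    qed
    have "(\<integral>x. f (E x) \<partial>M) = (\<integral>x. f (E x) \<partial>N)"
    proof (rule ccontr)
      define D where "D = \<bar>(\<integral>x. f (E x) \<partial>M) - (\<integral>x. f (E x) \<partial>N)\<bar>"
      define m where "m = measure M UNIV + measure N UNIV"
      assume "(\<integral>x. f (E x) \<partial>M) \<noteq> (\<integral>x. f (E x) \<partial>N)"
      then have D: "0 < D" by (simp add: D_def)
      have m: "0 \<le> m" by (simp add: m_def)
      \<comment> \<open>The \<open>+ 1\<close> covers total mass 0, and the factor 2 leaves a bound
        below \<open>D\<close>.\<close>
      have e: "0 < D / (2 * (m + 1))" using D m by simp
      have "D \<le> D / (2 * (m + 1)) * m"
        using near[OF e] by (simp only: D_def[symmetric] m_def[symmetric])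
      also have "\<dots> = D * (m / (2 * (m + 1)))" by simp
      also have "\<dots> < D * 1" using D m by (intro mult_strict_left_mono) (auto simp: field_simps)
      finally show False by simp
    qed
    then have "(\<integral>\<^sup>+x. ennreal (f (E x)) \<partial>M) = (\<integral>\<^sup>+x. ennreal (f (E x)) \<partial>N)"
      using int[OF fM sM] int[OF fN sN] f(2) by (simp add: nn_integral_eq_integral)
    then show "(\<integral>\<^sup>+x. ennreal (f x) \<partial>distr M borel E) = (\<integral>\<^sup>+x. ennreal (f x) \<partial>distr N borel E)"
      by (simp add: nn_integral_distr)
  qed auto
  then have "distr (distr M borel E) borel F = distr (distr N borel E) borel F" by simp
  then have "distr M borel (\<lambda>x. x) = distr N borel (\<lambda>x. x)"
    by (simp add: distr_distr comp_def FE)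
  then show ?thesis using sM sN by (simp add: distr_id2)
qed

subsection \<open>Disintegration\<close>

text \<open>Base-4 expansions with digits 0 and 1: digit extraction is then unambiguous.\<close>

definition digits_sum :: "(nat \<Rightarrow> real) \<Rightarrow> real" where
  "digits_sum d = (\<Sum>j. d j * (1/4) ^ Suc j)"

primrec digit_shift :: "nat \<Rightarrow> real \<Rightarrow> real" where
  "digit_shift 0 r = r"
| "digit_shift (Suc k) r = frac (4 * digit_shift k r)"

lemma digits_sum_summable:
  assumes "\<And>j. d j \<in> {0, 1}"
  shows "summable (\<lambda>j. d j * (1/4::real) ^ Suc j)"
proof (rule summable_comparison_test')
  show "summable (\<lambda>j. (1/4::real) ^ j)" by simp
  show "norm (d j * (1/4) ^ Suc j) \<le> (1/4) ^ j" for j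
    using assms[of j] by auto
qed

lemma digits_sum_bounds:
  assumes "\<And>j. d j \<in> {0, 1}"
  shows "0 \<le> digits_sum d" "digits_sum d < 1"
proof -
  have nn: "0 \<le> d j" "d j \<le> 1" for j using assms[of j] by auto
  show "0 \<le> digits_sum d" unfolding digits_sum_def
    by (rule suminf_nonneg[OF digits_sum_summable[OF assms]]) (use nn in simp)
  have s: "(\<lambda>j. (1/4::real) ^ j) sums (1 / (1 - 1/4))" by (rule geometric_sums) simp
  then have s': "(\<lambda>j. (1/4::real) ^ Suc j) sums (1 / 3)"
    using sums_mult[OF s, of "1/4"] by simp
  have "digits_sum d \<le> (\<Sum>j. (1/4::real) ^ Suc j)" unfolding digits_sum_def
    by (rule suminf_le[OF _ digits_sum_summable[OF assms] sums_summable[OF s']])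
      (use nn in \<open>auto intro!: mult_left_le_one_le\<close>)
  then show "digits_sum d < 1" using sums_unique[OF s'] by simp
qed

lemma digits_sum_rec:
  assumes "\<And>j. d j \<in> {0, 1}"
  shows "4 * digits_sum d = d 0 + digits_sum (\<lambda>j. d (Suc j))"
proof -
  have "digits_sum d = (\<Sum>j. d (Suc j) * (1/4) ^ Suc (Suc j)) + d 0 * (1/4)"
    unfolding digits_sum_def
    using suminf_split_head[where f="\<lambda>j. d j * (1/4) ^ Suc j", OF digits_sum_summable[OF assms]]
    by simp
  also have "(\<Sum>j. d (Suc j) * (1/4::real) ^ Suc (Suc j)) = (\<Sum>j. (1/4) * (d (Suc j) * (1/4) ^ Suc j))"
    by (simp add: mult_ac)
  also have "\<dots> = (1/4) * digits_sum (\<lambda>j. d (Suc j))"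
    unfolding digits_sum_def by (rule suminf_mult[OF digits_sum_summable]) (use assms in auto)
  finally show ?thesis by simp
qed

text \<open>Multiplying by 4 and dropping the integer part deletes the leading digit, since the
  remaining tail is below 1.\<close>

lemma digit_shift_digits_sum:
  assumes "\<And>j. d j \<in> {0, 1}"
  shows "digit_shift k (digits_sum d) = digits_sum (\<lambda>j. d (j + k))"
proof (induction k)
  case (Suc k)
  have d: "d (j + k) \<in> {0, 1}" for j k by (rule assms)
  have "4 * digits_sum (\<lambda>j. d (j + k)) = d k + digits_sum (\<lambda>j. d (j + Suc k))"
    using digits_sum_rec[of "\<lambda>j. d (j + k)", OF d] by simp
  moreover have "frac (d k + r) = r" if "0 \<le> r" "r < 1" for r :: real
  proof -
    have "frac (r + d k) = frac r" using assms[of k] by (auto simp: frac_1_eq)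
    then show ?thesis using that by (simp add: frac_eq add.commute)
  qed
  ultimately show ?case
    using digits_sum_bounds[of "\<lambda>j. d (j + Suc k)", OF d] Suc by simp
qed simp

text \<open>Four times the shifted number is the digit plus a tail in [0, 1), so comparison with 1
  reads off the digit.\<close>

lemma digit_digits_sum:
  assumes "\<And>j. d j \<in> {0, 1}"
  shows "1 \<le> 4 * digit_shift k (digits_sum d) \<longleftrightarrow> d k = 1"
proof -
  have d: "d (j + k) \<in> {0, 1}" for j k by (rule assms)
  have "4 * digit_shift k (digits_sum d) = d k + digits_sum (\<lambda>j. d (j + Suc k))"
    using digits_sum_rec[of "\<lambda>j. d (j + k)", OF d] digit_shift_digits_sum[OF assms] by simp
  then show ?thesis
    using digits_sum_bounds[of "\<lambda>j. d (j + Suc k)", OF d] assms[of k] by auto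
qed

text \<open>A vector is encoded by the answers to the countably many questions whether x_b < q, for
  basis vectors b and rationals q, written as digits. Each coordinate is recovered as the infimum of
  the rationals answered with yes. This reduces kernels on a Euclidean space to kernels on [0, 1),
  where quantile functions are available.\<close>

lemma borel_embedding_unit_interval:
  obtains \<phi> :: "'a::euclidean_space \<Rightarrow> real" and \<psi> :: "real \<Rightarrow> 'a"
  where "\<phi> \<in> borel_measurable borel" "\<psi> \<in> borel_measurable borel"
    "\<And>x. 0 \<le> \<phi> x" "\<And>x. \<phi> x < 1" "\<And>x. \<psi> (\<phi> x) = x"
proof -
  define I where "I = (Basis :: 'a set) \<times> (\<rat> :: real set)"
  have cI: "countable I" unfolding I_def by (intro countable_SIGMA countable_rat) (simp add: countable_finite)
  have neI: "I \<noteq> {}" by (auto simp: I_def intro!: exI[of _ 0])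
  define e where "e = from_nat_into I"
  have e: "range e = I" unfolding e_def using cI neI by (simp add: range_from_nat_into)
  define d where "d x j = (if x \<bullet> fst (e j) < snd (e j) then 1 else 0 :: real)" for x :: 'a and j
  define \<phi> where "\<phi> x = digits_sum (d x)" for x
  \<comment> \<open>Indices with digit 0 contribute infinity and do not affect the infimum.
    Arguments outside the range of \<open>\<phi>\<close> receive some value, which does no harm to
    measurability.\<close>
  define \<psi> where "\<psi> r = (\<Sum>b\<in>Basis. real_of_ereal
      (INF j\<in>{j. fst (e j) = b}. if 1 \<le> 4 * digit_shift j r then ereal (snd (e j)) else \<infinity>) *\<^sub>R b)" for r
  have d01: "d x j \<in> {0, 1}" for x j by (simp add: d_def)
  have [measurable]: "(\<lambda>x. d x j) \<in> borel_measurable borel" for j unfolding d_def by measurable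
  have [measurable]: "digit_shift j \<in> borel_measurable borel" for j
    by (induction j) (auto simp: frac_def)
  have [measurable]: "Measurable.pred borel (\<lambda>r. 1 \<le> 4 * digit_shift j r)" for j by measurable
  have [measurable]: "(\<lambda>r. INF j\<in>{j. fst (e j) = b}. if 1 \<le> 4 * digit_shift j r
      then ereal (snd (e j)) else \<infinity>) \<in> borel_measurable borel" for b
    by (intro borel_measurable_INF countableI_type) measurable
  show ?thesis
  proof (rule that[of \<phi> \<psi>])
    show "\<phi> \<in> borel_measurable borel" unfolding \<phi>_def digits_sum_def by measurable
    show "\<psi> \<in> borel_measurable borel" unfolding \<psi>_def by measurable
    show "0 \<le> \<phi> x" "\<phi> x < 1" for x using digits_sum_bounds[of "d x", OF d01] by (auto simp: \<phi>_def)
    fix x :: 'a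
    have "(INF j\<in>{j. fst (e j) = b}. if 1 \<le> 4 * digit_shift j (\<phi> x) then ereal (snd (e j)) else \<infinity>)
        = ereal (x \<bullet> b)" if b: "b \<in> Basis" for b
    proof (rule antisym)
      have iff: "1 \<le> 4 * digit_shift j (\<phi> x) \<longleftrightarrow> x \<bullet> fst (e j) < snd (e j)" for j
        unfolding \<phi>_def using digit_digits_sum[of "d x" j, OF d01] by (auto simp: d_def)
      show "ereal (x \<bullet> b) \<le> (INF j\<in>{j. fst (e j) = b}.
          if 1 \<le> 4 * digit_shift j (\<phi> x) then ereal (snd (e j)) else \<infinity>)"
        by (rule INF_greatest) (auto simp: iff)
      show "(INF j\<in>{j. fst (e j) = b}.
          if 1 \<le> 4 * digit_shift j (\<phi> x) then ereal (snd (e j)) else \<infinity>) \<le> ereal (x \<bullet> b)"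
      proof (rule ereal_le_epsilon2)
        fix \<epsilon> :: real assume "0 < \<epsilon>"
        then obtain q where q: "q \<in> \<rat>" "x \<bullet> b < q" "q < x \<bullet> b + \<epsilon>"
          using Rats_dense_in_real[of "x \<bullet> b" "x \<bullet> b + \<epsilon>"] by auto
        then have "(b, q) \<in> range e" using b by (simp add: e I_def)
        then obtain j where j: "e j = (b, q)" by (metis imageE)
        have "(INF j\<in>{j. fst (e j) = b}.
            if 1 \<le> 4 * digit_shift j (\<phi> x) then ereal (snd (e j)) else \<infinity>) \<le> ereal q"
          by (rule INF_lower2[of j]) (use j q iff[of j] in auto)
        also have "\<dots> \<le> ereal (x \<bullet> b) + ereal \<epsilon>" using q by simp
        finally show "(INF j\<in>{j. fst (e j) = b}.
            if 1 \<le> 4 * digit_shift j (\<phi> x) then ereal (snd (e j)) else \<infinity>) \<le> ereal (x \<bullet> b) + ereal \<epsilon>" .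
      qed
    qed
    then show "\<psi> (\<phi> x) = x" by (simp add: \<psi>_def euclidean_representation)
  qed
qed

text \<open>Tested on the set A where g < f: the nonnegative function f - g has integral 0 over A
  and so vanishes there almost everywhere. The finite integral of g permits the subtraction in
  \<open>ennreal\<close>.\<close>

lemma AE_le_of_density_le:
  assumes "finite_measure M" and [measurable]: "f \<in> borel_measurable M" "g \<in> borel_measurable M"
    and fin: "(\<integral>\<^sup>+x. g x \<partial>M) < \<infinity>"
    and le: "\<And>A. A \<in> sets M \<Longrightarrow> (\<integral>\<^sup>+x\<in>A. f x \<partial>M) \<le> (\<integral>\<^sup>+x\<in>A. g x \<partial>M)"
  shows "AE x in M. f x \<le> (g x :: ennreal)"
proof -
  define A where "A = {x \<in> space M. g x < f x}"
  have [measurable]: "A \<in> sets M" unfolding A_def by measurable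
  have "(\<integral>\<^sup>+x\<in>A. g x \<partial>M) \<le> (\<integral>\<^sup>+x. g x \<partial>M)"
    by (intro nn_integral_mono) (auto simp: indicator_def)
  then have finA: "(\<integral>\<^sup>+x\<in>A. g x \<partial>M) \<noteq> \<infinity>" using fin by (auto simp: top_unique less_top)
  have "(\<integral>\<^sup>+x. f x * indicator A x - g x * indicator A x \<partial>M) =
      (\<integral>\<^sup>+x\<in>A. f x \<partial>M) - (\<integral>\<^sup>+x\<in>A. g x \<partial>M)"
    by (rule nn_integral_diff) (use finA in \<open>auto simp: A_def indicator_def\<close>)
  also have "\<dots> = 0" using le[of A] finA by (intro diff_eq_0_ennreal) (auto simp: less_top[symmetric] top_unique)
  finally have "AE x in M. f x * indicator A x - g x * indicator A x = 0"
    by (simp add: nn_integral_0_iff_AE)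
  then show ?thesis
    using AE_space
  proof eventually_elim
    case (elim x)
    show ?case
    proof (rule ccontr)
      assume "\<not> f x \<le> g x"
      then have "x \<in> A" using elim by (simp add: A_def not_le)
      with elim have "f x - g x = 0" by simp
      then show False using \<open>\<not> f x \<le> g x\<close>
        by (metis diff_eq_0_iff_ennreal not_le order.strict_implies_order)
    qed
  qed
qed

text \<open>The kernel is the image of Lebesgue measure on the unit interval under the conditional
  quantile functions; the distribution functions enter only at rational points.\<close>

lemma disintegration:
  fixes \<mu> :: "('a::second_countable_topology \<times> 'b::euclidean_space) measure"
  assumes fin: "finite_measure \<mu>" and s\<mu>[measurable_cong]: "sets \<mu> = sets borel"
  obtains \<kappa> where "\<kappa> \<in> borel \<rightarrow>\<^sub>M prob_algebra borel"
    "\<And>C. C \<in> sets borel \<Longrightarrow>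
      emeasure \<mu> C = (\<integral>\<^sup>+t. emeasure (\<kappa> t) {u. (t, u) \<in> C} \<partial>distr \<mu> borel fst)"
proof -
  interpret finite_measure \<mu> by fact
  have [simp]: "space \<mu> = UNIV" using s\<mu> by (auto dest: sets_eq_imp_space_eq)
  have [measurable]: "fst \<in> \<mu> \<rightarrow>\<^sub>M (borel :: 'a measure)" "snd \<in> \<mu> \<rightarrow>\<^sub>M (borel :: 'b measure)"
    by (simp_all add: measurable_cong_sets[OF s\<mu> refl] borel_prod[symmetric])
  obtain \<phi> :: "'b \<Rightarrow> real" and \<psi> where \<phi>[measurable]: "\<phi> \<in> borel_measurable borel"
    and \<psi>[measurable]: "\<psi> \<in> borel_measurable borel"
    and \<phi>0: "\<And>x. 0 \<le> \<phi> x" and \<phi>1: "\<And>x. \<phi> x < 1" and \<psi>\<phi>: "\<And>x. \<psi> (\<phi> x) = x"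
    using borel_embedding_unit_interval by metis
  define \<mu>1 where "\<mu>1 = distr \<mu> borel fst"
  interpret m1: finite_measure \<mu>1 unfolding \<mu>1_def by (rule finite_measure_distr) measurable
  have [simp]: "space \<mu>1 = UNIV" and [measurable_cong, simp]: "sets \<mu>1 = sets borel" by (simp_all add: \<mu>1_def)
  \<comment> \<open>\<open>\<nu> q\<close> is the first marginal restricted to the event that the
    coded second coordinate is below q; its density \<open>F q\<close> is the conditional
    distribution function at q.\<close>
  define \<nu> where "\<nu> q = distr (density \<mu> (\<lambda>z. indicator {..<q} (\<phi> (snd z)))) borel fst" for q :: real
  define F where "F q = RN_deriv \<mu>1 (\<nu> q)" for q
  have F[measurable]: "F q \<in> borel_measurable borel" for q
    using borel_measurable_RN_deriv[of \<mu>1 "\<nu> q"] by (simp add: F_def)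
  have \<nu>: "emeasure (\<nu> q) A = emeasure \<mu> {z. fst z \<in> A \<and> \<phi> (snd z) < q}" if [measurable]: "A \<in> sets borel" for q A
  proof -
    have S[measurable]: "fst -` A \<in> sets \<mu>" using measurable_sets[of fst \<mu> borel A] by simp
    have T: "{z. fst z \<in> A \<and> \<phi> (snd z) < q} \<in> sets \<mu>"
    proof -
      have "{z \<in> space \<mu>. fst z \<in> A \<and> \<phi> (snd z) < q} \<in> sets \<mu>" by measurable
      then show ?thesis by simp
    qed
    have "emeasure (\<nu> q) A = (\<integral>\<^sup>+z. indicator {z. fst z \<in> A \<and> \<phi> (snd z) < q} z \<partial>\<mu>)"
      unfolding \<nu>_def using S
      by (auto simp: emeasure_distr emeasure_density indicator_def intro!: nn_integral_cong)
    then show ?thesis using T by simp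
  qed
  have m1: "emeasure \<mu>1 A = emeasure \<mu> {z. fst z \<in> A}" if "A \<in> sets borel" for A
    using that by (simp add: \<mu>1_def emeasure_distr vimage_def)
  have F\<nu>: "(\<integral>\<^sup>+t\<in>A. F q t \<partial>\<mu>1) = emeasure \<mu> {z. fst z \<in> A \<and> \<phi> (snd z) < q}"
    if A[measurable]: "A \<in> sets borel" for q A
  proof -
    have "absolutely_continuous \<mu>1 (\<nu> q)"
      unfolding absolutely_continuous_def null_sets_def
    proof (safe)
      fix N assume N: "N \<in> sets \<mu>1" "emeasure \<mu>1 N = 0"
      then have N': "N \<in> sets borel" by simp
      show "N \<in> sets (\<nu> q)" using N' by (simp add: \<nu>_def)
      have "emeasure \<mu> {z. fst z \<in> N \<and> \<phi> (snd z) < q} \<le> emeasure \<mu> {z. fst z \<in> N}"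
        by (rule emeasure_mono) (use measurable_sets[of fst \<mu> borel N] N' in \<open>auto simp: vimage_def\<close>)
      then show "emeasure (\<nu> q) N = 0" using N m1[OF N'] \<nu>[OF N'] by simp
    qed
    then have "density \<mu>1 (F q) = \<nu> q" unfolding F_def
      by (rule m1.density_RN_deriv) (simp add: \<nu>_def)
    then have "emeasure (density \<mu>1 (F q)) A = emeasure (\<nu> q) A" by simp
    then show ?thesis by (simp add: emeasure_density \<nu>)
  qed
  have setF: "{z. fst z \<in> A \<and> \<phi> (snd z) < q} \<in> sets \<mu>" if [measurable]: "A \<in> sets borel" for A q
  proof -
    have "{z \<in> space \<mu>. fst z \<in> A \<and> \<phi> (snd z) < q} \<in> sets \<mu>" by measurable
    then show ?thesis by simp
  qed
  \<comment> \<open>Bounds and monotonicity hold off a null set that depends on q or on the pair q,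
    q'; only countably many rational q are ever used together.\<close>
  have AE1: "AE t in \<mu>1. F q t \<le> 1" for q
  proof (rule AE_le_of_density_le)
    fix A assume A: "A \<in> sets \<mu>1"
    then have A': "A \<in> sets borel" by simp
    have "emeasure \<mu> {z. fst z \<in> A \<and> \<phi> (snd z) < q} \<le> emeasure \<mu> {z. fst z \<in> A}"
      by (rule emeasure_mono) (use measurable_sets[of fst \<mu> borel A] A' in \<open>auto simp: vimage_def\<close>)
    then show "(\<integral>\<^sup>+t\<in>A. F q t \<partial>\<mu>1) \<le> (\<integral>\<^sup>+t\<in>A. 1 \<partial>\<mu>1)"
      using A' F\<nu>[OF A'] m1[OF A'] by simp
  qed (auto simp: less_top[symmetric] m1.finite_measure_axioms)
  have AE2: "AE t in \<mu>1. F q t \<le> F q' t" if "q \<le> q'" for q q'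
  proof (rule AE_le_of_density_le)
    show "(\<integral>\<^sup>+t. F q' t \<partial>\<mu>1) < \<infinity>" using F\<nu>[of UNIV q'] by (simp add: less_top[symmetric])
    fix A assume A: "A \<in> sets \<mu>1"
    then have A': "A \<in> sets borel" by simp
    show "(\<integral>\<^sup>+t\<in>A. F q t \<partial>\<mu>1) \<le> (\<integral>\<^sup>+t\<in>A. F q' t \<partial>\<mu>1)"
      unfolding F\<nu>[OF A'] by (rule emeasure_mono) (use setF[OF A'] that in auto)
  qed (auto simp: m1.finite_measure_axioms)
  define R where "R = \<rat> \<inter> {0..1::real}"
  have cR: "countable R" unfolding R_def using countable_rat by (rule countable_subset[rotated]) auto
  have R0: "0 \<in> R" by (simp add: R_def)
  \<comment> \<open>Generalised inverse of the conditional distribution function. The default 1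
    never counts as being below a threshold x with x \<le> 1.\<close>
  define Q where "Q t w = (INF q\<in>R. if ennreal w \<le> F q t then q else 1)" for t w
  have bdd: "bdd_below ((\<lambda>q. if ennreal w \<le> F q t then q else 1) ` R)" for t w
    by (rule bdd_belowI[of _ 0]) (auto simp: R_def)
  have Qless: "Q t w < x \<longleftrightarrow> 1 < x \<or> (\<exists>q\<in>R. q < x \<and> ennreal w \<le> F q t)" for t w x
    unfolding Q_def using R0
    by (subst cINF_less_iff[OF _ bdd]) (auto simp: R_def)
  define U where "U = uniform_measure lborel {0..1::real}"
  interpret U: prob_space U unfolding U_def by (rule prob_space_uniform_measure) auto
  have [measurable_cong, simp]: "sets U = sets borel" and [simp]: "space U = UNIV" by (simp_all add: U_def)
  have Q[measurable]: "(\<lambda>z. Q (fst z) (snd z)) \<in> borel_measurable (borel \<Otimes>\<^sub>M borel)"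
    unfolding Q_def by (rule borel_measurable_cINF[OF cR _ bdd]) (use R0 in auto)
  interpret P: pair_sigma_finite \<mu>1 U ..
  have UF: "emeasure U {w. ennreal w \<le> s} = s" if s1: "s \<le> 1" for s :: ennreal
  proof -
    obtain r where r: "s = ennreal r" "0 \<le> r" "r \<le> 1"
      using s1 by (cases s) (auto simp: ennreal_le_1 ennreal_top_neq_one top_unique)
    have "{0..1} \<inter> {w. ennreal w \<le> s} = {0..r}" using r by (auto simp: ennreal_le_iff)
    moreover have "{w. ennreal w \<le> s} \<in> sets borel" by measurable
    ultimately show ?thesis using r by (simp add: U_def divide_ennreal_def)
  qed
  \<comment> \<open>The crucial identity: under uniform w the quantile \<open>Q t w\<close> falls
    below x with the same weight as the coded coordinate.\<close>
  have level: "(\<integral>\<^sup>+t\<in>A. emeasure U {w. Q t w < x} \<partial>\<mu>1) = emeasure \<mu> {z. fst z \<in> A \<and> \<phi> (snd z) < x}"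
    if A[measurable]: "A \<in> sets borel" for A x
  proof (cases "1 < x \<or> x \<le> 0")
    case True
    then show ?thesis
    proof
      assume x: "1 < x"
      then have "{w. Q t w < x} = UNIV" for t by (auto simp: Qless)
      moreover have "{z. fst z \<in> A \<and> \<phi> (snd z) < x} = {z. fst z \<in> A}" using \<phi>1 x
        by (auto intro: less_trans)
      ultimately show ?thesis using U.emeasure_space_1 by (simp add: m1)
    next
      assume x: "x \<le> 0"
      then have e1: "{w. Q t w < x} = {}" for t by (auto simp: Qless R_def)
      have e2: "{z. fst z \<in> A \<and> \<phi> (snd z) < x} = {}" using \<phi>0 x
        by (auto simp: not_less intro: order_trans)
      show ?thesis unfolding e1 e2 by simp
    qed
  next
    case False
    define I where "I = {q\<in>R. q < x}"
    have I: "countable I" "I \<noteq> {}" using cR R0 False by (auto simp: I_def intro: countable_subset[of _ R])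
    define e where "e = from_nat_into I"
    have re: "range e = I" unfolding e_def using I by (simp add: range_from_nat_into)
    \<comment> \<open>Running maxima of an enumeration of the rationals below x turn the union over
      q into an increasing one, so that suprema pass through measures and integrals.\<close>
    define m where "m n = Max (e ` {..n})" for n :: nat
    have mI: "m n \<in> I" for n
    proof -
      have "m n \<in> e ` {..n}" unfolding m_def by (rule Max_in) auto
      then show ?thesis using re by auto
    qed
    have m_inc: "m n \<le> m n'" if "n \<le> n'" for n n'
      unfolding m_def by (rule Max_mono) (use that in auto)
    have em: "e n \<le> m n" for n unfolding m_def by (rule Max_ge) auto
    have "AE t in \<mu>1. (\<forall>n. F (m n) t \<le> 1) \<and> (\<forall>n n'. n \<le> n' \<longrightarrow> F (m n) t \<le> F (m n') t)
        \<and> (\<forall>n. F (e n) t \<le> F (m n) t)"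
      using AE1 AE2[OF m_inc] AE2[OF em] by (auto simp: AE_all_countable)
    then have key: "AE t in \<mu>1. emeasure U {w. Q t w < x} = (SUP n. F (m n) t) \<and> incseq (\<lambda>n. F (m n) t)"
    proof eventually_elim
      case (elim t)
      have "{w. Q t w < x} = (\<Union>n. {w. ennreal w \<le> F (m n) t})"
      proof (intro set_eqI iffI)
        fix w assume "w \<in> {w. Q t w < x}"
        then obtain q where q: "q \<in> I" "ennreal w \<le> F q t" using False by (auto simp: Qless I_def)
        then obtain n where "q = e n" using re by (metis imageE)
        then show "w \<in> (\<Union>n. {w. ennreal w \<le> F (m n) t})" using q elim order_trans[of "ennreal w" "F (e n) t" "F (m n) t"] by auto
      next
        fix w assume "w \<in> (\<Union>n. {w. ennreal w \<le> F (m n) t})"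
        then show "w \<in> {w. Q t w < x}" using mI by (auto simp: Qless I_def)
      qed
      moreover have "(SUP n. emeasure U {w. ennreal w \<le> F (m n) t}) = emeasure U (\<Union>n. {w. ennreal w \<le> F (m n) t})"
        by (rule SUP_emeasure_incseq) (use elim in \<open>auto simp: incseq_def intro: order_trans\<close>)
      ultimately show ?case using elim by (simp add: UF incseq_def)
    qed
    have "(\<integral>\<^sup>+t\<in>A. emeasure U {w. Q t w < x} \<partial>\<mu>1) = (\<integral>\<^sup>+t. (SUP n. F (m n) t * indicator A t) \<partial>\<mu>1)"
      by (rule nn_integral_cong_AE) (use key in eventually_elim, simp add: SUP_mult_right_ennreal)
    also have "\<dots> = (SUP n. \<integral>\<^sup>+t\<in>A. F (m n) t \<partial>\<mu>1)"
    proof (rule nn_integral_monotone_convergence_SUP_AE)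
      show "AE t in \<mu>1. F (m i) t * indicator A t \<le> F (m (Suc i)) t * indicator A t" for i
        using key by eventually_elim (auto simp: incseq_def intro!: mult_right_mono)
    qed measurable
    also have "\<dots> = (SUP n. emeasure \<mu> {z. fst z \<in> A \<and> \<phi> (snd z) < m n})" by (simp add: F\<nu>)
    also have "\<dots> = emeasure \<mu> (\<Union>n. {z. fst z \<in> A \<and> \<phi> (snd z) < m n})"
      by (rule SUP_emeasure_incseq) (use setF m_inc in \<open>auto simp: incseq_def intro: less_le_trans\<close>)
    also have "(\<Union>n. {z. fst z \<in> A \<and> \<phi> (snd z) < m n}) = {z. fst z \<in> A \<and> \<phi> (snd z) < x}"
    proof (intro set_eqI iffI)
      fix z assume "z \<in> {z. fst z \<in> A \<and> \<phi> (snd z) < x}"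
      then have z: "fst z \<in> A" "\<phi> (snd z) < x" by auto
      obtain q where q: "q \<in> \<rat>" "\<phi> (snd z) < q" "q < x" using Rats_dense_in_real[OF z(2)] by auto
      then have "q \<in> I" using \<phi>0[of "snd z"] False by (auto simp: I_def R_def)
      then obtain n where "q = e n" using re by (metis imageE)
      then show "z \<in> (\<Union>n. {z. fst z \<in> A \<and> \<phi> (snd z) < m n})" using q em[of n] z(1) by (auto intro: less_le_trans)
    next
      fix z assume "z \<in> (\<Union>n. {z. fst z \<in> A \<and> \<phi> (snd z) < m n})"
      then obtain n where n: "fst z \<in> A" "\<phi> (snd z) < m n" by auto
      then show "z \<in> {z. fst z \<in> A \<and> \<phi> (snd z) < x}" using mI[of n] by (simp add: I_def)
    qed
    finally show ?thesis .
  qed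
  \<comment> \<open>\<open>L\<close> is the law produced by the quantile functions,
    \<open>L'\<close> the given law after coding; \<open>level\<close> compares them on products
    with half-lines.\<close>
  define L where "L = distr (\<mu>1 \<Otimes>\<^sub>M U) borel (\<lambda>z. (fst z, Q (fst z) (snd z)))"
  define L' where "L' = distr \<mu> borel (\<lambda>z. (fst z, \<phi> (snd z)))"
  have setsP: "sets (\<mu>1 \<Otimes>\<^sub>M U) = sets (borel \<Otimes>\<^sub>M borel)" by (intro sets_pair_measure_cong) auto
  have Q'[measurable]: "(\<lambda>z. (fst z, Q (fst z) (snd z))) \<in> (\<mu>1 \<Otimes>\<^sub>M U) \<rightarrow>\<^sub>M (borel \<Otimes>\<^sub>M borel)"
    unfolding measurable_cong_sets[OF setsP refl] by measurable
  have Q''[measurable]: "(\<lambda>z. (fst z, Q (fst z) (snd z))) \<in> (\<mu>1 \<Otimes>\<^sub>M U) \<rightarrow>\<^sub>M borel"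
    using Q' by (simp add: borel_prod)
  have \<phi>'[measurable]: "(\<lambda>z. (fst z, \<phi> (snd z))) \<in> \<mu> \<rightarrow>\<^sub>M borel"
    unfolding borel_prod[symmetric] by measurable
  have Qt[measurable]: "Q t \<in> borel_measurable borel" for t
    using measurable_compose[OF measurable_Pair1'[of t borel borel] Q] by simp
  have LC: "emeasure L C = (\<integral>\<^sup>+t. emeasure U {w. (t, Q t w) \<in> C} \<partial>\<mu>1)" if C: "C \<in> sets borel" for C
  proof -
    have "emeasure L C = emeasure (\<mu>1 \<Otimes>\<^sub>M U) ((\<lambda>z. (fst z, Q (fst z) (snd z))) -` C \<inter> space (\<mu>1 \<Otimes>\<^sub>M U))"
      unfolding L_def by (rule emeasure_distr[OF Q'' C])
    also have "\<dots> = (\<integral>\<^sup>+t. emeasure U (Pair t -` ((\<lambda>z. (fst z, Q (fst z) (snd z))) -` C \<inter> space (\<mu>1 \<Otimes>\<^sub>M U))) \<partial>\<mu>1)"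
      by (rule U.emeasure_pair_measure_alt) (rule measurable_sets[OF Q'' C])
    finally show ?thesis by (simp add: vimage_def space_pair_measure)
  qed
  have "L = L'"
  proof (rule finite_measure_eqI_rectangles)
    interpret PU: finite_measure "\<mu>1 \<Otimes>\<^sub>M U"
      by (rule finite_measure_pair_measure) unfold_locales
    show "finite_measure L" unfolding L_def by (rule PU.finite_measure_distr[OF Q''])
    show "sets L = sets borel" "sets L' = sets borel" by (simp_all add: L_def L'_def)
    fix A :: "'a set" and B :: "real set" assume A[measurable]: "A \<in> sets borel" and B: "B \<in> sets borel"
    define K1 where "K1 = distr (density \<mu> (\<lambda>z. indicator A (fst z))) borel (\<lambda>z. \<phi> (snd z))"
    define K2 where "K2 = distr (density (\<mu>1 \<Otimes>\<^sub>M U) (\<lambda>z. indicator A (fst z))) borel (\<lambda>z. Q (fst z) (snd z))"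
    have Qs[measurable]: "(\<lambda>z. Q (fst z) (snd z)) \<in> (\<mu>1 \<Otimes>\<^sub>M U) \<rightarrow>\<^sub>M borel"
      unfolding measurable_cong_sets[OF setsP refl] by (rule Q)
    have K1: "emeasure K1 B = emeasure L' (A \<times> B)" if [measurable]: "B \<in> sets borel" for B
    proof -
      have S: "(\<lambda>z. \<phi> (snd z)) -` B \<in> sets \<mu>"
        using measurable_sets[of "\<lambda>z. \<phi> (snd z)" \<mu> borel B] by simp
      have T: "(\<lambda>z. (fst z, \<phi> (snd z))) -` (A \<times> B) \<in> sets \<mu>"
        using measurable_sets[OF \<phi>', of "A \<times> B"] by (simp add: borel_Times)
      have "emeasure K1 B = (\<integral>\<^sup>+z. indicator A (fst z) * indicator ((\<lambda>z. \<phi> (snd z)) -` B) z \<partial>\<mu>)"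
        unfolding K1_def using S by (subst emeasure_distr) (auto simp: emeasure_density)
      also have "\<dots> = (\<integral>\<^sup>+z. indicator ((\<lambda>z. (fst z, \<phi> (snd z))) -` (A \<times> B)) z \<partial>\<mu>)"
        by (rule nn_integral_cong) (auto simp: indicator_def)
      also have "\<dots> = emeasure L' (A \<times> B)"
        unfolding L'_def using T by (simp add: emeasure_distr borel_Times)
      finally show ?thesis .
    qed
    have K2: "emeasure K2 B = emeasure L (A \<times> B)" if [measurable]: "B \<in> sets borel" for B
    proof -
      have S: "(\<lambda>z. Q (fst z) (snd z)) -` B \<inter> space (\<mu>1 \<Otimes>\<^sub>M U) \<in> sets (\<mu>1 \<Otimes>\<^sub>M U)"
        by (rule measurable_sets[OF Qs]) simp
      have T: "(\<lambda>z. (fst z, Q (fst z) (snd z))) -` (A \<times> B) \<inter> space (\<mu>1 \<Otimes>\<^sub>M U) \<in> sets (\<mu>1 \<Otimes>\<^sub>M U)"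
        by (rule measurable_sets[OF Q'']) (simp add: borel_Times)
      have "emeasure K2 B = (\<integral>\<^sup>+z. indicator A (fst z) * indicator ((\<lambda>z. Q (fst z) (snd z)) -` B \<inter> space (\<mu>1 \<Otimes>\<^sub>M U)) z \<partial>(\<mu>1 \<Otimes>\<^sub>M U))"
        unfolding K2_def using S by (subst emeasure_distr) (auto simp: emeasure_density)
      also have "\<dots> = (\<integral>\<^sup>+z. indicator ((\<lambda>z. (fst z, Q (fst z) (snd z))) -` (A \<times> B) \<inter> space (\<mu>1 \<Otimes>\<^sub>M U)) z \<partial>(\<mu>1 \<Otimes>\<^sub>M U))"
        by (rule nn_integral_cong) (auto simp: indicator_def)
      also have "\<dots> = emeasure L (A \<times> B)"
        unfolding L_def using T by (simp add: emeasure_distr borel_Times)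
      finally show ?thesis .
    qed
    have "K2 = K1"
    proof (rule measure_eqI_generator_eq[where E="range lessThan" and \<Omega>=UNIV and A="\<lambda>n. {..<real n}"])
      show "Int_stable (range lessThan :: real set set)"
      proof (rule Int_stableI)
        fix a b :: "real set" assume "a \<in> range lessThan" "b \<in> range lessThan"
        then obtain u v where "a = {..<u}" "b = {..<v}" by auto
        then have "a \<inter> b = {..<min u v}" by auto
        then show "a \<inter> b \<in> range lessThan" by simp
      qed
      show "sets K2 = sigma_sets UNIV (range lessThan)" "sets K1 = sigma_sets UNIV (range lessThan)"
        by (simp_all add: K1_def K2_def borel_Iio)
      show "(\<Union>i::nat. {..<real i}) = UNIV" by (auto intro: reals_Archimedean2)
      show eq: "emeasure K2 X = emeasure K1 X" if X': "X \<in> range lessThan" for X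
      proof -
        obtain x where X: "X = {..<x}" using X' by auto
        have "emeasure K1 X = emeasure \<mu> {z. fst z \<in> A \<and> \<phi> (snd z) < x}"
        proof -
          have "(\<lambda>z. (fst z, \<phi> (snd z))) -` (A \<times> {..<x}) = {z. fst z \<in> A \<and> \<phi> (snd z) < x}" by auto
          then show ?thesis by (simp add: X K1 L'_def emeasure_distr borel_Times)
        qed
        also have "\<dots> = (\<integral>\<^sup>+t\<in>A. emeasure U {w. Q t w < x} \<partial>\<mu>1)" by (rule level[OF A, symmetric])
        also have "\<dots> = emeasure L (A \<times> {..<x})"
          by (subst LC) (auto simp: borel_Times indicator_def intro!: nn_integral_cong)
        also have "\<dots> = emeasure K2 X" by (simp add: X K2)
        finally show ?thesis by simp
      qed
      show "emeasure K2 {..<real i} \<noteq> \<infinity>" for i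
      proof -
        have "emeasure K2 {..<real i} \<le> emeasure L UNIV"
          unfolding K2[OF lessThan_borel] by (rule emeasure_mono) (auto simp: L_def)
        also have "\<dots> < \<infinity>" using finite_measure.emeasure_finite[OF \<open>finite_measure L\<close>, of UNIV]
          by (simp add: less_top[symmetric])
        finally show ?thesis by simp
      qed
    qed auto
    then show "emeasure L (A \<times> B) = emeasure L' (A \<times> B)" using K1[OF B] K2[OF B] by simp
  qed
  \<comment> \<open>Decoding by \<open>\<psi>\<close> moves the kernel from the unit interval back
    to the Euclidean space.\<close>
  define \<kappa> where "\<kappa> t = distr U borel (\<lambda>w. \<psi> (Q t w))" for t
  show ?thesis
  proof (rule that[of \<kappa>])
    show "\<kappa> \<in> borel \<rightarrow>\<^sub>M prob_algebra borel"
    proof (rule measurable_prob_algebraI)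
      show "prob_space (\<kappa> t)" for t unfolding \<kappa>_def by (rule U.prob_space_distr) measurable
      have "(\<lambda>t. distr U borel (\<lambda>w. \<psi> (Q t w))) \<in> borel \<rightarrow>\<^sub>M subprob_algebra borel"
      proof (rule measurable_distr2[where M=borel])
        show "case_prod (\<lambda>t w. \<psi> (Q t w)) \<in> borel \<Otimes>\<^sub>M borel \<rightarrow>\<^sub>M borel"
          unfolding case_prod_beta' by measurable
        show "(\<lambda>t. U) \<in> borel \<rightarrow>\<^sub>M subprob_algebra borel"
          by (rule measurable_const) (simp add: space_subprob_algebra prob_space_imp_subprob_space[OF U.prob_space_axioms])
      qed
      then show "\<kappa> \<in> borel \<rightarrow>\<^sub>M subprob_algebra borel" by (simp add: \<kappa>_def[abs_def])
    qed
    fix C :: "('a \<times> 'b) set" assume C: "C \<in> sets borel"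
    have [measurable]: "(\<lambda>z::'a \<times> real. (fst z, \<psi> (snd z))) \<in> borel \<rightarrow>\<^sub>M borel"
      unfolding borel_prod[symmetric] by measurable
    define C' where "C' = {z. (fst z, \<psi> (snd z)) \<in> C}"
    have C'[measurable]: "C' \<in> sets borel"
      using measurable_sets[of "\<lambda>z. (fst z, \<psi> (snd z))" borel borel C] C by (simp add: C'_def vimage_def)
    have slice: "{u. (t, u) \<in> C} \<in> sets borel" for t
      using measurable_sets[of "Pair t" borel "borel \<Otimes>\<^sub>M borel" C] C
      by (simp add: borel_prod vimage_def)
    have "emeasure \<mu> C = emeasure L' C'"
    proof -
      have "(\<lambda>z. (fst z, \<phi> (snd z))) -` C' = C" by (auto simp: C'_def \<psi>\<phi>)
      then show ?thesis unfolding L'_def by (simp add: emeasure_distr)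
    qed
    also have "\<dots> = (\<integral>\<^sup>+t. emeasure U {w. (t, Q t w) \<in> C'} \<partial>\<mu>1)" using LC[OF C'] \<open>L = L'\<close> by simp
    also have "\<dots> = (\<integral>\<^sup>+t. emeasure (\<kappa> t) {u. (t, u) \<in> C} \<partial>\<mu>1)"
      using slice by (simp add: \<kappa>_def emeasure_distr C'_def vimage_def)
    finally show "emeasure \<mu> C = (\<integral>\<^sup>+t. emeasure (\<kappa> t) {u. (t, u) \<in> C} \<partial>distr \<mu> borel fst)"
      by (simp add: \<mu>1_def)
  qed
qed

subsection \<open>Regular conditional distributions\<close>

text \<open>A kernel given on R is completed by a point mass rather than by the zero measure,
  because elements of \<open>prob_algebra\<close> are probability measures; the completion is
  measurable on the whole space.\<close>

definition ext_kernel :: "'b set \<Rightarrow> ('b \<Rightarrow> 'c::topological_space measure) \<Rightarrow> 'b \<Rightarrow> 'c measure" where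
  "ext_kernel R K y = (if y \<in> R then K y else return borel undefined)"

lemma ext_kernel_eq [simp]: "y \<in> R \<Longrightarrow> ext_kernel R K y = K y"
  by (simp add: ext_kernel_def)

lemma measurable_ext_kernel:
  assumes "K \<in> measurable (restrict_space borel R) (prob_algebra borel)" "R \<in> sets borel"
  shows "ext_kernel R K \<in> borel \<rightarrow>\<^sub>M prob_algebra borel"
  using assms measurable_restrict_space_iff[of R borel "return borel undefined" "prob_algebra borel" K]
  by (simp add: ext_kernel_def[abs_def] space_prob_algebra prob_space_return)

text \<open>\<open>reg_cond_distr\<close> speaks of rectangles only. Both sides are integrals
  against finite measures on the product, the law of (Y, Z) over R and the law of Y over R followed
  by the kernel; agreement on rectangles makes these measures equal.\<close>

lemma reg_cond_distr_nn_integral: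
  fixes Y :: "'a \<Rightarrow> 'b::second_countable_topology" and Z :: "'a \<Rightarrow> 'c::second_countable_topology"
  assumes rc: "reg_cond_distr M E Y Z R K" and fin: "finite_measure M" and E: "E \<in> sets M"
    and Y[measurable]: "Y \<in> borel_measurable (restrict_space M E)"
    and Z[measurable]: "Z \<in> borel_measurable (restrict_space M E)"
    and R[measurable]: "R \<in> sets borel"
    and H[measurable]: "H \<in> borel_measurable borel"
  shows "(\<integral>\<^sup>+\<omega>. H (Y \<omega>, Z \<omega>) * indicator R (Y \<omega>) \<partial>restrict_space M E) =
    (\<integral>\<^sup>+\<omega>. (\<integral>\<^sup>+z. H (Y \<omega>, z) \<partial>K (Y \<omega>)) * indicator R (Y \<omega>) \<partial>restrict_space M E)"
proof -
  define N where "N = restrict_space M E"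
  have spN: "space N = E" using sets.sets_into_space[OF E] by (auto simp: N_def space_restrict_space)
  interpret N: finite_measure N unfolding N_def 
    by (rule finite_measure_restrict_space[OF fin E])
  have [measurable]: "Y \<in> borel_measurable N" "Z \<in> borel_measurable N" by (simp_all add: N_def)
  have H'[measurable]: "H \<in> borel_measurable (borel \<Otimes>\<^sub>M borel)" by (simp add: borel_prod)
  define K' where "K' = ext_kernel R K"
  have K': "K' \<in> borel \<rightarrow>\<^sub>M prob_algebra borel"
    unfolding K'_def using rc R by (intro measurable_ext_kernel) (auto simp: reg_cond_distr_def)
  have K''[measurable]: "K' \<in> borel \<rightarrow>\<^sub>M subprob_algebra borel" by (rule measurable_prob_algebraD[OF K'])
  have sK[simp]: "sets (K' y) = sets borel" "space (K' y) = UNIV" for y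
    using measurable_space[OF K', of y] by (auto simp: space_prob_algebra dest: sets_eq_imp_space_eq)
  define L1 where "L1 = distr (density N (\<lambda>\<omega>. indicator R (Y \<omega>))) borel (\<lambda>\<omega>. (Y \<omega>, Z \<omega>))"
  define J where "J y = distr (K' y) borel (Pair y)" for y
  have J: "J \<in> borel \<rightarrow>\<^sub>M subprob_algebra borel"
    unfolding J_def[abs_def]
    by (rule measurable_distr2[OF _ K'']) (simp add: borel_prod case_prod_beta')
  \<comment> \<open>The density \<open>indicator R\<close> discards the values of Y outside R, so
    the completed kernel \<open>K'\<close> may replace \<open>K\<close> throughout.\<close>
  define D where "D = density (distr N borel Y) (indicator R)"
  have [simp]: "sets D = sets borel" "space D = UNIV" by (simp_all add: D_def)
  have J': "J \<in> D \<rightarrow>\<^sub>M subprob_algebra borel" using J by (simp cong: measurable_cong_sets)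
  define L2 where "L2 = D \<bind> J"
  have YZ[measurable]: "(\<lambda>\<omega>. (Y \<omega>, Z \<omega>)) \<in> N \<rightarrow>\<^sub>M borel" unfolding borel_prod[symmetric] by measurable
  have Pr[measurable]: "(Pair y :: 'c \<Rightarrow> 'b \<times> 'c) \<in> borel \<rightarrow>\<^sub>M borel" for y
    unfolding borel_prod[symmetric] by measurable
  have PrK: "(Pair y :: 'c \<Rightarrow> 'b \<times> 'c) \<in> K' y' \<rightarrow>\<^sub>M borel" for y y'
    using Pr measurable_cong_sets[OF sK(1) refl] by blast
  have "L1 = L2"
  proof (rule finite_measure_eqI_rectangles)
    show "finite_measure L1"
    proof (rule finite_measureI)
      have "emeasure L1 (space L1) = (\<integral>\<^sup>+\<omega>. indicator R (Y \<omega>) \<partial>N)"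
        by (simp add: L1_def emeasure_distr emeasure_density space_density)
      also have "\<dots> \<le> (\<integral>\<^sup>+\<omega>. 1 \<partial>N)" by (intro nn_integral_mono) (simp add: indicator_def)
      also have "\<dots> < \<infinity>" by (simp add: less_top[symmetric])
      finally show "emeasure L1 (space L1) \<noteq> \<infinity>" by simp
    qed
    show "sets L1 = sets borel" by (simp add: L1_def)
    show "sets L2 = sets borel" unfolding L2_def by (rule sets_bind[of _ _ borel]) (use J in \<open>auto dest: subprob_measurableD\<close>)
    fix A :: "'b set" and B :: "'c set" assume A[measurable]: "A \<in> sets borel" and B[measurable]: "B \<in> sets borel"
    have AB: "A \<times> B \<in> sets borel" by (simp add: borel_Times)
    have KB: "(\<lambda>y. emeasure (K' y) B) \<in> borel_measurable borel" by measurable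
    have "emeasure L1 (A \<times> B) = (\<integral>\<^sup>+\<omega>. indicator {\<omega>\<in>space N. Y \<omega> \<in> A \<inter> R \<and> Z \<omega> \<in> B} \<omega> \<partial>N)"
      unfolding L1_def using measurable_sets[OF YZ AB]
      by (subst emeasure_distr) (auto simp: AB emeasure_density space_density indicator_def
          simp del: nn_integral_indicator intro!: nn_integral_cong)
    also have "\<dots> = emeasure N {\<omega>\<in>space N. Y \<omega> \<in> A \<inter> R \<and> Z \<omega> \<in> B}" by (rule nn_integral_indicator) measurable
    also have "\<dots> = emeasure M {\<omega>\<in>E. Y \<omega> \<in> A \<inter> R \<and> Z \<omega> \<in> B}"
      unfolding spN unfolding N_def by (rule emeasure_restrict_space) (use E sets.sets_into_space[OF E] in auto)
    also have "\<dots> = (\<integral>\<^sup>+ y. emeasure (K y) B * indicator (A \<inter> R) y \<partial>distr N borel Y)"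
      using rc A B R unfolding reg_cond_distr_def N_def by blast
    also have "\<dots> = (\<integral>\<^sup>+ y. indicator R y * (emeasure (K' y) B * indicator A y) \<partial>distr N borel Y)"
      by (rule nn_integral_cong) (auto simp: K'_def indicator_def)
    also have "\<dots> = (\<integral>\<^sup>+ y. emeasure (K' y) B * indicator A y \<partial>D)"
      unfolding D_def using KB by (subst nn_integral_density) auto
    also have "\<dots> = (\<integral>\<^sup>+ y. emeasure (J y) (A \<times> B) \<partial>D)"
    proof (rule nn_integral_cong)
      fix y
      have "Pair y -` (A \<times> B) = (if y \<in> A then B else {})" by auto
      then show "emeasure (K' y) B * indicator A y = emeasure (J y) (A \<times> B)"
        unfolding J_def using PrK by (simp add: emeasure_distr AB)
    qed
    also have "\<dots> = emeasure L2 (A \<times> B)"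
      unfolding L2_def by (rule emeasure_bind[OF _ J' AB, symmetric]) simp
    finally show "emeasure L1 (A \<times> B) = emeasure L2 (A \<times> B)" .
  qed
  then have "(\<integral>\<^sup>+p. H p \<partial>L1) = (\<integral>\<^sup>+p. H p \<partial>L2)" by simp
  moreover have "(\<integral>\<^sup>+p. H p \<partial>L1) = (\<integral>\<^sup>+\<omega>. H (Y \<omega>, Z \<omega>) * indicator R (Y \<omega>) \<partial>N)"
    unfolding L1_def by (simp add: nn_integral_distr nn_integral_density mult.commute)
  moreover have "(\<integral>\<^sup>+p. H p \<partial>L2) = (\<integral>\<^sup>+\<omega>. (\<integral>\<^sup>+z. H (Y \<omega>, z) \<partial>K (Y \<omega>)) * indicator R (Y \<omega>) \<partial>N)"
  proof -
    have [measurable]: "(\<lambda>y. \<integral>\<^sup>+z. H (y, z) \<partial>K' y) \<in> borel_measurable borel"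
      using nn_integral_measurable_subprob_algebra2[OF _ K'', of "\<lambda>y z. H (y, z)"]
      by (simp add: case_prod_beta')
    have "(\<integral>\<^sup>+p. H p \<partial>L2) = (\<integral>\<^sup>+y. \<integral>\<^sup>+p. H p \<partial>J y \<partial>D)" unfolding L2_def by (rule nn_integral_bind[OF H J'])
    also have "\<dots> = (\<integral>\<^sup>+y. \<integral>\<^sup>+z. H (y, z) \<partial>K' y \<partial>D)" unfolding J_def by (simp add: nn_integral_distr PrK)
    also have "\<dots> = (\<integral>\<^sup>+y. indicator R y * (\<integral>\<^sup>+z. H (y, z) \<partial>K' y) \<partial>distr N borel Y)"
      unfolding D_def by (rule nn_integral_density) simp_all
    also have "\<dots> = (\<integral>\<^sup>+\<omega>. indicator R (Y \<omega>) * (\<integral>\<^sup>+z. H (Y \<omega>, z) \<partial>K' (Y \<omega>)) \<partial>N)"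
      by (simp add: nn_integral_distr)
    also have "\<dots> = (\<integral>\<^sup>+\<omega>. (\<integral>\<^sup>+z. H (Y \<omega>, z) \<partial>K (Y \<omega>)) * indicator R (Y \<omega>) \<partial>N)"
      by (rule nn_integral_cong) (auto simp: K'_def indicator_def)
    finally show ?thesis .
  qed
  ultimately show ?thesis by (simp add: N_def)
qed

subsection \<open>The orthant and its norm\<close>

lemma zero_in_orthant [simp]: "0 \<in> orthant"
  by (simp add: orthant_def)

lemma orthant_add [intro]: "x \<in> orthant \<Longrightarrow> y \<in> orthant \<Longrightarrow> x + y \<in> orthant"
  by (simp add: orthant_def)

lemma orthant_scaleR [intro]: "0 \<le> a \<Longrightarrow> x \<in> orthant \<Longrightarrow> a *\<^sub>R x \<in> orthant"
  by (simp add: orthant_def)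

lemma orthant_inner_nonneg: "x \<in> orthant \<Longrightarrow> y \<in> orthant \<Longrightarrow> 0 \<le> x \<bullet> y"
  by (auto simp: inner_vec_def orthant_def intro!: sum_nonneg)

lemma closed_orthant: "closed (orthant :: (real ^ 'n) set)"
  unfolding orthant_def by (intro closed_Collect_all closed_Collect_le continuous_intros)

lemma orthant_borel [measurable]: "(orthant :: (real ^ 'n) set) \<in> sets borel"
  by (rule borel_closed[OF closed_orthant])

lemma continuous_l1norm: "continuous_on UNIV (l1norm :: real ^ 'n \<Rightarrow> real)"
  unfolding l1norm_def[abs_def] by (intro continuous_intros)

lemma borel_measurable_l1norm [measurable]: "(l1norm :: real ^ 'n \<Rightarrow> real) \<in> borel_measurable borel"
  by (rule borel_measurable_continuous_onI[OF continuous_l1norm])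

lemma tendsto_l1norm: "(f \<longlongrightarrow> l) F \<Longrightarrow> ((\<lambda>x. l1norm (f x)) \<longlongrightarrow> l1norm l) F"
  by (rule continuous_on_tendsto_compose[OF continuous_l1norm]) auto

lemma l1norm_nonneg: "0 \<le> l1norm x"
  by (simp add: l1norm_def sum_nonneg)

lemma l1norm_zero [simp]: "l1norm 0 = 0"
  by (simp add: l1norm_def)

lemma l1norm_eq_0 [simp]: "l1norm x = 0 \<longleftrightarrow> x = 0"
  by (auto simp: l1norm_def sum_nonneg_eq_0_iff vec_eq_iff)

lemma l1norm_pos: "0 < l1norm x \<longleftrightarrow> x \<noteq> 0"
  using l1norm_nonneg[of x] by (auto simp: less_le)

lemma l1norm_add: "x \<in> orthant \<Longrightarrow> y \<in> orthant \<Longrightarrow> l1norm (x + y) = l1norm x + l1norm y"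
  by (simp add: l1norm_def orthant_def sum.distrib)

lemma l1norm_diff: "x \<in> orthant \<Longrightarrow> y - x \<in> orthant \<Longrightarrow> l1norm (y - x) = l1norm y - l1norm x"
  using l1norm_add[of x "y - x"] by simp

text \<open>Pairing with this vector is the L1 norm on the orthant, so a factor exp (- S) becomes a
  shift of the Laplace argument.\<close>

definition ones :: "real ^ 'n" where
  "ones = (\<chi> i. 1)"

lemma ones_orthant [simp]: "ones \<in> orthant"
  by (simp add: ones_def orthant_def)

lemma ones_inner: "x \<in> orthant \<Longrightarrow> ones \<bullet> x = l1norm x"
  by (simp add: ones_def l1norm_def inner_vec_def orthant_def)

subsection \<open>Increasing paths and their passage times\<close>

text \<open>Collects almost sure properties of a sample path, so that the passage arguments are
  deterministic. \<open>strict\<close> is the contribution of infinite activity, and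
  \<open>unbounded\<close> ensures that every level is passed.\<close>

locale increasing_path =
  fixes x :: "real \<Rightarrow> real ^ 'n"
  assumes start_0: "x 0 = 0"
    and nonneg: "0 \<le> t \<Longrightarrow> x t \<in> orthant"
    and right_cts: "0 \<le> t \<Longrightarrow> (x \<longlongrightarrow> x t) (at_right t)"
    and left_lims: "0 < t \<Longrightarrow> \<exists>l. (x \<longlongrightarrow> l) (at_left t)"
    and incr: "0 \<le> s \<Longrightarrow> s < t \<Longrightarrow> x t - x s \<in> orthant"
    and strict: "0 \<le> s \<Longrightarrow> s < t \<Longrightarrow> l1norm (x s) < l1norm (x t)"
    and unbounded: "\<exists>t>0. y < l1norm (x t)"

lemma left_lim_eq: "(f \<longlongrightarrow> l) (at_left t) \<Longrightarrow> left_lim f (t::real) = l"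
  unfolding left_lim_def by (rule tendsto_Lim[OF trivial_limit_at_left_real])

lemma tendsto_left_lim: "\<exists>l. (f \<longlongrightarrow> l) (at_left t) \<Longrightarrow> (f \<longlongrightarrow> left_lim f t) (at_left (t::real))"
  using left_lim_eq by blast

context increasing_path
begin

lemma left_limit: "0 < t \<Longrightarrow> (x \<longlongrightarrow> left_lim x t) (at_left t)"
  by (rule tendsto_left_lim[OF left_lims])

lemma eventually_at_left_interval: "(0::real) \<le> s \<Longrightarrow> s < t \<Longrightarrow> \<forall>\<^sub>F r in at_left t. s < r \<and> r < t"
  by (auto simp: eventually_at_left_field intro!: exI[of _ s])

lemma left_lim_diff: assumes "0 \<le> s" "s < t" shows "left_lim x t - x s \<in> orthant"
proof (rule Lim_in_closed_set[OF closed_orthant _ trivial_limit_at_left_real])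
  show "((\<lambda>r. x r - x s) \<longlongrightarrow> left_lim x t - x s) (at_left t)"
    using assms by (intro tendsto_intros left_limit) simp
  show "\<forall>\<^sub>F r in at_left t. x r - x s \<in> orthant"
    using eventually_at_left_interval[OF assms] by eventually_elim (use assms in \<open>auto intro: incr\<close>)
qed

lemma left_lim_orthant: "0 < t \<Longrightarrow> left_lim x t \<in> orthant"
  using left_lim_diff[of 0 t] by (simp add: start_0)

lemma jump_orthant: assumes "0 < t" shows "jump x t \<in> orthant"
  unfolding jump_def
proof (rule Lim_in_closed_set[OF closed_orthant _ trivial_limit_at_left_real])
  show "((\<lambda>r. x t - x r) \<longlongrightarrow> x t - left_lim x t) (at_left t)"
    using assms by (intro tendsto_intros left_limit)
  show "\<forall>\<^sub>F r in at_left t. x t - x r \<in> orthant"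
    using eventually_at_left_interval[OF order_refl assms] by eventually_elim (auto intro: incr)
qed

lemma l1norm_left_lim_strict: assumes "0 \<le> s" "s < t" shows "l1norm (x s) < l1norm (left_lim x t)"
proof -
  \<comment> \<open>A value at an intermediate time keeps the inequality strict, which the passage
    to the limit alone would not.\<close>
  define m where "m = (s + t) / 2"
  have m: "s < m" "m < t" "0 \<le> m" using assms by (auto simp: m_def)
  have "l1norm (x s) < l1norm (x m)" using strict[of s m] assms m by simp
  also have "\<dots> \<le> l1norm (left_lim x t)"
    using l1norm_diff[OF nonneg[OF m(3)] left_lim_diff[OF m(3,2)]] l1norm_nonneg[of "left_lim x t - x m"] by simp
  finally show ?thesis .
qed

lemma l1norm_jump: "0 < t \<Longrightarrow> l1norm (jump x t) = l1norm (x t) - l1norm (left_lim x t)"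
  unfolding jump_def by (rule l1norm_diff) (auto intro: left_lim_orthant jump_orthant[unfolded jump_def])

lemma left_lim_l1norm: "0 < t \<Longrightarrow> left_lim (\<lambda>r. l1norm (x r)) t = l1norm (left_lim x t)"
  by (rule left_lim_eq) (intro tendsto_l1norm left_limit)

lemma l1norm_mono: "0 \<le> s \<Longrightarrow> s \<le> t \<Longrightarrow> l1norm (x s) \<le> l1norm (x t)"
  using strict[of s t] by (cases "s = t") auto

definition passage :: "(real \<Rightarrow> real) \<Rightarrow> ereal" where
  "passage g = Inf (ereal ` {t. 0 < t \<and> g t < l1norm (x t)})"

text \<open>Touching the boundary suffices, since just after r the path is strictly higher and g is
  not. Conversely, a path strictly below g at r stays below on a right neighbourhood by continuity
  and was below at all earlier times by monotonicity.\<close>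

lemma passage_le_iff:
  assumes cont: "continuous_on {0<..} g" and anti: "antimono_on {0<..} g" and r: "0 < r"
  shows "passage g \<le> ereal r \<longleftrightarrow> g r \<le> l1norm (x r)"
proof
  assume le: "g r \<le> l1norm (x r)"
  show "passage g \<le> ereal r"
  proof (rule ereal_le_epsilon2)
    fix e :: real assume e: "0 < e"
    have "g (r + e) \<le> g r" using anti r e by (auto simp: monotone_on_def)
    also note le
    also have "l1norm (x r) < l1norm (x (r + e))" using strict[of r "r + e"] r e by simp
    finally have "ereal (r + e) \<in> ereal ` {t. 0 < t \<and> g t < l1norm (x t)}" using r e by auto
    then show "passage g \<le> ereal r + ereal e" unfolding passage_def by (auto intro: Inf_lower)
  qed
next
  assume le: "passage g \<le> ereal r"
  show "g r \<le> l1norm (x r)"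
  proof (rule ccontr)
    assume "\<not> g r \<le> l1norm (x r)"
    then have lt: "0 < g r - l1norm (x r)" by simp
    have gc: "(g \<longlongrightarrow> g r) (at r)"
      using cont r continuous_on_eq_continuous_at[of "{0<..}" g] by (auto simp: isCont_def)
    have "((\<lambda>t. g t - l1norm (x t)) \<longlongrightarrow> g r - l1norm (x r)) (at_right r)"
      using r by (intro tendsto_intros tendsto_l1norm right_cts filterlim_mono[OF gc order_refl])
        (auto simp: at_le)
    then have "\<forall>\<^sub>F t in at_right r. 0 < g t - l1norm (x t)" using lt by (rule order_tendstoD)
    then obtain b where b: "r < b" "\<And>t. r < t \<Longrightarrow> t < b \<Longrightarrow> l1norm (x t) < g t"
      unfolding eventually_at_right_field by auto
    have "ereal b \<le> passage g" unfolding passage_def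
    proof (rule Inf_greatest, safe)
      fix t assume t: "0 < t" "g t < l1norm (x t)"
      have "b \<le> t"
      proof (rule ccontr)
        assume "\<not> b \<le> t"
        with b(2)[of t] t have "t \<le> r" by force
        then have "l1norm (x t) \<le> l1norm (x r)" "g r \<le> g t"
          using l1norm_mono[of t r] anti t r by (auto simp: monotone_on_def)
        then show False using t lt by simp
      qed
      then show "ereal b \<le> ereal t" by simp
    qed
    also note le
    finally show False using b(1) by simp
  qed
qed

text \<open>At times r < t strict growth puts the path below its left limit at t. If that limit is
  at most g t, the path at r is below g r, so there is no passage before t; touching at t then makes
  t the passage time.\<close>

lemma passage_eq_iff:
  assumes cont: "continuous_on {0<..} g" and anti: "antimono_on {0<..} g" and t: "0 < t"
  shows "passage g = ereal t \<longleftrightarrow> l1norm (left_lim x t) \<le> g t \<and> g t \<le> l1norm (x t)"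
proof
  assume eq: "passage g = ereal t"
  have gc: "(g \<longlongrightarrow> g t) (at t)"
    using cont t continuous_on_eq_continuous_at[of "{0<..}" g] by (auto simp: isCont_def)
  have "l1norm (left_lim x t) \<le> g t"
  proof (rule tendsto_le[OF trivial_limit_at_left_real])
    show "(g \<longlongrightarrow> g t) (at_left t)" by (rule filterlim_mono[OF gc order_refl]) (simp add: at_le)
    show "((\<lambda>r. l1norm (x r)) \<longlongrightarrow> l1norm (left_lim x t)) (at_left t)"
      using t by (intro tendsto_l1norm left_limit)
    show "\<forall>\<^sub>F r in at_left t. l1norm (x r) \<le> g r"
      using eventually_at_left_interval[OF order_refl t]
    proof eventually_elim
      case (elim r)
      then show ?case using passage_le_iff[OF cont anti, of r] eq by auto
    qed
  qed
  then show "l1norm (left_lim x t) \<le> g t \<and> g t \<le> l1norm (x t)"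
    using passage_le_iff[OF cont anti t] eq by simp
next
  assume asm: "l1norm (left_lim x t) \<le> g t \<and> g t \<le> l1norm (x t)"
  show "passage g = ereal t"
  proof (rule antisym)
    show "passage g \<le> ereal t" using passage_le_iff[OF cont anti t] asm by simp
    show "ereal t \<le> passage g"
    proof (rule ccontr)
      assume "\<not> ereal t \<le> passage g"
      then obtain r0 where r0: "passage g < ereal r0" "ereal r0 < ereal t"
        using ereal_dense2[of "passage g" "ereal t"] by (auto simp: not_le)
      \<comment> \<open>The maximum with t / 2 keeps r positive, as g is controlled on (0, infinity)
        only.\<close>
      define r where "r = max r0 (t / 2)"
      have r: "0 < r" "r < t" using r0(2) t by (auto simp: r_def)
      have "passage g \<le> ereal r0" using r0(1) by (rule less_imp_le)
      also have "\<dots> \<le> ereal r" by (simp add: r_def)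
      finally have r3: "passage g \<le> ereal r" .
      have "g r \<le> l1norm (x r)" using passage_le_iff[OF cont anti r(1)] r3 by simp
      also have "\<dots> < l1norm (left_lim x t)" using l1norm_left_lim_strict r by simp
      also have "\<dots> \<le> g t" using asm by simp
      also have "\<dots> \<le> g r" using anti r t by (auto simp: monotone_on_def)
      finally show False by simp
    qed
  qed
qed

text \<open>Positivity comes from right-continuity at 0, finiteness from unboundedness.\<close>

lemma passage_level:
  assumes "0 < y"
  shows "0 < passage (\<lambda>_. y)" "passage (\<lambda>_. y) < \<infinity>"
proof -
  have iff: "passage (\<lambda>_. y) \<le> ereal r \<longleftrightarrow> y \<le> l1norm (x r)" if "0 < r" for r
    by (rule passage_le_iff[OF _ _ that]) (auto simp: monotone_on_def)
  have "((\<lambda>t. l1norm (x t)) \<longlongrightarrow> l1norm (x 0)) (at_right 0)" by (intro tendsto_l1norm right_cts) simp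
  then have "\<forall>\<^sub>F t in at_right 0. l1norm (x t) < y"
    by (rule order_tendstoD) (simp add: start_0 assms)
  then obtain b where b: "0 < b" "\<And>t. 0 < t \<Longrightarrow> t < b \<Longrightarrow> l1norm (x t) < y"
    unfolding eventually_at_right_field by auto
  have "\<not> passage (\<lambda>_. y) \<le> ereal (b / 2)" using iff[of "b / 2"] b(2)[of "b / 2"] b(1) by simp
  then have "ereal (b / 2) < passage (\<lambda>_. y)" by simp
  moreover have "0 < ereal (b / 2)" using b(1) by simp
  ultimately show "0 < passage (\<lambda>_. y)" by (rule less_trans[rotated])
  obtain t where "0 < t" "y < l1norm (x t)" using unbounded by blast
  then have "passage (\<lambda>_. y) \<le> ereal t" using iff[of t] by simp
  then show "passage (\<lambda>_. y) < \<infinity>" by (rule le_less_trans) simp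
qed

text \<open>The norm of the path plus a constant strictly increases while g does not, so they meet
  at most once. Hence the times at which a jump of fixed size would land on the boundary form a
  Lebesgue null set.\<close>

lemma first_zero_unique:
  assumes anti: "antimono_on {0<..} g" and "0 < s" "0 < t" "l1norm (x s) + a = g s" "l1norm (x t) + a = g t"
  shows "s = t"
proof (rule ccontr)
  assume "s \<noteq> t"
  then consider "s < t" | "t < s" by linarith
  then show False
  proof cases
    case 1
    then have "g t \<le> g s" using anti assms(2,3) by (auto simp: monotone_on_def)
    then show False using strict[of s t] 1 assms by simp
  next
    case 2
    then have "g s \<le> g t" using anti assms(2,3) by (auto simp: monotone_on_def)
    then show False using strict[of t s] 2 assms by simp
  qed
qed

end

subsection \<open>Grid approximation of times\<close>

text \<open>Rounding up makes the cells left-open and right-closed: \<open>grid_lo\<close> lies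
  strictly before t and picks up left limits, \<open>grid_hi\<close> lies at or after t and picks up
  values by right-continuity. For t > 0 the index is at least 1, so the truncated subtraction in
  \<open>grid_lo\<close> is exact.\<close>

definition grid_index :: "nat \<Rightarrow> real \<Rightarrow> nat" where
  "grid_index n t = nat \<lceil>t * real (Suc n)\<rceil>"

definition grid_hi :: "nat \<Rightarrow> real \<Rightarrow> real" where
  "grid_hi n t = real (grid_index n t) / real (Suc n)"

definition grid_lo :: "nat \<Rightarrow> real \<Rightarrow> real" where
  "grid_lo n t = real (grid_index n t - 1) / real (Suc n)"

lemma grid_index_measurable [measurable]: "grid_index n \<in> borel \<rightarrow>\<^sub>M count_space UNIV"
  unfolding grid_index_def[abs_def] by measurable

lemma grid_index_eq_Suc:
  "grid_index n t = Suc k \<longleftrightarrow> real k / real (Suc n) < t \<and> t \<le> real (Suc k) / real (Suc n)"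
proof -
  have "grid_index n t = Suc k \<longleftrightarrow> \<lceil>t * real (Suc n)\<rceil> = int (Suc k)"
    unfolding grid_index_def by auto
  also have "\<dots> \<longleftrightarrow> real k < t * real (Suc n) \<and> t * real (Suc n) \<le> real (Suc k)"
    by (auto simp: ceiling_eq_iff)
  also have "\<dots> \<longleftrightarrow> real k / real (Suc n) < t \<and> t \<le> real (Suc k) / real (Suc n)"
    by (simp add: pos_divide_less_eq pos_le_divide_eq del: of_nat_Suc)
  finally show ?thesis .
qed

lemma grid_index_pos: "0 < t \<Longrightarrow> \<exists>k. grid_index n t = Suc k"
proof -
  assume "0 < t"
  then have "0 < \<lceil>t * real (Suc n)\<rceil>" by simp
  then show ?thesis unfolding grid_index_def by (metis gr0_implies_Suc zero_less_nat_eq)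
qed

lemma grid_bounds:
  assumes "0 < t"
  shows "0 \<le> grid_lo n t" "grid_lo n t < t" "t \<le> grid_hi n t" "grid_hi n t = grid_lo n t + 1 / real (Suc n)"
proof -
  obtain k where k: "grid_index n t = Suc k" using grid_index_pos[OF assms] by blast
  show "0 \<le> grid_lo n t" by (simp add: grid_lo_def)
  show "grid_lo n t < t" "t \<le> grid_hi n t"
    using k grid_index_eq_Suc[of n t k] by (simp_all add: grid_lo_def grid_hi_def del: of_nat_Suc)
  show "grid_hi n t = grid_lo n t + 1 / real (Suc n)"
    using k by (simp add: grid_lo_def grid_hi_def add_divide_distrib)
qed

lemma grid_lo_tendsto: assumes "0 < t" shows "(\<lambda>n. grid_lo n t) \<longlonglongrightarrow> t"
proof (rule tendsto_sandwich)
  show "(\<lambda>n. t - 1 / real (Suc n)) \<longlonglongrightarrow> t"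
    using tendsto_diff[OF tendsto_const LIMSEQ_inverse_real_of_nat, of t] by (simp add: inverse_eq_divide)
  show "\<forall>\<^sub>F n in sequentially. t - 1 / real (Suc n) \<le> grid_lo n t"
    using grid_bounds(3,4)[OF assms] by (intro always_eventually allI) (metis diff_le_eq)
  show "\<forall>\<^sub>F n in sequentially. grid_lo n t \<le> t"
    using grid_bounds(2)[OF assms] by (intro always_eventually allI) (simp add: less_imp_le)
qed simp

lemma grid_hi_tendsto: assumes "0 < t" shows "(\<lambda>n. grid_hi n t) \<longlonglongrightarrow> t"
proof -
  have "(\<lambda>n. grid_lo n t + inverse (real (Suc n))) \<longlonglongrightarrow> t + 0"
    by (intro tendsto_add grid_lo_tendsto[OF assms] LIMSEQ_inverse_real_of_nat)
  then show ?thesis using grid_bounds(4)[OF assms] by (simp add: inverse_eq_divide)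
qed

lemma tendsto_grid_lo:
  assumes "(f \<longlongrightarrow> l) (at_left t)" "0 < t"
  shows "(\<lambda>n. f (grid_lo n t)) \<longlonglongrightarrow> l"
proof -
  have "filterlim (\<lambda>n. grid_lo n t) (at_left t) sequentially"
    unfolding filterlim_at using grid_bounds(2)[OF assms(2)] grid_lo_tendsto[OF assms(2)]
    by (auto intro!: always_eventually simp: less_imp_neq)
  then show ?thesis by (rule filterlim_compose[OF assms(1)])
qed

lemma tendsto_grid_hi:
  fixes f :: "real \<Rightarrow> 'a::topological_space"
  assumes "(f \<longlongrightarrow> f t) (at_right t)" "0 < t"
  shows "(\<lambda>n. f (grid_hi n t)) \<longlonglongrightarrow> f t"
proof (rule topological_tendstoI)
  fix S assume S: "open S" "f t \<in> S"
  then have "\<forall>\<^sub>F r in at_right t. f r \<in> S" using assms(1) by (simp add: tendsto_def)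
  then obtain b where b: "t < b" "\<And>r. t < r \<Longrightarrow> r < b \<Longrightarrow> f r \<in> S"
    unfolding eventually_at_right_field by auto
  have "\<forall>\<^sub>F n in sequentially. grid_hi n t < b" using grid_hi_tendsto[OF assms(2)] b(1) by (rule order_tendstoD)
  then show "\<forall>\<^sub>F n in sequentially. f (grid_hi n t) \<in> S"
    by eventually_elim (use b(2) S(2) grid_bounds(3)[OF assms(2)] in \<open>metis less_eq_real_def\<close>)
qed

subsection \<open>Levy processes: measurability and increments\<close>

context levy_process
begin

text \<open>A random time rounded to the grid takes countably many values, so the path evaluated
  there is measurable; grid limits then give the value and the left limit. The map
  \<open>\<phi>\<close> lets the time depend on extra randomness such as a level. The value 0 is a
  default for times that are not positive.\<close>

lemma measurable_at_hitting:
  assumes T[measurable]: "T \<in> borel_measurable N" and \<phi>: "\<phi> \<in> N \<rightarrow>\<^sub>M M"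
  shows "(\<lambda>z. if 0 < T z then X (T z) (\<phi> z) else 0) \<in> borel_measurable N"
    and "(\<lambda>z. if 0 < T z then left_lim (\<lambda>r. X r (\<phi> z)) (T z) else 0) \<in> borel_measurable N"
proof -
  have k[measurable]: "(\<lambda>z. grid_index n (T z)) \<in> N \<rightarrow>\<^sub>M count_space UNIV" for n
    by (rule measurable_compose[OF T grid_index_measurable])
  have X[measurable]: "(\<lambda>z. X r (\<phi> z)) \<in> borel_measurable N" if "0 \<le> r" for r
    using measurable_compose[OF \<phi> random_vector[OF that]] .
  have hi[measurable]: "(\<lambda>z. X (grid_hi n (T z)) (\<phi> z)) \<in> borel_measurable N" for n
    unfolding grid_hi_def
    using measurable_compose_countable[OF X k, of "\<lambda>k. real k / real (Suc n)" n] by simp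
  have lo[measurable]: "(\<lambda>z. X (grid_lo n (T z)) (\<phi> z)) \<in> borel_measurable N" for n
    unfolding grid_lo_def
    using measurable_compose_countable[OF X k, of "\<lambda>k. real (k - 1) / real (Suc n)" n] by simp
  have sp: "\<phi> z \<in> space M" if "z \<in> space N" for z using measurable_space[OF \<phi> that] .
  show "(\<lambda>z. if 0 < T z then X (T z) (\<phi> z) else 0) \<in> borel_measurable N"
  proof (rule borel_measurable_LIMSEQ_metric)
    show "(\<lambda>z. if 0 < T z then X (grid_hi n (T z)) (\<phi> z) else 0) \<in> borel_measurable N" for n
      by measurable
    show "(\<lambda>n. if 0 < T z then X (grid_hi n (T z)) (\<phi> z) else 0) \<longlonglongrightarrow>
        (if 0 < T z then X (T z) (\<phi> z) else 0)" if "z \<in> space N" for z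
      using tendsto_grid_hi[of "\<lambda>r. X r (\<phi> z)" "T z"] right_cont[OF sp[OF that], of "T z"] by auto
  qed
  show "(\<lambda>z. if 0 < T z then left_lim (\<lambda>r. X r (\<phi> z)) (T z) else 0) \<in> borel_measurable N"
  proof (rule borel_measurable_LIMSEQ_metric)
    show "(\<lambda>z. if 0 < T z then X (grid_lo n (T z)) (\<phi> z) else 0) \<in> borel_measurable N" for n
      by measurable
    show "(\<lambda>n. if 0 < T z then X (grid_lo n (T z)) (\<phi> z) else 0) \<longlonglongrightarrow>
        (if 0 < T z then left_lim (\<lambda>r. X r (\<phi> z)) (T z) else 0)" if "z \<in> space N" for z
      using tendsto_grid_lo[OF tendsto_left_lim[OF left_limits[OF sp[OF that], of "T z"]]] by auto
  qed
qed

text \<open>Almost surely X(r) is the increment over [0, r], hence independent of the increment over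
  [r, r + h]; stationarity replaces the latter by an independent copy of X(h).\<close>

lemma increment_nn_integral:
  assumes r: "0 \<le> r" and h: "0 \<le> h" and H[measurable]: "H \<in> borel_measurable borel"
  shows "(\<integral>\<^sup>+\<omega>. H (X r \<omega>, X (r + h) \<omega> - X r \<omega>) \<partial>M) = (\<integral>\<^sup>+\<omega>. \<integral>\<^sup>+\<omega>'. H (X r \<omega>, X h \<omega>') \<partial>M \<partial>M)"
proof -
  have [measurable]: "X r \<in> borel_measurable M" "X 0 \<in> borel_measurable M" "X h \<in> borel_measurable M"
    "X (r + h) \<in> borel_measurable M" using r h by (auto intro: random_vector)
  have H'[measurable]: "H \<in> borel_measurable (borel \<Otimes>\<^sub>M borel)" by (simp add: borel_prod)
  \<comment> \<open>The time points 0, r, r + h, whose two increments are all that is used.\<close>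
  define time where "time i = (if i = 0 then 0 else if i = Suc 0 then r else r + h)" for i :: nat
  define Y where "Y i \<omega> = X (time (Suc i)) \<omega> - X (time i) \<omega>" for i \<omega>
  have "indep_vars (\<lambda>_. borel) Y {..<2}"
    unfolding Y_def[abs_def] by (rule indep_increments) (use r h in \<open>auto simp: time_def\<close>)
  then have "indep_var (PiM {0} (\<lambda>_. borel)) (\<lambda>\<omega>. restrict (\<lambda>i. Y i \<omega>) {0})
      (PiM {Suc 0} (\<lambda>_. borel)) (\<lambda>\<omega>. restrict (\<lambda>i. Y i \<omega>) {Suc 0})"
    by (rule indep_var_restrict) auto
  then have "indep_var borel ((\<lambda>f. f 0) \<circ> (\<lambda>\<omega>. restrict (\<lambda>i. Y i \<omega>) {0}))
      borel ((\<lambda>f. f (Suc 0)) \<circ> (\<lambda>\<omega>. restrict (\<lambda>i. Y i \<omega>) {Suc 0}))"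
    by (rule indep_var_compose) (auto intro!: measurable_component_singleton)
  then have "indep_var borel (Y 0) borel (Y (Suc 0))" by (simp add: comp_def)
  then have eq: "distr M borel (Y 0) \<Otimes>\<^sub>M distr M borel (Y (Suc 0)) =
      distr M (borel \<Otimes>\<^sub>M borel) (\<lambda>\<omega>. (Y 0 \<omega>, Y (Suc 0) \<omega>))"
    by (simp add: indep_var_distribution_eq)
  have [measurable]: "Y i \<in> borel_measurable M" for i
    unfolding Y_def[abs_def] using r h
    by (intro borel_measurable_diff random_vector) (auto simp: time_def)
  have Y1: "distr M borel (Y (Suc 0)) = distr M borel (X h)"
    using stationary_increments[OF r h] by (simp add: Y_def[abs_def] time_def)
  have Y0: "distr M borel (Y 0) = distr M borel (X r)"
    by (rule distr_cong_AE) (use start in \<open>auto simp: Y_def time_def\<close>)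
  interpret D: prob_space "distr M borel (X h)" by (rule prob_space_distr) measurable
  have "(\<integral>\<^sup>+\<omega>. H (X r \<omega>, X (r + h) \<omega> - X r \<omega>) \<partial>M) = (\<integral>\<^sup>+\<omega>. H (Y 0 \<omega>, Y (Suc 0) \<omega>) \<partial>M)"
    by (rule nn_integral_cong_AE) (use start in \<open>auto simp: Y_def time_def\<close>)
  also have "\<dots> = (\<integral>\<^sup>+p. H p \<partial>distr M (borel \<Otimes>\<^sub>M borel) (\<lambda>\<omega>. (Y 0 \<omega>, Y (Suc 0) \<omega>)))"
    by (simp add: nn_integral_distr)
  also have "\<dots> = (\<integral>\<^sup>+p. H p \<partial>(distr M borel (X r) \<Otimes>\<^sub>M distr M borel (X h)))"
    unfolding eq[symmetric] Y0 Y1 ..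
  also have "\<dots> = (\<integral>\<^sup>+u. \<integral>\<^sup>+v. H (u, v) \<partial>distr M borel (X h) \<partial>distr M borel (X r))"
    by (rule D.nn_integral_fst[symmetric]) measurable
  also have "\<dots> = (\<integral>\<^sup>+\<omega>. \<integral>\<^sup>+\<omega>'. H (X r \<omega>, X h \<omega>') \<partial>M \<partial>M)"
    by (simp add: nn_integral_distr D.borel_measurable_nn_integral cong: nn_integral_cong)
  finally show ?thesis .
qed

end

subsection \<open>The Levy measure\<close>

context orthant_levy_process
begin

abbreviation (input) S where "S t \<omega> \<equiv> l1norm (X t \<omega>)"

definition laplace_exp :: "real ^ 'n \<Rightarrow> real" where
  "laplace_exp \<theta> = (\<integral>v. 1 - exp (- (\<theta> \<bullet> v)) \<partial>Pm)"

lemma space_Pm [simp]: "space Pm = UNIV"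
  using sets_eq_imp_space_eq[OF sets_Pm] by simp

lemma measurable_Pm [measurable_cong, simp]: "sets Pm = sets borel"
  by (rule sets_Pm)

lemma AE_Pm_orthant: "AE v in Pm. v \<in> orthant"
  by (rule AE_I[of _ _ "- orthant"]) (auto simp: Pm_orthant)

lemma AE_Pm_nonzero: "AE v in Pm. v \<noteq> 0"
  by (rule AE_I[of _ _ "{0}"]) (auto simp: Pm_zero)

lemma laplace_exp_nn:
  assumes "\<theta> \<in> orthant"
  shows "(\<integral>\<^sup>+v. ennreal (1 - exp (- (\<theta> \<bullet> v))) \<partial>Pm) = ennreal (laplace_exp \<theta>)"
  unfolding laplace_exp_def
  by (rule nn_integral_eq_integral[OF exponent_finite[OF assms]])
    (use AE_Pm_orthant in eventually_elim, use assms in \<open>simp add: orthant_inner_nonneg\<close>)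

lemma laplace_nn:
  assumes \<theta>: "\<theta> \<in> orthant" and t: "0 \<le> t"
  shows "(\<integral>\<^sup>+\<omega>. ennreal (exp (- (\<theta> \<bullet> X t \<omega>))) \<partial>M) = ennreal (exp (- t * laplace_exp \<theta>))"
proof -
  have [measurable]: "X t \<in> borel_measurable M" using t by (rule random_vector)
  have "integrable M (\<lambda>\<omega>. exp (- (\<theta> \<bullet> X t \<omega>)))"
    by (rule integrable_const_bound[where B=1])
      (use \<theta> t in \<open>auto intro!: AE_I2 simp: orthant_inner_nonneg in_orthant\<close>)
  then show ?thesis using laplace[OF \<theta> t] by (simp add: nn_integral_eq_integral laplace_exp_def)
qed

text \<open>Markov's inequality for 1 - exp (- |v|), whose integral is
  \<open>laplace_exp ones\<close>; the constant c is the reciprocal of its value at |v| = a.\<close>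

lemma tail_finite:
  assumes a: "0 < a" shows "emeasure Pm {v. a < l1norm v} < \<infinity>"
proof -
  define c where "c = 1 / (1 - exp (- a))"
  have c: "0 < c" using a by (simp add: c_def)
  have "emeasure Pm {v. a < l1norm v} \<le> emeasure Pm {v \<in> UNIV. 1 \<le> ennreal c * ennreal (1 - exp (- l1norm v))}"
  proof (rule emeasure_mono)
    show "{v :: real ^ 'n. a < l1norm v} \<subseteq> {v \<in> UNIV. 1 \<le> ennreal c * ennreal (1 - exp (- l1norm v))}"
    proof safe
      fix v :: "real ^ 'n" assume "a < l1norm v"
      then have "1 \<le> c * (1 - exp (- l1norm v))"
        unfolding c_def using a by (simp add: pos_le_divide_eq)
      then have "ennreal 1 \<le> ennreal (c * (1 - exp (- l1norm v)))" by (rule ennreal_leI)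
      then show "1 \<le> ennreal c * ennreal (1 - exp (- l1norm v))"
        using c by (simp add: ennreal_mult' l1norm_nonneg)
    qed simp
    show "{v :: real ^ 'n \<in> UNIV. 1 \<le> ennreal c * ennreal (1 - exp (- l1norm v))} \<in> sets Pm"
      unfolding sets_Pm by measurable
  qed
  also have "\<dots> \<le> ennreal c * (\<integral>\<^sup>+v. ennreal (1 - exp (- l1norm v)) * indicator UNIV v \<partial>Pm)"
    by (rule nn_integral_Markov_inequality) auto
  also have "(\<integral>\<^sup>+v. ennreal (1 - exp (- l1norm v)) * indicator UNIV v \<partial>Pm) = ennreal (laplace_exp ones)"
    unfolding laplace_exp_nn[OF ones_orthant, symmetric]
    by (rule nn_integral_cong_AE) (use AE_Pm_orthant in eventually_elim, simp add: ones_inner)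
  also have "ennreal c * ennreal (laplace_exp ones) < \<infinity>"
    by (simp add: ennreal_mult_less_top)
  finally show ?thesis .
qed

text \<open>The tails beyond 1 / Suc n have finite mass and exhaust all vectors except 0, which is a
  null set.\<close>

lemma sigma_finite_Pm: "sigma_finite_measure Pm"
proof (rule sigma_finite_measure.intro)
  define A where "A n = {v :: real ^ 'n. 1 / real (Suc n) < l1norm v}" for n
  have A: "A n \<in> sets borel" for n unfolding A_def by measurable
  have "emeasure Pm a \<noteq> \<infinity>" if "a \<in> insert {0} (range A)" for a
    using that tail_finite[of "1 / real (Suc n)" for n] by (auto simp: Pm_zero A_def less_top[symmetric])
  moreover have "\<Union> (insert {0} (range A)) = UNIV"
  proof -
    have "v \<in> \<Union> (insert {0} (range A))" for v
    proof (cases "v = 0")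
      case False
      then have "0 < l1norm v" by (simp add: l1norm_pos)
      then obtain n where "1 / real (Suc n) < l1norm v" using nat_approx_posE by blast
      then have "v \<in> A n" by (simp add: A_def)
      then show ?thesis by blast
    qed simp
    then show ?thesis by blast
  qed
  ultimately show "\<exists>C. countable C \<and> C \<subseteq> sets Pm \<and> \<Union> C = space Pm \<and> (\<forall>a\<in>C. emeasure Pm a \<noteq> \<infinity>)"
    using A by (intro exI[of _ "insert {0} (range A)"]) auto
qed

end

sublocale orthant_levy_process \<subseteq> Pm: sigma_finite_measure Pm
  by (rule sigma_finite_Pm)

subsection \<open>Sample paths under infinite activity\<close>

locale infinite_activity = orthant_levy_process M X Pm
  for M :: "'a measure" and X :: "real \<Rightarrow> 'a \<Rightarrow> real ^ 'n" and Pm +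
  assumes infinite: "emeasure (norm_levy Pm) {0<..} = \<infinity>"
begin

text \<open>Monotone convergence: 1 - exp (- n |v|) increases to the indicator of nonzero v, whose
  integral is infinite.\<close>

lemma laplace_exp_diverges: "(\<lambda>n. ennreal (laplace_exp (real n *\<^sub>R ones))) \<longlonglongrightarrow> \<infinity>"
proof -
  define f where "f n v = ennreal (1 - exp (- real n * l1norm v))" for n and v :: "real ^ 'n"
  have "(\<lambda>n. integral\<^sup>N Pm (f n)) \<longlonglongrightarrow> integral\<^sup>N Pm (\<lambda>v. indicator {v. 0 < l1norm v} v)"
  proof (rule nn_integral_LIMSEQ)
    show "incseq f"
      unfolding f_def incseq_def le_fun_def
      by (auto intro!: ennreal_leI mult_right_mono simp: l1norm_nonneg)
    show "f n \<in> borel_measurable Pm" for n unfolding f_def[abs_def] by measurable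
    show "(\<lambda>n. f n v) \<longlonglongrightarrow> indicator {v. 0 < l1norm v} v" for v
    proof (cases "0 < l1norm v")
      case True
      have "(\<lambda>n. 1 - exp (- real n * a)) \<longlonglongrightarrow> 1" if "0 < a" for a :: real using that by real_asymp
      from this[OF True] have "(\<lambda>n. 1 - exp (- real n * l1norm v)) \<longlonglongrightarrow> 1" .
      then have "(\<lambda>n. ennreal (1 - exp (- real n * l1norm v))) \<longlonglongrightarrow> ennreal 1" by (rule tendsto_ennrealI)
      then show ?thesis using True by (simp add: f_def)
    next
      case False
      then show ?thesis using l1norm_nonneg[of v] by (simp add: f_def)
    qed
  qed
  moreover have "integral\<^sup>N Pm (\<lambda>v. indicator {v. 0 < l1norm v} v) = \<infinity>"
  proof -
    have "{v. 0 < l1norm v} = l1norm -` {0<..} \<inter> space Pm" by auto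
    then have "emeasure Pm {v. 0 < l1norm v} = \<infinity>"
      using infinite unfolding norm_levy_def by (simp add: emeasure_distr)
    moreover have "{v. 0 < l1norm v} \<in> sets Pm" unfolding sets_Pm by measurable
    ultimately show ?thesis by simp
  qed
  moreover have "integral\<^sup>N Pm (f n) = ennreal (laplace_exp (real n *\<^sub>R ones))" for n
    unfolding f_def laplace_exp_nn[OF orthant_scaleR[OF of_nat_0_le_iff ones_orthant], symmetric]
    by (rule nn_integral_cong_AE) (use AE_Pm_orthant in eventually_elim, simp add: ones_inner)
  ultimately show ?thesis by simp
qed

text \<open>A vanishing exponent would make \<open>Pm\<close> null, against its infinite mass.
  Positivity keeps the denominators of the transforms away from 0 and drives S to infinity.\<close>

lemma laplace_exp_pos: assumes \<theta>: "\<theta> \<in> orthant" shows "0 < laplace_exp (\<theta> + ones)"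
proof (rule ccontr)
  assume "\<not> 0 < laplace_exp (\<theta> + ones)"
  then have "(\<integral>\<^sup>+v. ennreal (1 - exp (- ((\<theta> + ones) \<bullet> v))) \<partial>Pm) = 0"
    using \<theta> by (subst laplace_exp_nn) (auto simp: ennreal_eq_0_iff)
  then have "AE v in Pm. ennreal (1 - exp (- ((\<theta> + ones) \<bullet> v))) = 0"
    by (subst (asm) nn_integral_0_iff_AE) auto
  then have "AE v in Pm. False" using AE_Pm_orthant AE_Pm_nonzero
  proof eventually_elim
    case (elim v)
    then have "0 < (\<theta> + ones) \<bullet> v"
      using \<theta> by (auto simp: inner_add_left ones_inner l1norm_pos intro!: add_nonneg_pos orthant_inner_nonneg)
    with elim show False by (simp add: ennreal_eq_0_iff)
  qed
  then have "emeasure Pm UNIV = 0" by (simp add: AE_iff_null null_sets_def)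
  moreover have "emeasure Pm (l1norm -` {0<..}) = \<infinity>"
    using infinite unfolding norm_levy_def by (simp add: emeasure_distr)
  moreover have "emeasure Pm (l1norm -` {0<..}) \<le> emeasure Pm UNIV" by (rule emeasure_mono) auto
  ultimately show False by simp
qed

text \<open>For every n the event X(h) = 0 has probability at most the expectation of exp (- n
  S(h)), which tends to 0 because the Laplace exponent at n times \<open>ones\<close>
  diverges.\<close>

lemma AE_nonzero:
  assumes h: "0 < h" shows "AE \<omega> in M. X h \<omega> \<noteq> 0"
proof -
  have [measurable]: "X h \<in> borel_measurable M" using h by (intro random_vector) simp
  define Z where "Z = {\<omega>\<in>space M. X h \<omega> = 0}"
  have Z[measurable]: "Z \<in> sets M" unfolding Z_def by measurable
  have le: "emeasure M Z \<le> ennreal (exp (- h * laplace_exp (real n *\<^sub>R ones)))" for n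
  proof -
    have "emeasure M Z = (\<integral>\<^sup>+\<omega>. indicator Z \<omega> \<partial>M)" by simp
    also have "\<dots> \<le> (\<integral>\<^sup>+\<omega>. ennreal (exp (- ((real n *\<^sub>R ones) \<bullet> X h \<omega>))) \<partial>M)"
      by (rule nn_integral_mono) (auto simp: Z_def indicator_def)
    finally show ?thesis using laplace_nn[OF orthant_scaleR[OF of_nat_0_le_iff ones_orthant], of h n] h by simp
  qed
  have "filterlim (\<lambda>n. laplace_exp (real n *\<^sub>R ones)) at_top sequentially"
    unfolding filterlim_at_top_dense
  proof safe
    fix B :: real
    have "0 \<le> max 0 B \<longrightarrow>
        (\<forall>\<^sub>F n in sequentially. ennreal (max 0 B) < ennreal (laplace_exp (real n *\<^sub>R ones)))"
      using laplace_exp_diverges unfolding infinity_ennreal_def tendsto_top_iff_ennreal by (rule spec)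
    then have "\<forall>\<^sub>F n in sequentially. ennreal (max 0 B) < ennreal (laplace_exp (real n *\<^sub>R ones))"
      by (rule mp) simp
    then show "\<forall>\<^sub>F n in sequentially. B < laplace_exp (real n *\<^sub>R ones)"
    proof eventually_elim
      case (elim n)
      then have "max 0 B < laplace_exp (real n *\<^sub>R ones)" by (subst (asm) ennreal_less_iff) auto
      then show ?case by simp
    qed
  qed
  then have "filterlim (\<lambda>n. - h * laplace_exp (real n *\<^sub>R ones)) at_bot sequentially"
    using h by (intro filterlim_tendsto_neg_mult_at_bot[OF tendsto_const]) auto
  then have "(\<lambda>n. exp (- h * laplace_exp (real n *\<^sub>R ones))) \<longlonglongrightarrow> 0"
    by (rule filterlim_compose[OF exp_at_bot])
  then have "(\<lambda>n. ennreal (exp (- h * laplace_exp (real n *\<^sub>R ones)))) \<longlonglongrightarrow> ennreal 0"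
    by (rule tendsto_ennrealI)
  then have "emeasure M Z \<le> ennreal 0" by (rule LIMSEQ_le_const) (use le in auto)
  then have "Z \<in> null_sets M" by (auto simp: null_sets_def)
  then show ?thesis by (rule AE_I') (auto simp: Z_def)
qed

lemma AE_increment:
  assumes "0 \<le> s" "s < t"
  shows "AE \<omega> in M. X t \<omega> - X s \<omega> \<in> orthant \<and> X t \<omega> \<noteq> X s \<omega>"
proof -
  define h where "h = t - s"
  have h: "0 < h" "t = s + h" using assms by (auto simp: h_def)
  have [measurable]: "X h \<in> borel_measurable M" "X s \<in> borel_measurable M" "X t \<in> borel_measurable M"
    using assms h by (auto intro!: random_vector)
  have "AE \<omega> in M. X h \<omega> \<in> orthant \<and> X h \<omega> \<noteq> 0"
    using AE_nonzero[OF h(1)] AE_space by eventually_elim (use h in \<open>auto intro!: in_orthant\<close>)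
  then have "AE v in distr M borel (X h). v \<in> orthant \<and> v \<noteq> 0"
    by (subst AE_distr_iff) auto
  moreover have "distr M borel (\<lambda>\<omega>. X t \<omega> - X s \<omega>) = distr M borel (X h)"
    unfolding h(2) by (rule stationary_increments) (use assms h in auto)
  ultimately have "AE v in distr M borel (\<lambda>\<omega>. X t \<omega> - X s \<omega>). v \<in> orthant \<and> v \<noteq> 0"
    by (simp only:)
  then show ?thesis by (subst (asm) AE_distr_iff) auto
qed

text \<open>An exponential Markov bound: S(n + 1) \<le> K has probability at most exp K times exp (-
  (n + 1) p) with p > 0.\<close>

lemma AE_unbounded: "AE \<omega> in M. \<forall>K::nat. \<exists>n::nat. real K < S (real (Suc n)) \<omega>"
  unfolding AE_all_countable
proof
  fix K :: nat
  define Z where "Z = {\<omega>\<in>space M. \<forall>n. S (real (Suc n)) \<omega> \<le> real K}"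
  have [measurable]: "X (real (Suc n)) \<in> borel_measurable M" for n by (intro random_vector) simp
  have Z[measurable]: "Z \<in> sets M" unfolding Z_def by measurable
  define p where "p = laplace_exp (0 + ones)"
  have p: "0 < p" unfolding p_def by (rule laplace_exp_pos) simp
  have le: "emeasure M Z \<le> ennreal (exp K * exp (- real (Suc n) * p))" for n
  proof -
    have "emeasure M Z = (\<integral>\<^sup>+\<omega>. indicator Z \<omega> \<partial>M)" by simp
    also have "\<dots> \<le> (\<integral>\<^sup>+\<omega>. ennreal (exp K) * ennreal (exp (- (ones \<bullet> X (real (Suc n)) \<omega>))) \<partial>M)"
    proof (rule nn_integral_mono)
      fix \<omega> assume \<omega>: "\<omega> \<in> space M"
      have "1 \<le> exp (real K) * exp (- S (real (Suc n)) \<omega>)" if "\<omega> \<in> Z"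
        using that by (simp add: exp_add[symmetric] Z_def)
      then show "indicator Z \<omega> \<le> ennreal (exp K) * ennreal (exp (- (ones \<bullet> X (real (Suc n)) \<omega>)))"
        using \<omega> by (auto simp: indicator_def ones_inner in_orthant ennreal_mult'[symmetric] simp flip: ennreal_1
            intro!: ennreal_leI)
    qed
    also have "\<dots> = ennreal (exp K) * ennreal (exp (- real (Suc n) * p))"
      using laplace_nn[OF ones_orthant, of "real (Suc n)"] by (subst nn_integral_cmult) (auto simp: p_def simp del: of_nat_Suc)
    finally show ?thesis by (simp add: ennreal_mult')
  qed
  have "(\<lambda>n. exp (real K) * exp (- real (Suc n) * p)) \<longlonglongrightarrow> 0" using p by real_asymp
  then have "(\<lambda>n. ennreal (exp (real K) * exp (- real (Suc n) * p))) \<longlonglongrightarrow> ennreal 0" by (rule tendsto_ennrealI)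
  then have "emeasure M Z \<le> ennreal 0" by (rule LIMSEQ_le_const) (use le in auto)
  then have "Z \<in> null_sets M" by (auto simp: null_sets_def)
  then show "AE \<omega> in M. \<exists>n::nat. real K < S (real (Suc n)) \<omega>"
    by (rule AE_I') (auto simp: Z_def not_less)
qed

text \<open>Increments between rational times are simultaneously in the orthant and nonzero.
  Right-continuity extends the order to all real times, and two intermediate rationals give
  strictness.\<close>

lemma AE_increasing_path: "AE \<omega> in M. increasing_path (\<lambda>t. X t \<omega>)"
proof -
  have "AE \<omega> in M. \<forall>p\<in>\<rat>. \<forall>q\<in>\<rat>. 0 \<le> p \<longrightarrow> p < q \<longrightarrow> X q \<omega> - X p \<omega> \<in> orthant \<and> X q \<omega> \<noteq> X p \<omega>"
    unfolding AE_ball_countable[OF countable_rat] using AE_increment by auto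
  then show ?thesis using start AE_unbounded AE_space
  proof eventually_elim
    case (elim \<omega>)
    have incr: "X t \<omega> - X s \<omega> \<in> orthant" if st: "0 \<le> s" "s < t" for s t
    proof (cases "s = 0")
      case True
      \<comment> \<open>The grid approximation from the right is for positive times, so s = 0 is
        treated directly.\<close>
      then show ?thesis using st in_orthant[OF elim(4), of t] elim(2) by simp
    next
      case False
      then have s: "0 < s" "0 < t" using st by auto
      show ?thesis
      proof (rule Lim_in_closed_set[OF closed_orthant _ trivial_limit_sequentially])
        show "(\<lambda>n. X (grid_hi n t) \<omega> - X (grid_hi n s) \<omega>) \<longlonglongrightarrow> X t \<omega> - X s \<omega>"
          using s by (intro tendsto_diff tendsto_grid_hi[of "\<lambda>r. X r \<omega>"] right_cont elim) auto
        \<comment> \<open>The midpoint separates the rational grid points: those for s eventually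
          fall below it, those for t lie at or beyond t.\<close>
        have "\<forall>\<^sub>F n in sequentially. grid_hi n s < (s + t) / 2"
          using s st by (intro order_tendstoD[OF grid_hi_tendsto]) auto
        then show "\<forall>\<^sub>F n in sequentially. X (grid_hi n t) \<omega> - X (grid_hi n s) \<omega> \<in> orthant"
        proof eventually_elim
          case (elim n)
          have "grid_hi n t \<in> \<rat>" "grid_hi n s \<in> \<rat>" by (simp_all add: grid_hi_def)
          moreover have "0 \<le> grid_hi n s" "grid_hi n s < grid_hi n t"
            using elim st grid_bounds(3)[OF s(2), of n] grid_bounds(3)[OF s(1), of n] s by auto
          ultimately show ?case using \<open>\<forall>p\<in>\<rat>. _ p\<close> by blast
        qed
      qed
    qed
    have mono: "S s \<omega> \<le> S t \<omega>" if "0 \<le> s" "s < t" for s t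
      using l1norm_diff[OF in_orthant[OF elim(4) that(1)] incr[OF that]] l1norm_nonneg[of "X t \<omega> - X s \<omega>"] by simp
    show ?case
    proof
      show "X 0 \<omega> = 0" by fact
      show "0 \<le> t \<Longrightarrow> X t \<omega> \<in> orthant" for t by (rule in_orthant[OF elim(4)])
      show "0 \<le> t \<Longrightarrow> ((\<lambda>r. X r \<omega>) \<longlongrightarrow> X t \<omega>) (at_right t)" for t by (rule right_cont[OF elim(4)])
      show "0 < t \<Longrightarrow> \<exists>l. ((\<lambda>r. X r \<omega>) \<longlongrightarrow> l) (at_left t)" for t by (rule left_limits[OF elim(4)])
      show "0 \<le> s \<Longrightarrow> s < t \<Longrightarrow> X t \<omega> - X s \<omega> \<in> orthant" for s t by (rule incr)
      show "S s \<omega> < S t \<omega>" if st: "0 \<le> s" "s < t" for s t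
      proof -
        obtain p where p: "p \<in> \<rat>" "s < p" "p < t" using Rats_dense_in_real[OF st(2)] by auto
        obtain q where q: "q \<in> \<rat>" "p < q" "q < t" using Rats_dense_in_real[OF p(3)] by auto
        have p0: "0 \<le> p" using p st by simp
        have pq: "X q \<omega> - X p \<omega> \<in> orthant" "X q \<omega> \<noteq> X p \<omega>" using elim(1) p q p0 by blast+
        have "S s \<omega> \<le> S p \<omega>" using mono st p by simp
        also have "S p \<omega> < S q \<omega>"
          using l1norm_diff[OF in_orthant[OF elim(4) p0] pq(1)] pq(2) l1norm_pos[of "X q \<omega> - X p \<omega>"] by simp
        also have "\<dots> \<le> S t \<omega>" using mono[of q t] q p0 p by simp
        finally show ?thesis .
      qed
      show "\<exists>t>0. y < S t \<omega>" for y
      proof -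
        obtain K :: nat where "y < real K" using reals_Archimedean2 by blast
        moreover obtain n where "real K < S (real (Suc n)) \<omega>" using elim(3) by blast
        ultimately have "y < S (real (Suc n)) \<omega>" by simp
        then show ?thesis by (intro exI[of _ "real (Suc n)"]) simp
      qed
    qed
  qed
qed

end

subsection \<open>Passage over levels and over the boundary\<close>

lemma first_passage_eq:
  "increasing_path (\<lambda>t. X t \<omega>) \<Longrightarrow>
    first_passage (norm_proc X) c \<omega> = increasing_path.passage (\<lambda>t. X t \<omega>) c"
  by (simp add: increasing_path.passage_def first_passage_def norm_proc_def)

lemma passesD:
  assumes "\<omega> \<in> passes M X c"
  shows "\<omega> \<in> space M" "0 < tau X c \<omega>" "first_passage (norm_proc X) c \<omega> = ereal (tau X c \<omega>)"
proof -
  show "\<omega> \<in> space M" using assms by (simp add: passes_def)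
  have "0 < first_passage (norm_proc X) c \<omega>" "first_passage (norm_proc X) c \<omega> < \<infinity>"
    using assms by (auto simp: passes_def)
  then show "first_passage (norm_proc X) c \<omega> = ereal (tau X c \<omega>)" "0 < tau X c \<omega>"
    unfolding tau_def by (cases "first_passage (norm_proc X) c \<omega>"; simp)+
qed

lemma passes_tau_iff:
  assumes "\<omega> \<in> space M" "0 < t"
  shows "\<omega> \<in> passes M X c \<and> tau X c \<omega> = t \<longleftrightarrow> first_passage (norm_proc X) c \<omega> = ereal t"
proof
  assume "\<omega> \<in> passes M X c \<and> tau X c \<omega> = t"
  then show "first_passage (norm_proc X) c \<omega> = ereal t" using passesD(3) by metis
next
  assume "first_passage (norm_proc X) c \<omega> = ereal t"
  then show "\<omega> \<in> passes M X c \<and> tau X c \<omega> = t" using assms by (simp add: passes_def tau_def)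
qed

text \<open>Kept apart from the process because constant levels are boundaries too: the same facts
  serve the passage over c and over a level y.\<close>

locale boundary =
  fixes c :: "real \<Rightarrow> real"
  assumes cont: "continuous_on {0<..} c" and anti: "antimono_on {0<..} c"
begin

lemma tau_le_iff:
  assumes "increasing_path (\<lambda>t. X t \<omega>)" "\<omega> \<in> passes M X c" "0 < r"
  shows "tau X c \<omega> \<le> r \<longleftrightarrow> c r \<le> l1norm (X r \<omega>)"
  using increasing_path.passage_le_iff[OF assms(1) cont anti assms(3)] passesD(3)[OF assms(2)]
  by (simp add: first_passage_eq[of X \<omega>, OF assms(1)])

lemma passes_tau_eq_iff:
  assumes "increasing_path (\<lambda>t. X t \<omega>)" "\<omega> \<in> space M" "0 < t"
  shows "\<omega> \<in> passes M X c \<and> tau X c \<omega> = t \<longleftrightarrow>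
    l1norm (left_lim (\<lambda>r. X r \<omega>) t) \<le> c t \<and> c t \<le> l1norm (X t \<omega>)"
  using increasing_path.passage_eq_iff[OF assms(1) cont anti assms(3)]
  by (simp add: passes_tau_iff[OF assms(2,3)] first_passage_eq[of X \<omega>, OF assms(1)])

end

lemma boundary_const: "boundary (\<lambda>_. y)"
  by (auto simp: boundary_def monotone_on_def)

lemma passes_level:
  assumes "increasing_path (\<lambda>t. X t \<omega>)" "\<omega> \<in> space M" "0 < y"
  shows "\<omega> \<in> passes M X (\<lambda>_. y)"
  using increasing_path.passage_level[OF assms(1,3)] assms(2)
  by (simp add: passes_def first_passage_eq[of X \<omega>, OF assms(1)])

section \<open>Measurability of passage times\<close>

context orthant_levy_process
begin

text \<open>A strict crossing persists to a slightly later rational time, by right-continuity of the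
  path and continuity of the boundary; this reduces the infimum to a countable union. The boundary
  may depend on z, which covers random levels.\<close>

lemma measurable_first_passage:
  assumes \<phi>: "\<phi> \<in> N \<rightarrow>\<^sub>M M"
    and G: "\<And>t. 0 < t \<Longrightarrow> G t \<in> borel_measurable N"
    and Gc: "\<And>z. z \<in> space N \<Longrightarrow> continuous_on {0<..} (\<lambda>t. G t z)"
  shows "(\<lambda>z. first_passage (norm_proc X) (\<lambda>t. G t z) (\<phi> z)) \<in> borel_measurable N"
proof (rule borel_measurableI_less)
  fix a :: ereal
  have iff: "first_passage (norm_proc X) (\<lambda>t. G t z) (\<phi> z) < a \<longleftrightarrow>
      (\<exists>q\<in>{q\<in>\<rat>. 0 < q \<and> ereal q < a}. G q z < S q (\<phi> z))" if z: "z \<in> space N" for z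
  proof
    assume "first_passage (norm_proc X) (\<lambda>t. G t z) (\<phi> z) < a"
    then obtain t where t: "0 < t" "G t z < S t (\<phi> z)" "ereal t < a"
      by (auto simp: first_passage_def Inf_less_iff norm_proc_def)
    have gc: "((\<lambda>t. G t z) \<longlongrightarrow> G t z) (at t)"
      using Gc[OF z] t continuous_on_eq_continuous_at[of "{0<..}" "\<lambda>t. G t z"] by (auto simp: isCont_def)
    have "((\<lambda>r. S r (\<phi> z) - G r z) \<longlongrightarrow> S t (\<phi> z) - G t z) (at_right t)"
      using t measurable_space[OF \<phi> z]
      by (intro tendsto_diff tendsto_l1norm right_cont filterlim_mono[OF gc order_refl]) (auto simp: at_le)
    then have "\<forall>\<^sub>F r in at_right t. 0 < S r (\<phi> z) - G r z" by (rule order_tendstoD) (use t in simp)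
    moreover have "\<forall>\<^sub>F r in at_right t. ereal r < a"
    proof -
      obtain t' where t': "ereal t < ereal t'" "ereal t' < a" using ereal_dense2[OF t(3)] by auto
      then have "\<forall>\<^sub>F r in at_right t. r < t'" by (auto simp: eventually_at_right_field intro!: exI[of _ t'])
      then show ?thesis
      proof eventually_elim
        case (elim r)
        then have "ereal r < ereal t'" by simp
        then show ?case using t'(2) by (rule less_trans)
      qed
    qed
    ultimately have "\<forall>\<^sub>F r in at_right t. G r z < S r (\<phi> z) \<and> ereal r < a" by eventually_elim simp
    then obtain b where b: "t < b" "\<And>r. t < r \<Longrightarrow> r < b \<Longrightarrow> G r z < S r (\<phi> z) \<and> ereal r < a"
      unfolding eventually_at_right_field by auto
    obtain q where "q \<in> \<rat>" "t < q" "q < b" using Rats_dense_in_real[OF b(1)] by auto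
    then show "\<exists>q\<in>{q\<in>\<rat>. 0 < q \<and> ereal q < a}. G q z < S q (\<phi> z)"
      using b(2)[of q] t(1) by (intro bexI[of _ q]) auto
  next
    assume "\<exists>q\<in>{q\<in>\<rat>. 0 < q \<and> ereal q < a}. G q z < S q (\<phi> z)"
    then show "first_passage (norm_proc X) (\<lambda>t. G t z) (\<phi> z) < a"
      by (auto simp: first_passage_def Inf_less_iff norm_proc_def)
  qed
  have q: "countable {q\<in>\<rat>. 0 < q \<and> ereal q < a}"
    by (rule countable_subset[OF _ countable_rat]) auto
  have "(\<Union>q\<in>{q\<in>\<rat>. 0 < q \<and> ereal q < a}. {z\<in>space N. G q z < S q (\<phi> z)}) \<in> sets N"
  proof (rule sets.countable_UN'[OF q], rule image_subsetI)
    fix q assume "q \<in> {q\<in>\<rat>. 0 < q \<and> ereal q < a}"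
    then have q0: "0 < q" by simp
    have [measurable]: "G q \<in> borel_measurable N" by (rule G[OF q0])
    have [measurable]: "(\<lambda>z. X q (\<phi> z)) \<in> borel_measurable N"
      using measurable_compose[OF \<phi> random_vector, of q] q0 by simp
    show "{z\<in>space N. G q z < S q (\<phi> z)} \<in> sets N" by measurable
  qed
  also have "(\<Union>q\<in>{q\<in>\<rat>. 0 < q \<and> ereal q < a}. {z\<in>space N. G q z < S q (\<phi> z)}) =
      {z\<in>space N. first_passage (norm_proc X) (\<lambda>t. G t z) (\<phi> z) < a}"
    using iff by auto
  finally show "{z\<in>space N. first_passage (norm_proc X) (\<lambda>t. G t z) (\<phi> z) < a} \<in> sets N" .
qed

end

section \<open>Exponentially distributed levels\<close>

definition unit_exponential :: "real measure" where
  "unit_exponential = density lborel (exponential_density 1)"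

lemma sets_unit_exponential [simp, measurable_cong]: "sets unit_exponential = sets borel"
  by (simp add: unit_exponential_def)

lemma space_unit_exponential [simp]: "space unit_exponential = UNIV"
  by (simp add: unit_exponential_def)

lemma prob_space_unit_exponential: "prob_space unit_exponential"
  unfolding unit_exponential_def by (rule prob_space_exponential_density) simp

text \<open>Single points are null, so half-open grid cells and the closed gap of a jump are covered
  alike. The mass is a difference of Laplace factors, which is the reason for this distribution of
  the level.\<close>

lemma emeasure_unit_exponential:
  assumes "0 \<le> a" "a \<le> b" and I: "I \<in> sets borel" "{a<..<b} \<subseteq> I" "I \<subseteq> {a..b}"
  shows "emeasure unit_exponential I = ennreal (exp (- a) - exp (- b))"
proof -
  have "emeasure unit_exponential I = (\<integral>\<^sup>+x. ennreal (exponential_density 1 x) * indicator I x \<partial>lborel)"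
    unfolding unit_exponential_def using I by (simp add: emeasure_density)
  also have "\<dots> = (\<integral>\<^sup>+x. ennreal (exp (- x)) * indicator {a..b} x \<partial>lborel)"
  proof (rule nn_integral_cong_AE)
    have "AE x in lborel. x \<noteq> a" "AE x in lborel. x \<noteq> b" by (rule AE_lborel_singleton)+
    then show "AE x in lborel. ennreal (exponential_density 1 x) * indicator I x =
        ennreal (exp (- x)) * indicator {a..b} x"
    proof eventually_elim
      case (elim x)
      then have "x \<in> I \<longleftrightarrow> x \<in> {a..b}" using I by (auto simp: less_le)
      then show ?case using assms(1) by (auto simp: exponential_density_def indicator_def)
    qed
  qed
  also have "\<dots> = ennreal (- exp (- b) - (- exp (- a)))"
    by (rule nn_integral_FTC_Icc)
      (use assms in \<open>auto intro!: derivative_eq_intros simp: has_real_derivative_iff_has_vector_derivative[symmetric]\<close>)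
  finally show ?thesis by simp
qed

lemma AE_unit_exponential_pos: "AE y in unit_exponential. 0 < y"
proof -
  have "AE y in lborel. y \<noteq> (0::real)" by (rule AE_lborel_singleton)
  then show ?thesis unfolding unit_exponential_def
    by (subst AE_density) (auto elim!: eventually_mono simp: exponential_density_def less_le)
qed

lemma nn_integral_exp_decay:
  assumes w: "0 < w"
  shows "(\<integral>\<^sup>+t. ennreal (exp (- w * t)) * indicator {0<..} t \<partial>lborel) = ennreal (1 / w)"
proof -
  interpret D: prob_space "density lborel (exponential_density w)" by (rule prob_space_exponential_density[OF w])
  have "1 = emeasure (density lborel (exponential_density w)) UNIV" using D.emeasure_space_1 by simp
  also have "\<dots> = (\<integral>\<^sup>+t. ennreal (exponential_density w t) \<partial>lborel)" by (simp add: emeasure_density)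
  also have "\<dots> = (\<integral>\<^sup>+t. ennreal w * (ennreal (exp (- w * t)) * indicator {0<..} t) \<partial>lborel)"
  proof (rule nn_integral_cong_AE)
    have "AE x in lborel. x \<noteq> (0::real)" by (rule AE_lborel_singleton)
    then show "AE t in lborel. ennreal (exponential_density w t) = ennreal w * (ennreal (exp (- w * t)) * indicator {0<..} t)"
      by eventually_elim (use w in \<open>auto simp: exponential_density_def indicator_def ennreal_mult' mult.commute\<close>)
  qed
  also have "\<dots> = ennreal w * (\<integral>\<^sup>+t. ennreal (exp (- w * t)) * indicator {0<..} t \<partial>lborel)"
    by (rule nn_integral_cmult) measurable
  finally have "ennreal (1 / w) * 1 = ennreal (1 / w) * (ennreal w * (\<integral>\<^sup>+t. ennreal (exp (- w * t)) * indicator {0<..} t \<partial>lborel))"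
    by simp
  then show ?thesis using w by (simp add: mult.assoc[symmetric] ennreal_mult'[symmetric])
qed

subsection \<open>The jump formula over exponential levels\<close>

lemma nonneg_coordinates_iff:
  fixes z :: "real \<times> (real ^ 'n) \<times> (real ^ 'n)"
  shows "(\<forall>b\<in>Basis. 0 \<le> z \<bullet> b) \<longleftrightarrow> 0 \<le> fst z \<and> fst (snd z) \<in> orthant \<and> snd (snd z) \<in> orthant"
  by (cases z) (auto simp: Basis_prod_def Basis_vec_def orthant_def inner_axis ball_Un)

context infinite_activity
begin

text \<open>The integrand is a difference of two integrands of \<open>laplace_exp\<close>. No
  further term appears because the exponent has no drift.\<close>

lemma laplace_exp_diff:
  assumes \<theta>: "\<theta> \<in> orthant"
  shows "(\<integral>\<^sup>+v. ennreal (exp (- (\<theta> \<bullet> v)) * (1 - exp (- l1norm v))) \<partial>Pm) =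
    ennreal (laplace_exp (\<theta> + ones) - laplace_exp \<theta>)"
proof -
  have \<theta>1: "\<theta> + ones \<in> orthant" using \<theta> by auto
  have "(\<integral>\<^sup>+v. ennreal (exp (- (\<theta> \<bullet> v)) * (1 - exp (- l1norm v))) \<partial>Pm) =
      (\<integral>\<^sup>+v. ennreal ((1 - exp (- ((\<theta> + ones) \<bullet> v))) - (1 - exp (- (\<theta> \<bullet> v)))) \<partial>Pm)"
    by (rule nn_integral_cong_AE)
      (use AE_Pm_orthant in eventually_elim, simp add: ones_inner inner_add_left exp_add[symmetric] algebra_simps)
  also have "\<dots> = ennreal (\<integral>v. (1 - exp (- ((\<theta> + ones) \<bullet> v))) - (1 - exp (- (\<theta> \<bullet> v))) \<partial>Pm)"
  proof (rule nn_integral_eq_integral)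
    show "integrable Pm (\<lambda>v. (1 - exp (- ((\<theta> + ones) \<bullet> v))) - (1 - exp (- (\<theta> \<bullet> v))))"
      by (intro Bochner_Integration.integrable_diff exponent_finite \<theta> \<theta>1)
    show "AE v in Pm. 0 \<le> (1 - exp (- ((\<theta> + ones) \<bullet> v))) - (1 - exp (- (\<theta> \<bullet> v)))"
      using AE_Pm_orthant by eventually_elim (simp add: inner_add_left ones_inner l1norm_nonneg)
  qed
  also have "\<dots> = ennreal (laplace_exp (\<theta> + ones) - laplace_exp \<theta>)"
    unfolding laplace_exp_def
    by (subst Bochner_Integration.integral_diff[OF exponent_finite[OF \<theta>1] exponent_finite[OF \<theta>]]) simp
  finally show ?thesis .
qed

lemma laplace_exp_mono: assumes \<theta>: "\<theta> \<in> orthant" shows "laplace_exp \<theta> \<le> laplace_exp (\<theta> + ones)"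
  unfolding laplace_exp_def
proof (rule integral_mono_AE)
  show "integrable Pm (\<lambda>v. 1 - exp (- (\<theta> \<bullet> v)))" "integrable Pm (\<lambda>v. 1 - exp (- ((\<theta> + ones) \<bullet> v)))"
    using \<theta> by (auto intro!: exponent_finite)
  show "AE v in Pm. 1 - exp (- (\<theta> \<bullet> v)) \<le> 1 - exp (- ((\<theta> + ones) \<bullet> v))"
    using AE_Pm_orthant by eventually_elim (simp add: inner_add_left ones_inner l1norm_nonneg)
qed

text \<open>The finite-time counterpart over a step h; divided by h, its right-hand side tends to
  the difference of exponents as h tends to 0.\<close>

lemma laplace_increment:
  assumes \<theta>: "\<theta> \<in> orthant" and h: "0 \<le> h"
  shows "(\<integral>\<^sup>+\<omega>. ennreal (exp (- (\<theta> \<bullet> X h \<omega>)) * (1 - exp (- l1norm (X h \<omega>)))) \<partial>M) =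
    ennreal (exp (- h * laplace_exp \<theta>) - exp (- h * laplace_exp (\<theta> + ones)))"
proof -
  have [measurable]: "X h \<in> borel_measurable M" using h by (rule random_vector)
  have \<theta>1: "\<theta> + ones \<in> orthant" using \<theta> by auto
  have "(\<integral>\<^sup>+\<omega>. ennreal (exp (- (\<theta> \<bullet> X h \<omega>)) * (1 - exp (- l1norm (X h \<omega>)))) \<partial>M) =
      (\<integral>\<^sup>+\<omega>. ennreal (exp (- (\<theta> \<bullet> X h \<omega>))) - ennreal (exp (- ((\<theta> + ones) \<bullet> X h \<omega>))) \<partial>M)"
  proof (rule nn_integral_cong)
    fix \<omega> assume "\<omega> \<in> space M"
    then have "exp (- ((\<theta> + ones) \<bullet> X h \<omega>)) = exp (- (\<theta> \<bullet> X h \<omega>)) * exp (- l1norm (X h \<omega>))"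
      using in_orthant[of \<omega> h] h by (simp add: inner_add_left ones_inner exp_add[symmetric])
    then show "ennreal (exp (- (\<theta> \<bullet> X h \<omega>)) * (1 - exp (- l1norm (X h \<omega>)))) =
        ennreal (exp (- (\<theta> \<bullet> X h \<omega>))) - ennreal (exp (- ((\<theta> + ones) \<bullet> X h \<omega>)))"
      by (simp add: ennreal_minus algebra_simps)
  qed
  also have "\<dots> = (\<integral>\<^sup>+\<omega>. ennreal (exp (- (\<theta> \<bullet> X h \<omega>))) \<partial>M) - (\<integral>\<^sup>+\<omega>. ennreal (exp (- ((\<theta> + ones) \<bullet> X h \<omega>))) \<partial>M)"
  proof (rule nn_integral_diff)
    show "(\<integral>\<^sup>+\<omega>. ennreal (exp (- ((\<theta> + ones) \<bullet> X h \<omega>))) \<partial>M) \<noteq> \<infinity>" by (simp add: laplace_nn[OF \<theta>1 h])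
    show "AE \<omega> in M. ennreal (exp (- ((\<theta> + ones) \<bullet> X h \<omega>))) \<le> ennreal (exp (- (\<theta> \<bullet> X h \<omega>)))"
      using h by (intro AE_I2) (auto intro!: ennreal_leI simp: inner_add_left ones_inner in_orthant l1norm_nonneg)
  qed measurable
  also have "\<dots> = ennreal (exp (- h * laplace_exp \<theta>) - exp (- h * laplace_exp (\<theta> + ones)))"
    by (simp add: laplace_nn[OF \<theta>1 h] laplace_nn[OF \<theta> h] ennreal_minus)
  finally show ?thesis .
qed

section \<open>Passage data at a random level and their grid version\<close>

definition level_time :: "'a \<times> real \<Rightarrow> real" where
  "level_time z = tau X (\<lambda>_. snd z) (fst z)"

lemma level_time_measurable [measurable]: "level_time \<in> borel_measurable (M \<Otimes>\<^sub>M unit_exponential)"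
  unfolding level_time_def[abs_def] tau_def
  by (intro borel_measurable_real_of_ereal measurable_first_passage) auto

text \<open>The guards with default 0 make this measurable on the whole product; for increasing
  paths and positive levels it is the triple of passage time, pre-passage value and jump.\<close>

definition level_jump :: "'a \<times> real \<Rightarrow> real \<times> (real ^ 'n) \<times> (real ^ 'n)" where
  "level_jump z = (level_time z,
    (if 0 < level_time z then left_lim (\<lambda>r. X r (fst z)) (level_time z) else 0),
    (if 0 < level_time z then X (level_time z) (fst z) else 0) -
      (if 0 < level_time z then left_lim (\<lambda>r. X r (fst z)) (level_time z) else 0))"

lemma level_jump_measurable [measurable]: "level_jump \<in> (M \<Otimes>\<^sub>M unit_exponential) \<rightarrow>\<^sub>M borel"
proof -
  note [measurable] = measurable_at_hitting[OF level_time_measurable measurable_fst]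
  show ?thesis unfolding level_jump_def[abs_def] borel_prod[symmetric] by measurable
qed

lemma level_jump_eq:
  assumes "increasing_path (\<lambda>t. X t \<omega>)" "\<omega> \<in> space M" "0 < y"
  shows "level_jump (\<omega>, y) = (tau X (\<lambda>_. y) \<omega>, pre_X X (\<lambda>_. y) \<omega>, jump_X X (\<lambda>_. y) \<omega>)"
  using passesD(2)[OF passes_level[of X \<omega>, OF assms]]
  by (simp add: level_jump_def level_time_def pre_X_def jump_X_def jump_def)

lemma level_time_le_iff:
  assumes "increasing_path (\<lambda>t. X t \<omega>)" "\<omega> \<in> space M" "0 < y" "0 \<le> r"
  shows "level_time (\<omega>, y) \<le> r \<longleftrightarrow> y \<le> S r \<omega>"
proof (cases "r = 0")
  case True
  then show ?thesis
    using passesD(2)[OF passes_level[of X \<omega>, OF assms(1-3)]] assms(3) increasing_path.start_0[OF assms(1)]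
    by (simp add: level_time_def)
next
  case False
  then show ?thesis
    using boundary.tau_le_iff[OF boundary_const, where X=X and \<omega>=\<omega>, OF assms(1) passes_level[of X \<omega>, OF assms(1-3)], of r] assms(4)
    by (simp add: level_time_def)
qed

text \<open>Laplace factor of the passage data as read off on cell k: time and position at its left
  end, and the increment over the cell in place of the jump.\<close>

definition jump_cell :: "real \<Rightarrow> real ^ 'n \<Rightarrow> real ^ 'n \<Rightarrow> nat \<Rightarrow> nat \<Rightarrow> 'a \<Rightarrow> real" where
  "jump_cell \<alpha> \<beta> \<theta> n k \<omega> = exp (- (\<alpha> * (k / Suc n) + \<beta> \<bullet> X (k / Suc n) \<omega> +
      \<theta> \<bullet> (X (Suc k / Suc n) \<omega> - X (k / Suc n) \<omega>)))"

text \<open>Integrating out the level gives exp (- S(r)) times 1 - exp (- |increment|). The first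
  factor shifts \<beta> by \<open>ones\<close>, the second belongs to the independent increment. As
  r = k h, the dependence on k is a pure power, so the cells form a geometric series.\<close>

lemma jump_cell_integral:
  fixes n k :: nat
  assumes \<alpha>: "0 \<le> \<alpha>" and \<beta>: "\<beta> \<in> orthant" and \<theta>: "\<theta> \<in> orthant"
  defines "h \<equiv> 1 / real (Suc n)"
  shows "(\<integral>\<^sup>+\<omega>. \<integral>\<^sup>+y. ennreal (jump_cell \<alpha> \<beta> \<theta> n k \<omega>) *
        indicator {S (k / Suc n) \<omega><..S (Suc k / Suc n) \<omega>} y \<partial>unit_exponential \<partial>M) =
    ennreal (exp (- h * (\<alpha> + laplace_exp (\<beta> + ones))) ^ k *
      (exp (- h * laplace_exp \<theta>) - exp (- h * laplace_exp (\<theta> + ones))))"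
proof -
  define r where "r = real k / real (Suc n)"
  have r: "0 \<le> r" and h: "0 \<le> h" and rh: "real (Suc k) / real (Suc n) = r + h" and rk: "r = real k * h"
    by (simp_all add: r_def h_def add_divide_distrib)
  have \<beta>1: "\<beta> + ones \<in> orthant" using \<beta> by auto
  have [measurable]: "X r \<in> borel_measurable M" "X h \<in> borel_measurable M"
    using r h by (auto intro: random_vector)
  \<comment> \<open>\<open>fst p\<close> stands for X(r) and \<open>snd p\<close> for the increment;
    the two factors separate under independence.\<close>
  define H where "H p = ennreal (exp (- (\<alpha> * r)) * exp (- ((\<beta> + ones) \<bullet> fst p))) *
      ennreal (exp (- (\<theta> \<bullet> snd p)) * (1 - exp (- l1norm (snd p))))" for p :: "(real ^ 'n) \<times> (real ^ 'n)"
  have H: "H \<in> borel_measurable borel" unfolding H_def[abs_def] borel_prod[symmetric] by measurable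
  have "(\<integral>\<^sup>+\<omega>. \<integral>\<^sup>+y. ennreal (jump_cell \<alpha> \<beta> \<theta> n k \<omega>) *
        indicator {S (k / Suc n) \<omega><..S (Suc k / Suc n) \<omega>} y \<partial>unit_exponential \<partial>M) =
      (\<integral>\<^sup>+\<omega>. H (X r \<omega>, X (r + h) \<omega> - X r \<omega>) \<partial>M)"
  proof (rule nn_integral_cong_AE)
    show "AE \<omega> in M. (\<integral>\<^sup>+y. ennreal (jump_cell \<alpha> \<beta> \<theta> n k \<omega>) *
        indicator {S (k / Suc n) \<omega><..S (Suc k / Suc n) \<omega>} y \<partial>unit_exponential) = H (X r \<omega>, X (r + h) \<omega> - X r \<omega>)"
      using AE_increasing_path
    proof eventually_elim
      case (elim \<omega>)
      interpret increasing_path "\<lambda>t. X t \<omega>" by fact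
      have h0: "r < r + h" by (simp add: h_def)
      define a b \<eta> where "a = S r \<omega>" "b = S (r + h) \<omega>" "\<eta> = X (r + h) \<omega> - X r \<omega>"
      have ab: "0 \<le> a" "a \<le> b" "b = a + l1norm \<eta>"
        using strict[OF r h0] l1norm_diff[OF nonneg[OF r] incr[OF r h0]] by (simp_all add: a_b_\<eta>_def l1norm_nonneg)
      have "(\<integral>\<^sup>+y. ennreal (jump_cell \<alpha> \<beta> \<theta> n k \<omega>) *
          indicator {S (k / Suc n) \<omega><..S (Suc k / Suc n) \<omega>} y \<partial>unit_exponential) =
        ennreal (jump_cell \<alpha> \<beta> \<theta> n k \<omega>) * emeasure unit_exponential {a<..b}"
        unfolding rh r_def[symmetric] a_b_\<eta>_def by (subst nn_integral_cmult) auto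
      moreover have "emeasure unit_exponential {a<..b} = ennreal (exp (- a) - exp (- b))"
        using ab by (intro emeasure_unit_exponential) auto
      moreover have "exp (- a) - exp (- b) = exp (- (ones \<bullet> X r \<omega>)) * (1 - exp (- l1norm \<eta>))"
        using ab nonneg[OF r] by (simp add: a_b_\<eta>_def(1) ones_inner right_diff_distrib mult_exp_exp)
      moreover have "jump_cell \<alpha> \<beta> \<theta> n k \<omega> = exp (- (\<alpha> * r)) * exp (- (\<beta> \<bullet> X r \<omega>)) * exp (- (\<theta> \<bullet> \<eta>))"
        unfolding jump_cell_def rh r_def[symmetric] a_b_\<eta>_def by (simp add: exp_add[symmetric])
      moreover have "exp (- ((\<beta> + ones) \<bullet> X r \<omega>)) = exp (- (\<beta> \<bullet> X r \<omega>)) * exp (- (ones \<bullet> X r \<omega>))"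
        by (simp add: inner_add_left mult_exp_exp)
      ultimately show ?case
        unfolding H_def a_b_\<eta>_def(3)[symmetric] fst_conv snd_conv
        by (simp add: ennreal_mult'[symmetric] ennreal_mult''[symmetric] l1norm_nonneg mult_ac)
    qed
  qed
  also have "\<dots> = (\<integral>\<^sup>+\<omega>. \<integral>\<^sup>+\<omega>'. H (X r \<omega>, X h \<omega>') \<partial>M \<partial>M)"
    by (rule increment_nn_integral[OF r h H])
  also have "\<dots> = ennreal (exp (- (\<alpha> * r))) * ennreal (exp (- r * laplace_exp (\<beta> + ones))) *
      ennreal (exp (- h * laplace_exp \<theta>) - exp (- h * laplace_exp (\<theta> + ones)))"
    unfolding H_def fst_conv snd_conv
    apply (subst nn_integral_cmult)
     apply measurable
    apply (subst laplace_increment[OF \<theta> h])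
    apply (subst nn_integral_multc)
     apply measurable
    apply (subst ennreal_mult')
     apply simp
    apply (subst nn_integral_cmult)
     apply measurable
    apply (subst laplace_nn[OF \<beta>1 r])
    apply (rule refl)
    done
  also have "\<dots> = ennreal (exp (- (\<alpha> * r)) * exp (- r * laplace_exp (\<beta> + ones)) *
      (exp (- h * laplace_exp \<theta>) - exp (- h * laplace_exp (\<theta> + ones))))"
    by (simp add: ennreal_mult')
  also have "exp (- (\<alpha> * r)) * exp (- r * laplace_exp (\<beta> + ones)) = exp (- h * (\<alpha> + laplace_exp (\<beta> + ones))) ^ k"
    unfolding rk by (simp add: exp_of_nat_mult[symmetric] exp_add[symmetric] algebra_simps)
  finally show ?thesis .
qed

end

context infinite_activity
begin

text \<open>The level lies in exactly one cell, the one that contains its passage time, so the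
  series has a single nonzero term.\<close>

lemma level_jump_discretized:
  assumes path: "increasing_path (\<lambda>t. X t \<omega>)" and \<omega>: "\<omega> \<in> space M" and y: "0 < y"
  defines "T \<equiv> level_time (\<omega>, y)"
  shows "(\<Sum>k. ennreal (jump_cell \<alpha> \<beta> \<theta> n k \<omega>) * indicator {S (k / Suc n) \<omega><..S (Suc k / Suc n) \<omega>} y) =
    ennreal (exp (- (\<alpha> * grid_lo n T + \<beta> \<bullet> X (grid_lo n T) \<omega> + \<theta> \<bullet> (X (grid_hi n T) \<omega> - X (grid_lo n T) \<omega>))))"
proof -
  have T0: "0 < T" using passesD(2)[OF passes_level[of X \<omega>, OF path \<omega> y]] by (simp add: T_def level_time_def)
  obtain k where k: "grid_index n T = Suc k" using grid_index_pos[OF T0] by blast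
  have iff: "y \<in> {S (j / Suc n) \<omega><..S (Suc j / Suc n) \<omega>} \<longleftrightarrow> grid_index n T = Suc j" for j
    using level_time_le_iff[OF path \<omega> y, of "real j / real (Suc n)"]
      level_time_le_iff[OF path \<omega> y, of "real (Suc j) / real (Suc n)"]
    unfolding grid_index_eq_Suc T_def by (auto simp: not_le simp del: of_nat_Suc)
  have "(\<Sum>j. ennreal (jump_cell \<alpha> \<beta> \<theta> n j \<omega>) * indicator {S (j / Suc n) \<omega><..S (Suc j / Suc n) \<omega>} y) =
    (\<Sum>j\<in>{k}. ennreal (jump_cell \<alpha> \<beta> \<theta> n j \<omega>) * indicator {S (j / Suc n) \<omega><..S (Suc j / Suc n) \<omega>} y)"
    by (rule suminf_finite) (use iff k in \<open>auto simp: indicator_def\<close>)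
  also have "\<dots> = ennreal (jump_cell \<alpha> \<beta> \<theta> n k \<omega>)"
    using iff[of k] k by simp
  also have "jump_cell \<alpha> \<beta> \<theta> n k \<omega> = exp (- (\<alpha> * grid_lo n T + \<beta> \<bullet> X (grid_lo n T) \<omega> +
      \<theta> \<bullet> (X (grid_hi n T) \<omega> - X (grid_lo n T) \<omega>)))"
    unfolding jump_cell_def grid_lo_def grid_hi_def k by simp
  finally show ?thesis .
qed

lemma AE_level: "AE z in M \<Otimes>\<^sub>M unit_exponential. increasing_path (\<lambda>t. X t (fst z)) \<and> fst z \<in> space M \<and> 0 < snd z"
proof -
  interpret E: prob_space unit_exponential by (rule prob_space_unit_exponential)
  interpret P: pair_prob_space M unit_exponential ..
  have "AE \<omega> in distr (M \<Otimes>\<^sub>M unit_exponential) M fst. increasing_path (\<lambda>t. X t \<omega>)"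
    unfolding E.distr_pair_fst by (rule AE_increasing_path)
  then have 1: "AE z in M \<Otimes>\<^sub>M unit_exponential. increasing_path (\<lambda>t. X t (fst z))"
    by (rule AE_distrD[OF measurable_fst])
  have 2: "AE z in M \<Otimes>\<^sub>M unit_exponential. 0 < snd z"
  proof (rule P.AE_pair_measure)
    show "{z \<in> space (M \<Otimes>\<^sub>M unit_exponential). 0 < snd z} \<in> sets (M \<Otimes>\<^sub>M unit_exponential)"
      by measurable
  qed (use AE_unit_exponential_pos in auto)
  show ?thesis using 1 2 AE_space by eventually_elim (auto simp: space_pair_measure)
qed

text \<open>Summing the cells with step h gives (exp (- h p) - exp (- h q)) / (1 - exp (- h w)),
  which tends to (q - p) / w. At the same time the discretised data converge to the passage data,
  and everything is dominated by 1.\<close>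

lemma level_jump_laplace:
  assumes \<alpha>: "0 \<le> \<alpha>" and \<beta>: "\<beta> \<in> orthant" and \<theta>: "\<theta> \<in> orthant"
  shows "(\<integral>\<^sup>+z. ennreal (exp (- ((\<alpha>, \<beta>, \<theta>) \<bullet> level_jump z))) \<partial>(M \<Otimes>\<^sub>M unit_exponential)) =
    ennreal ((laplace_exp (\<theta> + ones) - laplace_exp \<theta>) / (\<alpha> + laplace_exp (\<beta> + ones)))"
proof -
  interpret E: prob_space unit_exponential by (rule prob_space_unit_exponential)
  interpret P: pair_prob_space M unit_exponential ..
  define w where "w = \<alpha> + laplace_exp (\<beta> + ones)"
  have w: "0 < w" using laplace_exp_pos[OF \<beta>] \<alpha> by (simp add: w_def)
  define p q where "p = laplace_exp \<theta>" and "q = laplace_exp (\<theta> + ones)"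
  have pq: "p \<le> q" unfolding p_def q_def by (rule laplace_exp_mono[OF \<theta>])
  have X[measurable]: "X (k / Suc n) \<in> borel_measurable M" for k n :: nat by (rule random_vector) simp
  have X'[measurable]: "X (Suc k / Suc n) \<in> borel_measurable M" for k n :: nat by (rule random_vector) simp
  have J[measurable]: "jump_cell \<alpha> \<beta> \<theta> n k \<in> borel_measurable M" for n k
    unfolding jump_cell_def[abs_def] by measurable
  define G where "G n k z = ennreal (jump_cell \<alpha> \<beta> \<theta> n k (fst z)) *
      indicator {S (k / Suc n) (fst z)<..S (Suc k / Suc n) (fst z)} (snd z)" for n k and z :: "'a \<times> real"
  have ind: "indicator {a<..b} c = (if a < c \<and> c \<le> b then 1 else 0 :: ennreal)" for a b c :: real by simp
  have G[measurable]: "G n k \<in> borel_measurable (M \<Otimes>\<^sub>M unit_exponential)" for n k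
    unfolding G_def[abs_def] ind by measurable
  have int: "(\<integral>\<^sup>+z. (\<Sum>k. G n k z) \<partial>(M \<Otimes>\<^sub>M unit_exponential)) =
      ennreal ((exp (- (1 / real (Suc n)) * p) - exp (- (1 / real (Suc n)) * q)) / (1 - exp (- (1 / real (Suc n)) * w)))" for n
  proof -
    define h where "h = 1 / real (Suc n)"
    have h: "0 < h" by (simp add: h_def)
    have "(\<integral>\<^sup>+z. (\<Sum>k. G n k z) \<partial>(M \<Otimes>\<^sub>M unit_exponential)) = (\<Sum>k. \<integral>\<^sup>+z. G n k z \<partial>(M \<Otimes>\<^sub>M unit_exponential))"
      by (rule nn_integral_suminf) measurable
    also have "\<dots> = (\<Sum>k. ennreal (exp (- h * w) ^ k * (exp (- h * p) - exp (- h * q))))"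
    proof (rule suminf_cong)
      fix k
      have "(\<integral>\<^sup>+z. G n k z \<partial>(M \<Otimes>\<^sub>M unit_exponential)) = (\<integral>\<^sup>+\<omega>. \<integral>\<^sup>+y. G n k (\<omega>, y) \<partial>unit_exponential \<partial>M)"
        by (rule E.nn_integral_fst[symmetric]) measurable
      also have "\<dots> = ennreal (exp (- h * w) ^ k * (exp (- h * p) - exp (- h * q)))"
        unfolding G_def fst_conv snd_conv h_def w_def p_def q_def by (rule jump_cell_integral[OF \<alpha> \<beta> \<theta>])
      finally show "(\<integral>\<^sup>+z. G n k z \<partial>(M \<Otimes>\<^sub>M unit_exponential)) = ennreal (exp (- h * w) ^ k * (exp (- h * p) - exp (- h * q)))" .
    qed
    also have "\<dots> = ennreal ((1 / (1 - exp (- h * w))) * (exp (- h * p) - exp (- h * q)))"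
    proof (rule suminf_ennreal_eq)
      have le: "exp (- h * q) \<le> exp (- h * p)" using pq h by (simp add: mult_left_mono)
      then show "0 \<le> exp (- h * w) ^ k * (exp (- h * p) - exp (- h * q))" for k by simp
      show "(\<lambda>k. exp (- h * w) ^ k * (exp (- h * p) - exp (- h * q))) sums
          ((1 / (1 - exp (- h * w))) * (exp (- h * p) - exp (- h * q)))"
        by (intro sums_mult2 geometric_sums) (use w h in simp)
    qed
    finally show ?thesis by (simp add: h_def)
  qed
  have lim1: "(\<lambda>n. \<integral>\<^sup>+z. (\<Sum>k. G n k z) \<partial>(M \<Otimes>\<^sub>M unit_exponential)) \<longlonglongrightarrow> ennreal ((q - p) / w)"
    unfolding int
  proof (rule tendsto_ennrealI)
    show "(\<lambda>n. (exp (- (1 / real (Suc n)) * p) - exp (- (1 / real (Suc n)) * q)) /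
        (1 - exp (- (1 / real (Suc n)) * w))) \<longlonglongrightarrow> (q - p) / w"
    \<comment> \<open>For p = q both sides are 0; otherwise numerator and denominator behave like h
      (q - p) and h w.\<close>
    proof (cases "p = q")
      case False
      then have "p < q" using pq by simp
      then have "(\<lambda>n. (exp (- (1 / real (Suc n)) * p) - exp (- (1 / real (Suc n)) * q)) /
          (1 - exp (- (1 / real (Suc n)) * w))) \<longlonglongrightarrow> (q - p) * inverse w" using w by real_asymp
      then show ?thesis by (simp only: divide_inverse)
    qed simp
  qed
  have lim2: "(\<lambda>n. \<integral>\<^sup>+z. (\<Sum>k. G n k z) \<partial>(M \<Otimes>\<^sub>M unit_exponential)) \<longlonglongrightarrow>
      (\<integral>\<^sup>+z. ennreal (exp (- ((\<alpha>, \<beta>, \<theta>) \<bullet> level_jump z))) \<partial>(M \<Otimes>\<^sub>M unit_exponential))"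
  proof (rule nn_integral_dominated_convergence[where w="\<lambda>_. 1"])
    show "(\<lambda>z. \<Sum>k. G n k z) \<in> borel_measurable (M \<Otimes>\<^sub>M unit_exponential)" for n by measurable
    show "(\<integral>\<^sup>+z. 1 \<partial>(M \<Otimes>\<^sub>M unit_exponential)) < \<infinity>" by (simp add: P.emeasure_space_1)
    show "AE z in M \<Otimes>\<^sub>M unit_exponential. (\<Sum>k. G n k z) \<le> 1" for n
      using AE_level
    proof eventually_elim
      case (elim z)
      then interpret increasing_path "\<lambda>t. X t (fst z)" by simp
      define T where "T = level_time z"
      have T: "0 < T" using passesD(2)[OF passes_level[of X "fst z" M "snd z"]] elim by (simp add: T_def level_time_def)
      note b = grid_bounds[OF T, of n]
      have o: "X (grid_lo n T) (fst z) \<in> orthant" "X (grid_hi n T) (fst z) - X (grid_lo n T) (fst z) \<in> orthant"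
        using nonneg[OF b(1)] incr[OF b(1), of "grid_hi n T"] b(4) by auto
      have "(\<Sum>k. G n k z) = ennreal (exp (- (\<alpha> * grid_lo n T + \<beta> \<bullet> X (grid_lo n T) (fst z) +
          \<theta> \<bullet> (X (grid_hi n T) (fst z) - X (grid_lo n T) (fst z)))))"
        using level_jump_discretized[of "fst z" "snd z" \<alpha> \<beta> \<theta> n] elim by (simp add: G_def T_def)
      also have "\<dots> \<le> ennreal 1"
        using mult_nonneg_nonneg[OF \<alpha> b(1)] orthant_inner_nonneg[OF \<beta> o(1)] orthant_inner_nonneg[OF \<theta> o(2)]
        by (intro ennreal_leI) simp
      finally show ?case by simp
    qed
    show "AE z in M \<Otimes>\<^sub>M unit_exponential. (\<lambda>n. \<Sum>k. G n k z) \<longlonglongrightarrow> ennreal (exp (- ((\<alpha>, \<beta>, \<theta>) \<bullet> level_jump z)))"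
      using AE_level
    proof eventually_elim
      case (elim z)
      then interpret increasing_path "\<lambda>t. X t (fst z)" by simp
      define T where "T = level_time z"
      have T: "0 < T" using passesD(2)[OF passes_level[of X "fst z" M "snd z"]] elim by (simp add: T_def level_time_def)
      have lo: "(\<lambda>n. X (grid_lo n T) (fst z)) \<longlonglongrightarrow> left_lim (\<lambda>r. X r (fst z)) T"
        using tendsto_grid_lo[OF left_limit[OF T] T] .
      have hi: "(\<lambda>n. X (grid_hi n T) (fst z)) \<longlonglongrightarrow> X T (fst z)"
        using tendsto_grid_hi[OF right_cts T] T by simp
      have "(\<lambda>n. ennreal (exp (- (\<alpha> * grid_lo n T + \<beta> \<bullet> X (grid_lo n T) (fst z) +
          \<theta> \<bullet> (X (grid_hi n T) (fst z) - X (grid_lo n T) (fst z)))))) \<longlonglongrightarrow>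
          ennreal (exp (- (\<alpha> * T + \<beta> \<bullet> left_lim (\<lambda>r. X r (fst z)) T +
            \<theta> \<bullet> (X T (fst z) - left_lim (\<lambda>r. X r (fst z)) T))))"
        by (intro tendsto_ennrealI tendsto_intros lo hi grid_lo_tendsto[OF T])
      moreover have "(\<alpha>, \<beta>, \<theta>) \<bullet> level_jump z = \<alpha> * T + \<beta> \<bullet> left_lim (\<lambda>r. X r (fst z)) T +
            \<theta> \<bullet> (X T (fst z) - left_lim (\<lambda>r. X r (fst z)) T)"
        using T by (simp add: level_jump_def T_def)
      ultimately show ?case
        using level_jump_discretized[of "fst z" "snd z" \<alpha> \<beta> \<theta>] elim by (simp add: G_def T_def)
    qed
  qed measurable
  show ?thesis using LIMSEQ_unique[OF lim2 lim1] by (simp add: p_def q_def w_def)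
qed

text \<open>The candidate law, realised as an image of the product of Lebesgue measure,
  \<open>M\<close> and \<open>Pm\<close>: carrying the sample point along avoids a kernel for the
  law of X(t), and the guard at times that are not positive secures joint measurability.\<close>

definition jump_intensity :: "(real \<times> (real ^ 'n) \<times> (real ^ 'n)) measure" where
  "jump_intensity = distr
    (density (lborel \<Otimes>\<^sub>M (M \<Otimes>\<^sub>M Pm))
      (\<lambda>z. indicator {0<..} (fst z) * ennreal (exp (- l1norm (if 0 < fst z then X (fst z) (fst (snd z)) else 0)) *
        (1 - exp (- l1norm (snd (snd z)))))))
    borel (\<lambda>z. (fst z, (if 0 < fst z then X (fst z) (fst (snd z)) else 0), snd (snd z)))"

lemma jump_intensity_nn_integral:
  assumes H[measurable]: "H \<in> borel_measurable borel"
  shows "(\<integral>\<^sup>+p. H p \<partial>jump_intensity) =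
    (\<integral>\<^sup>+t\<in>{0<..}. \<integral>\<^sup>+\<omega>. \<integral>\<^sup>+v. ennreal (exp (- S t \<omega>) * (1 - exp (- l1norm v))) * H (t, X t \<omega>, v) \<partial>Pm \<partial>M \<partial>lborel)"
proof -
  interpret MP: pair_sigma_finite M Pm ..
  define Xp where "Xp z = (if 0 < fst z then X (fst z) (fst (snd z)) else 0)" for z :: "real \<times> 'a \<times> (real ^ 'n)"
  have Xp[measurable]: "Xp \<in> borel_measurable (lborel \<Otimes>\<^sub>M (M \<Otimes>\<^sub>M Pm))"
    unfolding Xp_def[abs_def] by (rule measurable_at_hitting) measurable
  have H'[measurable]: "H \<in> borel_measurable (borel \<Otimes>\<^sub>M borel \<Otimes>\<^sub>M borel)" by (simp add: borel_prod)
  have g[measurable]: "(\<lambda>z. (fst z, Xp z, snd (snd z))) \<in> (lborel \<Otimes>\<^sub>M (M \<Otimes>\<^sub>M Pm)) \<rightarrow>\<^sub>M borel"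
    unfolding borel_prod[symmetric] by measurable
  define f where "f z = indicator {0<..} (fst z) * ennreal (exp (- l1norm (Xp z)) * (1 - exp (- l1norm (snd (snd z))))) *
      H (fst z, Xp z, snd (snd z))" for z
  have f[measurable]: "f \<in> borel_measurable (lborel \<Otimes>\<^sub>M (M \<Otimes>\<^sub>M Pm))" unfolding f_def[abs_def] by measurable
  have ft[measurable]: "(\<lambda>p. f (t, p)) \<in> borel_measurable (M \<Otimes>\<^sub>M Pm)" for t
    by (rule measurable_compose[OF measurable_Pair1' f]) simp
  have "(\<integral>\<^sup>+p. H p \<partial>jump_intensity) = (\<integral>\<^sup>+z. f z \<partial>(lborel \<Otimes>\<^sub>M (M \<Otimes>\<^sub>M Pm)))"
    unfolding jump_intensity_def Xp_def[symmetric]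
    by (simp add: nn_integral_distr nn_integral_density f_def)
  also have "\<dots> = (\<integral>\<^sup>+t. \<integral>\<^sup>+p. f (t, p) \<partial>(M \<Otimes>\<^sub>M Pm) \<partial>lborel)"
    by (rule MP.nn_integral_fst[symmetric, OF f])
  also have "\<dots> = (\<integral>\<^sup>+t. \<integral>\<^sup>+\<omega>. \<integral>\<^sup>+v. f (t, \<omega>, v) \<partial>Pm \<partial>M \<partial>lborel)"
    by (simp only: Pm.nn_integral_fst[symmetric, OF ft])
  also have "\<dots> = (\<integral>\<^sup>+t\<in>{0<..}. \<integral>\<^sup>+\<omega>. \<integral>\<^sup>+v. ennreal (exp (- S t \<omega>) * (1 - exp (- l1norm v))) * H (t, X t \<omega>, v) \<partial>Pm \<partial>M \<partial>lborel)"
    by (rule nn_integral_cong) (auto simp: f_def Xp_def indicator_def)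
  finally show ?thesis .
qed

text \<open>The jump contributes the difference of exponents, the position contributes exp (- t
  psi(\<beta> + ones)) with psi for \<open>laplace_exp\<close>, and the time integral of exp (- w t)
  is 1 / w.\<close>

lemma jump_intensity_laplace:
  assumes \<alpha>: "0 \<le> \<alpha>" and \<beta>: "\<beta> \<in> orthant" and \<theta>: "\<theta> \<in> orthant"
  shows "(\<integral>\<^sup>+p. ennreal (exp (- ((\<alpha>, \<beta>, \<theta>) \<bullet> p))) \<partial>jump_intensity) =
    ennreal ((laplace_exp (\<theta> + ones) - laplace_exp \<theta>) / (\<alpha> + laplace_exp (\<beta> + ones)))"
proof -
  define C where "C = laplace_exp (\<theta> + ones) - laplace_exp \<theta>"
  have C: "0 \<le> C" using laplace_exp_mono[OF \<theta>] by (simp add: C_def)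
  define w where "w = \<alpha> + laplace_exp (\<beta> + ones)"
  have w: "0 < w" using laplace_exp_pos[OF \<beta>] \<alpha> by (simp add: w_def)
  have \<beta>1: "\<beta> + ones \<in> orthant" using \<beta> by auto
  have inner: "(\<integral>\<^sup>+\<omega>. \<integral>\<^sup>+v. ennreal (exp (- S t \<omega>) * (1 - exp (- l1norm v))) *
      ennreal (exp (- ((\<alpha>, \<beta>, \<theta>) \<bullet> (t, X t \<omega>, v)))) \<partial>Pm \<partial>M) = ennreal C * ennreal (exp (- w * t))" if t: "0 < t" for t
  proof -
    have [measurable]: "X t \<in> borel_measurable M" using t by (intro random_vector) simp
    have "(\<integral>\<^sup>+\<omega>. \<integral>\<^sup>+v. ennreal (exp (- S t \<omega>) * (1 - exp (- l1norm v))) *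
        ennreal (exp (- ((\<alpha>, \<beta>, \<theta>) \<bullet> (t, X t \<omega>, v)))) \<partial>Pm \<partial>M) =
      (\<integral>\<^sup>+\<omega>. \<integral>\<^sup>+v. ennreal (exp (- (\<alpha> * t))) * ennreal (exp (- ((\<beta> + ones) \<bullet> X t \<omega>))) *
        ennreal (exp (- (\<theta> \<bullet> v)) * (1 - exp (- l1norm v))) \<partial>Pm \<partial>M)"
    proof (intro nn_integral_cong)
      fix \<omega> v assume \<omega>: "\<omega> \<in> space M"
      have "exp (- S t \<omega>) * exp (- ((\<alpha>, \<beta>, \<theta>) \<bullet> (t, X t \<omega>, v))) =
          exp (- (\<alpha> * t)) * exp (- ((\<beta> + ones) \<bullet> X t \<omega>)) * exp (- (\<theta> \<bullet> v))"
        using in_orthant[OF \<omega>, of t] t by (simp add: mult_exp_exp inner_add_left ones_inner)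
      then show "ennreal (exp (- S t \<omega>) * (1 - exp (- l1norm v))) * ennreal (exp (- ((\<alpha>, \<beta>, \<theta>) \<bullet> (t, X t \<omega>, v)))) =
          ennreal (exp (- (\<alpha> * t))) * ennreal (exp (- ((\<beta> + ones) \<bullet> X t \<omega>))) *
          ennreal (exp (- (\<theta> \<bullet> v)) * (1 - exp (- l1norm v)))"
        by (simp add: ennreal_mult''[symmetric] ennreal_mult'[symmetric] l1norm_nonneg mult.assoc mult.left_commute mult.commute)
    qed
    also have "\<dots> = (\<integral>\<^sup>+\<omega>. ennreal (exp (- (\<alpha> * t))) * ennreal (exp (- ((\<beta> + ones) \<bullet> X t \<omega>))) * ennreal C \<partial>M)"
      by (subst nn_integral_cmult) (auto simp: laplace_exp_diff[OF \<theta>] C_def)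
    also have "\<dots> = ennreal (exp (- (\<alpha> * t))) * ennreal (exp (- t * laplace_exp (\<beta> + ones))) * ennreal C"
      using t by (simp add: nn_integral_multc nn_integral_cmult laplace_nn[OF \<beta>1])
    also have "\<dots> = ennreal C * ennreal (exp (- w * t))"
      by (simp add: w_def ennreal_mult'[symmetric] mult_exp_exp algebra_simps)
    finally show ?thesis .
  qed
  have "(\<integral>\<^sup>+p. ennreal (exp (- ((\<alpha>, \<beta>, \<theta>) \<bullet> p))) \<partial>jump_intensity) =
      (\<integral>\<^sup>+t. ennreal C * (ennreal (exp (- w * t)) * indicator {0<..} t) \<partial>lborel)"
  proof (subst jump_intensity_nn_integral, measurable, rule nn_integral_cong)
    fix t :: real
    show "(\<integral>\<^sup>+\<omega>. \<integral>\<^sup>+v. ennreal (exp (- S t \<omega>) * (1 - exp (- l1norm v))) *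
        ennreal (exp (- ((\<alpha>, \<beta>, \<theta>) \<bullet> (t, X t \<omega>, v)))) \<partial>Pm \<partial>M) * indicator {0<..} t =
        ennreal C * (ennreal (exp (- w * t)) * indicator {0<..} t)"
    proof (cases "0 < t")
      case True
      show ?thesis unfolding inner[OF True] by (simp add: mult.assoc)
    qed simp
  qed
  also have "\<dots> = ennreal C * ennreal (1 / w)"
    by (subst nn_integral_cmult, measurable) (simp only: nn_integral_exp_decay[OF w])
  also have "\<dots> = ennreal (C / w)" using C by (simp add: ennreal_mult'[symmetric])
  finally show ?thesis by (simp add: C_def w_def)
qed

text \<open>The transforms computed for both sides coincide; what remains is that both measures are
  finite and live on nonnegative coordinates.\<close>

lemma level_jump_distr: "distr (M \<Otimes>\<^sub>M unit_exponential) borel level_jump = jump_intensity"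
proof (rule finite_measure_eqI_laplace)
  interpret E: prob_space unit_exponential by (rule prob_space_unit_exponential)
  interpret P: pair_prob_space M unit_exponential ..
  show sJ: "sets (distr (M \<Otimes>\<^sub>M unit_exponential) borel level_jump) = sets borel"
    "sets jump_intensity = sets borel" by (simp_all add: jump_intensity_def)
  show "finite_measure (distr (M \<Otimes>\<^sub>M unit_exponential) borel level_jump)"
    by (rule P.finite_measure_distr) measurable
  show "finite_measure jump_intensity"
  proof (rule finite_measureI)
    \<comment> \<open>The total mass is the Laplace transform at zero.\<close>
    have "(\<integral>\<^sup>+p. ennreal (exp (- ((0 :: real, 0 :: real ^ 'n, 0 :: real ^ 'n) \<bullet> p))) \<partial>jump_intensity) < \<infinity>"
      by (subst jump_intensity_laplace) auto
    then show "emeasure jump_intensity (space jump_intensity) \<noteq> \<infinity>" by (simp add: zero_prod_def[symmetric])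
  qed
  let ?O = "{z :: real \<times> (real ^ 'n) \<times> (real ^ 'n). 0 \<le> fst z \<and> fst (snd z) \<in> orthant \<and> snd (snd z) \<in> orthant}"
  have O[measurable]: "?O \<in> sets borel"
  proof -
    have eq: "?O = {0..} \<times> orthant \<times> orthant" by auto
    have "closed ({0 :: real..} \<times> (orthant :: (real ^ 'n) set) \<times> (orthant :: (real ^ 'n) set))"
      by (intro closed_Times closed_orthant closed_atLeast)
    then show ?thesis unfolding eq by (rule borel_closed)
  qed
  show "AE z in distr (M \<Otimes>\<^sub>M unit_exponential) borel level_jump. \<forall>b\<in>Basis. 0 \<le> z \<bullet> b"
    unfolding nonneg_coordinates_iff
  proof (subst AE_distr_iff)
    show "{z :: real \<times> (real ^ 'n) \<times> (real ^ 'n) \<in> space borel.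
        0 \<le> fst z \<and> fst (snd z) \<in> orthant \<and> snd (snd z) \<in> orthant} \<in> sets borel"
      using O by simp
    show "AE z in M \<Otimes>\<^sub>M unit_exponential. 0 \<le> fst (level_jump z) \<and> fst (snd (level_jump z)) \<in> orthant \<and> snd (snd (level_jump z)) \<in> orthant"
      using AE_level
    proof eventually_elim
      case (elim z)
      then interpret increasing_path "\<lambda>t. X t (fst z)" by simp
      have T: "0 < level_time z" using passesD(2)[OF passes_level[of X "fst z" M "snd z"]] elim by (simp add: level_time_def)
      then show ?case using left_lim_orthant[OF T] jump_orthant[OF T] by (simp add: level_jump_def jump_def)
    qed
  qed measurable
  show "AE z in jump_intensity. \<forall>b\<in>Basis. 0 \<le> z \<bullet> b"
    unfolding nonneg_coordinates_iff
  proof (subst AE_iff_nn_integral)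
    show "{x \<in> space jump_intensity. 0 \<le> fst x \<and> fst (snd x) \<in> orthant \<and> snd (snd x) \<in> orthant} \<in> sets jump_intensity"
      using O by (simp add: jump_intensity_def)
    have z0: "(\<integral>\<^sup>+v. ennreal (exp (- S t \<omega>) * (1 - exp (- l1norm v))) * indicator (- ?O) (t, X t \<omega>, v) \<partial>Pm) = 0"
      if "0 < t" "\<omega> \<in> space M" for t \<omega>
    proof -
      have "(\<integral>\<^sup>+v. ennreal (exp (- S t \<omega>) * (1 - exp (- l1norm v))) * indicator (- ?O) (t, X t \<omega>, v) \<partial>Pm) = (\<integral>\<^sup>+v. 0 \<partial>Pm)"
        by (rule nn_integral_cong_AE)
          (use AE_Pm_orthant in eventually_elim, use that in_orthant in \<open>auto simp: indicator_def\<close>)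
      then show ?thesis by simp
    qed
    have zt: "(\<integral>\<^sup>+\<omega>. \<integral>\<^sup>+v. ennreal (exp (- S t \<omega>) * (1 - exp (- l1norm v))) *
        indicator (- ?O) (t, X t \<omega>, v) \<partial>Pm \<partial>M) * indicator {0<..} t = 0" for t
    proof -
      have "(\<integral>\<^sup>+\<omega>. \<integral>\<^sup>+v. ennreal (exp (- S t \<omega>) * (1 - exp (- l1norm v))) *
          indicator (- ?O) (t, X t \<omega>, v) \<partial>Pm \<partial>M) = (\<integral>\<^sup>+\<omega>. 0 \<partial>M)" if "0 < t"
        using that by (intro nn_integral_cong z0)
      then show ?thesis by (cases "0 < t") simp_all
    qed
    have "(\<integral>\<^sup>+x. indicator (- ?O) x \<partial>jump_intensity) = (\<integral>\<^sup>+t. 0 \<partial>(lborel :: real measure))"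
    proof (subst jump_intensity_nn_integral)
      show "indicator (- ?O) \<in> borel_measurable borel" using O by measurable
      show "(\<integral>\<^sup>+t\<in>{0<..}. \<integral>\<^sup>+\<omega>. \<integral>\<^sup>+v. ennreal (exp (- S t \<omega>) * (1 - exp (- l1norm v))) *
          indicator (- ?O) (t, X t \<omega>, v) \<partial>Pm \<partial>M \<partial>lborel) = (\<integral>\<^sup>+t. 0 \<partial>(lborel :: real measure))"
        by (rule nn_integral_cong) (simp add: zt)
    qed
    then have "(\<integral>\<^sup>+x. indicator (- ?O) x \<partial>jump_intensity) = 0" by simp
    then show "(\<integral>\<^sup>+x. indicator {x. \<not> (0 \<le> fst x \<and> fst (snd x) \<in> orthant \<and> snd (snd x) \<in> orthant)} x \<partial>jump_intensity) = 0"
      by (simp add: jump_intensity_def Compl_eq)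
  qed
  fix \<Theta> :: "real \<times> (real ^ 'n) \<times> (real ^ 'n)"
  assume "\<And>b. b \<in> Basis \<Longrightarrow> 0 \<le> \<Theta> \<bullet> b"
  then have \<Theta>: "0 \<le> fst \<Theta>" "fst (snd \<Theta>) \<in> orthant" "snd (snd \<Theta>) \<in> orthant"
    using nonneg_coordinates_iff[of \<Theta>] by auto
  show "(\<integral>\<^sup>+x. ennreal (exp (- (\<Theta> \<bullet> x))) \<partial>distr (M \<Otimes>\<^sub>M unit_exponential) borel level_jump) =
      (\<integral>\<^sup>+x. ennreal (exp (- (\<Theta> \<bullet> x))) \<partial>jump_intensity)"
    using level_jump_laplace[OF \<Theta>] jump_intensity_laplace[OF \<Theta>] by (simp add: nn_integral_distr)
qed

text \<open>A compensation formula: on the left each jump is counted with the mass of the levels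
  that it crosses; on the right the time is Lebesgue and the jump is integrated against
  \<open>Pm\<close> independently of X(t).\<close>

lemma level_jump_formula:
  assumes H[measurable]: "H \<in> borel_measurable borel"
  shows "(\<integral>\<^sup>+\<omega>. \<integral>\<^sup>+y. H (level_jump (\<omega>, y)) \<partial>unit_exponential \<partial>M) =
    (\<integral>\<^sup>+t\<in>{0<..}. \<integral>\<^sup>+\<omega>. \<integral>\<^sup>+v. ennreal (exp (- S t \<omega>) * (1 - exp (- l1norm v))) * H (t, X t \<omega>, v) \<partial>Pm \<partial>M \<partial>lborel)"
proof -
  interpret E: prob_space unit_exponential by (rule prob_space_unit_exponential)
  have "(\<integral>\<^sup>+\<omega>. \<integral>\<^sup>+y. H (level_jump (\<omega>, y)) \<partial>unit_exponential \<partial>M) = (\<integral>\<^sup>+z. H (level_jump z) \<partial>(M \<Otimes>\<^sub>M unit_exponential))"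
    by (rule E.nn_integral_fst) measurable
  also have "\<dots> = (\<integral>\<^sup>+p. H p \<partial>distr (M \<Otimes>\<^sub>M unit_exponential) borel level_jump)"
    by (simp add: nn_integral_distr)
  also have "\<dots> = (\<integral>\<^sup>+t\<in>{0<..}. \<integral>\<^sup>+\<omega>. \<integral>\<^sup>+v. ennreal (exp (- S t \<omega>) * (1 - exp (- l1norm v))) * H (t, X t \<omega>, v) \<partial>Pm \<partial>M \<partial>lborel)"
    unfolding level_jump_distr by (rule jump_intensity_nn_integral[OF H])
  finally show ?thesis .
qed

end

subsection \<open>The law at passage over the boundary\<close>

locale levy_passage = infinite_activity M X Pm + boundary c
  for M :: "'a measure" and X :: "real \<Rightarrow> 'a \<Rightarrow> real ^ 'n" and Pm and c
begin

abbreviation (input) "\<tau> \<equiv> tau X c"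
abbreviation (input) "pre \<equiv> pre_X X c"
abbreviation (input) "jmp \<equiv> jump_X X c"
abbreviation "E \<equiv> passes M X c"

text \<open>\<open>c\<close> is constrained on (0, infinity) only; the default 0 elsewhere gives a
  Borel function on the whole line.\<close>

definition c_ext :: "real \<Rightarrow> real" where
  "c_ext t = (if 0 < t then c t else 0)"

lemma c_ext_measurable [measurable]: "c_ext \<in> borel_measurable borel"
proof -
  have "c \<in> borel_measurable (restrict_space borel {0<..})"
    by (rule borel_measurable_continuous_on_restrict[OF cont])
  then show ?thesis
    using measurable_restrict_space_iff[of "{0<..}" borel 0 borel c] by (simp add: c_ext_def[abs_def])
qed

lemma first_passage_measurable [measurable]: "first_passage (norm_proc X) c \<in> borel_measurable M"
  using measurable_first_passage[of "\<lambda>\<omega>. \<omega>" M "\<lambda>t _. c t"] cont by simp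

lemma passes_sets [measurable]: "E \<in> sets M"
  unfolding passes_def by measurable

lemma tau_measurable [measurable]: "\<tau> \<in> borel_measurable M"
  unfolding tau_def[abs_def] by measurable

text \<open>Versions of the value before and at passage that are measurable on the whole space; on
  \<open>E\<close> the passage time is positive and the default 0 does not occur.\<close>

definition "pre0 \<omega> = (if 0 < \<tau> \<omega> then left_lim (\<lambda>r. X r \<omega>) (\<tau> \<omega>) else 0)"
definition "at0 \<omega> = (if 0 < \<tau> \<omega> then X (\<tau> \<omega>) \<omega> else 0)"

lemma pre0_measurable [measurable]: "pre0 \<in> borel_measurable M"
  unfolding pre0_def[abs_def] by (rule measurable_at_hitting) measurable

lemma at0_measurable [measurable]: "at0 \<in> borel_measurable M"
  unfolding at0_def[abs_def] by (rule measurable_at_hitting) measurable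

lemma on_passes:
  assumes "\<omega> \<in> E"
  shows "pre \<omega> = pre0 \<omega>" "jmp \<omega> = at0 \<omega> - pre0 \<omega>" "at_S X c \<omega> = l1norm (at0 \<omega>)" "c (\<tau> \<omega>) = c_ext (\<tau> \<omega>)"
  using passesD(2)[OF assms]
  by (simp_all add: pre_X_def pre0_def jump_X_def jump_def at0_def at_S_def norm_proc_def c_ext_def)

text \<open>The last inequality is strict because landing exactly on the boundary belongs to
  creeping.\<close>

definition jump_cond :: "(real \<times> (real ^ 'n) \<times> (real ^ 'n)) set" where
  "jump_cond = {(t, u, v). 0 < t \<and> l1norm u \<le> c t \<and> c t < l1norm u + l1norm v}"

lemma jump_cond_sets [measurable]: "jump_cond \<in> sets borel"
proof -
  have "{z :: real \<times> (real ^ 'n) \<times> (real ^ 'n) \<in> space (borel \<Otimes>\<^sub>M borel \<Otimes>\<^sub>M borel). 0 < fst z \<and> l1norm (fst (snd z)) \<le> c_ext (fst z) \<and>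
      c_ext (fst z) < l1norm (fst (snd z)) + l1norm (snd (snd z) :: real ^ 'n)} \<in> sets (borel \<Otimes>\<^sub>M borel \<Otimes>\<^sub>M borel)"
    by measurable
  moreover have "{z :: real \<times> (real ^ 'n) \<times> (real ^ 'n) \<in> space (borel \<Otimes>\<^sub>M borel \<Otimes>\<^sub>M borel). 0 < fst z \<and> l1norm (fst (snd z)) \<le> c_ext (fst z) \<and>
      c_ext (fst z) < l1norm (fst (snd z)) + l1norm (snd (snd z) :: real ^ 'n)} = jump_cond"
    by (auto simp: jump_cond_def space_pair_measure c_ext_def)
  ultimately show ?thesis unfolding borel_prod by (simp only:)
qed

lemma path_at_passage:
  assumes "increasing_path (\<lambda>t. X t \<omega>)" "\<omega> \<in> E"
  shows "pre \<omega> \<in> orthant" "jmp \<omega> \<in> orthant" "pre_S X c \<omega> = l1norm (pre \<omega>)" "jump_S X c \<omega> = l1norm (jmp \<omega>)"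
    "at_S X c \<omega> = l1norm (pre \<omega>) + l1norm (jmp \<omega>)" "l1norm (pre \<omega>) \<le> c (\<tau> \<omega>)" "c (\<tau> \<omega>) \<le> at_S X c \<omega>"
proof -
  interpret increasing_path "\<lambda>t. X t \<omega>" by fact
  note T = passesD(1,2)[OF assms(2)]
  show "pre \<omega> \<in> orthant" using left_lim_orthant[OF T(2)] by (simp add: pre_X_def)
  show "jmp \<omega> \<in> orthant" using jump_orthant[OF T(2)] by (simp add: jump_X_def)
  show preS: "pre_S X c \<omega> = l1norm (pre \<omega>)"
    using left_lim_l1norm[OF T(2)] by (simp add: pre_X_def pre_S_def norm_proc_def)
  show "jump_S X c \<omega> = l1norm (jmp \<omega>)"
    using left_lim_l1norm[OF T(2)] l1norm_jump[OF T(2)] by (simp add: jump_X_def jump_S_def norm_proc_def jump_def)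
  show "at_S X c \<omega> = l1norm (pre \<omega>) + l1norm (jmp \<omega>)"
    using l1norm_jump[OF T(2)] by (simp add: pre_X_def jump_X_def at_S_def norm_proc_def)
  show "l1norm (pre \<omega>) \<le> c (\<tau> \<omega>)" "c (\<tau> \<omega>) \<le> at_S X c \<omega>"
    using passes_tau_eq_iff[where X=X and \<omega>=\<omega> and M=M, OF assms(1) T] assms(2) by (simp_all add: pre_X_def at_S_def norm_proc_def)
qed

text \<open>The gap criterion for passage times is applied to two boundaries, the constant y and c:
  a jump that passes y and whose closed gap contains the boundary value is the passage over c, and
  the levels passed at that time are those in the gap.\<close>

lemma level_jump_cases:
  assumes path: "increasing_path (\<lambda>t. X t \<omega>)" and \<omega>: "\<omega> \<in> space M" and y: "0 < y"
  shows "fst (level_jump (\<omega>, y)) > 0"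
    and "\<omega> \<in> E \<Longrightarrow> fst (level_jump (\<omega>, y)) = \<tau> \<omega> \<longleftrightarrow> l1norm (pre \<omega>) \<le> y \<and> y \<le> at_S X c \<omega>"
    and "\<omega> \<in> E \<Longrightarrow> fst (level_jump (\<omega>, y)) = \<tau> \<omega> \<Longrightarrow> level_jump (\<omega>, y) = (\<tau> \<omega>, pre \<omega>, jmp \<omega>)"
    and "level_jump (\<omega>, y) = (t, u, v) \<Longrightarrow> l1norm u \<le> c t \<Longrightarrow> c t \<le> l1norm u + l1norm v \<Longrightarrow> \<omega> \<in> E \<and> \<tau> \<omega> = t"
proof -
  interpret increasing_path "\<lambda>t. X t \<omega>" by fact
  define T where "T = tau X (\<lambda>_. y) \<omega>"
  have p: "\<omega> \<in> passes M X (\<lambda>_. y)" using passes_level[of X \<omega>, OF path \<omega> y] .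
  have T: "0 < T" using passesD(2)[OF p] by (simp add: T_def)
  have lj: "level_jump (\<omega>, y) = (T, left_lim (\<lambda>r. X r \<omega>) T, jump (\<lambda>r. X r \<omega>) T)"
    using level_jump_eq[OF path \<omega> y] by (simp add: T_def pre_X_def jump_X_def)
  show "fst (level_jump (\<omega>, y)) > 0" using T lj by simp
  show "fst (level_jump (\<omega>, y)) = \<tau> \<omega> \<longleftrightarrow> l1norm (pre \<omega>) \<le> y \<and> y \<le> at_S X c \<omega>" if "\<omega> \<in> E"
    using boundary.passes_tau_eq_iff[OF boundary_const[of y], where X=X and \<omega>=\<omega> and M=M, OF path \<omega> passesD(2)[OF that]] p
    by (simp add: lj T_def pre_X_def at_S_def norm_proc_def)
  show "level_jump (\<omega>, y) = (\<tau> \<omega>, pre \<omega>, jmp \<omega>)" if "fst (level_jump (\<omega>, y)) = \<tau> \<omega>"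
    using that by (simp add: lj pre_X_def jump_X_def)
  show "\<omega> \<in> E \<and> \<tau> \<omega> = t" if "level_jump (\<omega>, y) = (t, u, v)" "l1norm u \<le> c t" "c t \<le> l1norm u + l1norm v"
    using that T l1norm_jump[OF T] by (subst passes_tau_eq_iff[where X=X and \<omega>=\<omega> and M=M, OF path \<omega>]) (auto simp: lj)
qed

text \<open>If H vanishes on all other passages, the integrand is constant on the closed gap of
  levels passed at \<open>\<tau>\<close> and 0 elsewhere, so only the exponential mass of the gap
  has to be computed.\<close>

lemma level_jump_integral_path:
  assumes path: "increasing_path (\<lambda>t. X t \<omega>)" and \<omega>: "\<omega> \<in> E"
    and H: "\<And>y. 0 < y \<Longrightarrow> fst (level_jump (\<omega>, y)) \<noteq> \<tau> \<omega> \<Longrightarrow> H (level_jump (\<omega>, y)) = 0"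
  shows "(\<integral>\<^sup>+y. H (level_jump (\<omega>, y)) \<partial>unit_exponential) =
    H (\<tau> \<omega>, pre \<omega>, jmp \<omega>) * ennreal (exp (- l1norm (pre \<omega>)) * (1 - exp (- l1norm (jmp \<omega>))))"
proof -
  note \<omega>' = passesD(1)[OF \<omega>]
  note p = path_at_passage[OF path \<omega>]
  have "(\<integral>\<^sup>+y. H (level_jump (\<omega>, y)) \<partial>unit_exponential) =
      (\<integral>\<^sup>+y. H (\<tau> \<omega>, pre \<omega>, jmp \<omega>) * indicator {l1norm (pre \<omega>)..at_S X c \<omega>} y \<partial>unit_exponential)"
  proof (rule nn_integral_cong_AE)
    show "AE y in unit_exponential. H (level_jump (\<omega>, y)) =
        H (\<tau> \<omega>, pre \<omega>, jmp \<omega>) * indicator {l1norm (pre \<omega>)..at_S X c \<omega>} y"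
      using AE_unit_exponential_pos
    proof eventually_elim
      case (elim y)
      note l = level_jump_cases[OF path \<omega>' elim]
      show ?case
      proof (cases "fst (level_jump (\<omega>, y)) = \<tau> \<omega>")
        case True
        then show ?thesis using l(2,3)[OF \<omega>] by simp
      next
        case False
        then show ?thesis using l(2)[OF \<omega>] H[OF elim] by (auto simp: indicator_def)
      qed
    qed
  qed
  also have "\<dots> = H (\<tau> \<omega>, pre \<omega>, jmp \<omega>) * emeasure unit_exponential {l1norm (pre \<omega>)..at_S X c \<omega>}"
    by (subst nn_integral_cmult) auto
  also have "emeasure unit_exponential {l1norm (pre \<omega>)..at_S X c \<omega>} = ennreal (exp (- l1norm (pre \<omega>)) - exp (- at_S X c \<omega>))"
    by (rule emeasure_unit_exponential) (auto simp: l1norm_nonneg p(5))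
  also have "exp (- l1norm (pre \<omega>)) - exp (- at_S X c \<omega>) = exp (- l1norm (pre \<omega>)) * (1 - exp (- l1norm (jmp \<omega>)))"
    by (simp add: p(5) right_diff_distrib mult_exp_exp)
  finally show ?thesis .
qed

text \<open>The formula for levels is applied to H cut to \<open>jump_cond\<close> and divided by
  the crossing weight. A level passage in \<open>jump_cond\<close> is the passage over c, so
  integrating over the levels multiplies by that weight again and restores H.\<close>

lemma jump_over_formula:
  assumes H[measurable]: "H \<in> borel_measurable borel"
  shows "(\<integral>\<^sup>+\<omega>. H (\<tau> \<omega>, pre \<omega>, jmp \<omega>) * indicator {\<omega>\<in>E. c (\<tau> \<omega>) < at_S X c \<omega>} \<omega> \<partial>M) =
    (\<integral>\<^sup>+t\<in>{0<..}. \<integral>\<^sup>+\<omega>. \<integral>\<^sup>+v. H (t, X t \<omega>, v) * indicator jump_cond (t, X t \<omega>, v) \<partial>Pm \<partial>M \<partial>lborel)"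
proof -
  define w where "w p = ennreal (exp (- l1norm (fst (snd p))) * (1 - exp (- l1norm (snd (snd p)))))"
    for p :: "real \<times> (real ^ 'n) \<times> (real ^ 'n)"
  have w[measurable]: "w \<in> borel_measurable borel" unfolding w_def[abs_def] borel_prod[symmetric] by measurable
  define H' where "H' p = indicator jump_cond p * H p / w p" for p
  have H'[measurable]: "H' \<in> borel_measurable borel" unfolding H'_def[abs_def] by measurable
  have ww: "H' p * w p = indicator jump_cond p * H p" for p
  proof (cases "p \<in> jump_cond")
    case True
    obtain t u v where p: "p = (t, u, v)" by (cases p)
    \<comment> \<open>On \<open>jump_cond\<close> the jump has positive norm, so the weight is
      neither 0 nor infinite and the division can be undone.\<close>
    have "0 < l1norm v" using True by (simp add: p jump_cond_def)
    then have "w p \<noteq> 0" "w p \<noteq> \<infinity>" by (simp_all add: w_def p ennreal_eq_0_iff not_le)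
    then show ?thesis unfolding H'_def by (simp add: ennreal_divide_times ennreal_divide_self less_top)
  qed (simp add: H'_def)
  have "(\<integral>\<^sup>+\<omega>. \<integral>\<^sup>+y. H' (level_jump (\<omega>, y)) \<partial>unit_exponential \<partial>M) =
      (\<integral>\<^sup>+\<omega>. H (\<tau> \<omega>, pre \<omega>, jmp \<omega>) * indicator {\<omega>\<in>E. c (\<tau> \<omega>) < at_S X c \<omega>} \<omega> \<partial>M)"
  proof (rule nn_integral_cong_AE)
    show "AE \<omega> in M. (\<integral>\<^sup>+y. H' (level_jump (\<omega>, y)) \<partial>unit_exponential) =
        H (\<tau> \<omega>, pre \<omega>, jmp \<omega>) * indicator {\<omega>\<in>E. c (\<tau> \<omega>) < at_S X c \<omega>} \<omega>"
      using AE_increasing_path AE_space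
    proof eventually_elim
      case (elim \<omega>)
      have H'0: "H' (level_jump (\<omega>, y)) = 0" if "0 < y" "\<not> (\<omega> \<in> E \<and> \<tau> \<omega> = fst (level_jump (\<omega>, y)))" for y
      proof (cases "level_jump (\<omega>, y) \<in> jump_cond")
        case True
        obtain t u v where p: "level_jump (\<omega>, y) = (t, u, v)" by (cases "level_jump (\<omega>, y)")
        have "\<omega> \<in> E \<and> \<tau> \<omega> = t"
          using level_jump_cases(4)[OF elim that(1) p] True by (simp add: p jump_cond_def)
        then show ?thesis using that p by simp
      qed (simp add: H'_def)
      show ?case
      proof (cases "\<omega> \<in> E")
        case True
        note p = path_at_passage[OF elim(1) True]
        have "(\<integral>\<^sup>+y. H' (level_jump (\<omega>, y)) \<partial>unit_exponential) =
            H' (\<tau> \<omega>, pre \<omega>, jmp \<omega>) * w (\<tau> \<omega>, pre \<omega>, jmp \<omega>)"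
          unfolding w_def fst_conv snd_conv
          by (rule level_jump_integral_path[OF elim(1) True]) (use H'0 in auto)
        also have "\<dots> = indicator jump_cond (\<tau> \<omega>, pre \<omega>, jmp \<omega>) * H (\<tau> \<omega>, pre \<omega>, jmp \<omega>)" by (rule ww)
        also have "indicator jump_cond (\<tau> \<omega>, pre \<omega>, jmp \<omega>) = (indicator {\<omega>\<in>E. c (\<tau> \<omega>) < at_S X c \<omega>} \<omega> :: ennreal)"
          using p True passesD(2)[OF True] by (auto simp: jump_cond_def indicator_def)
        finally show ?thesis by (simp add: mult.commute)
      next
        case False
        have "(\<integral>\<^sup>+y. H' (level_jump (\<omega>, y)) \<partial>unit_exponential) = (\<integral>\<^sup>+y. 0 \<partial>unit_exponential)"
          by (rule nn_integral_cong_AE) (use AE_unit_exponential_pos in eventually_elim, use H'0 False in auto)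
        then show ?thesis using False by simp
      qed
    qed
  qed
  moreover have "(\<integral>\<^sup>+t\<in>{0<..}. \<integral>\<^sup>+\<omega>. \<integral>\<^sup>+v. ennreal (exp (- S t \<omega>) * (1 - exp (- l1norm v))) * H' (t, X t \<omega>, v) \<partial>Pm \<partial>M \<partial>lborel) =
      (\<integral>\<^sup>+t\<in>{0<..}. \<integral>\<^sup>+\<omega>. \<integral>\<^sup>+v. H (t, X t \<omega>, v) * indicator jump_cond (t, X t \<omega>, v) \<partial>Pm \<partial>M \<partial>lborel)"
  proof -
    have "ennreal (exp (- S t \<omega>) * (1 - exp (- l1norm v))) * H' (t, X t \<omega>, v) =
        H (t, X t \<omega>, v) * indicator jump_cond (t, X t \<omega>, v)" for t \<omega> v
      using ww[of "(t, X t \<omega>, v)"] unfolding w_def fst_conv snd_conv by (simp add: mult.commute)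
    then show ?thesis by simp
  qed
  ultimately show ?thesis using level_jump_formula[OF H'] by simp
qed

text \<open>The level formula turns the weighted frequency of jumps onto the boundary into an
  integral over t, the path and v. Fubini fixes path and v, and then at most one t satisfies S(t) +
  |v| = c(t). As the crossing weight of a nonzero jump is positive, no such jump occurs.\<close>

lemma AE_no_jump_onto_boundary:
  "AE \<omega> in M. \<omega> \<in> E \<longrightarrow> (jmp \<omega> = 0 \<longleftrightarrow> at_S X c \<omega> = c (\<tau> \<omega>))"
proof -
  interpret Ex: prob_space unit_exponential by (rule prob_space_unit_exponential)
  interpret MP: pair_sigma_finite M Pm ..
  interpret LMP: pair_sigma_finite lborel "M \<Otimes>\<^sub>M Pm" ..
  define B where "B = {z :: real \<times> (real ^ 'n) \<times> (real ^ 'n). 0 < fst z \<and> snd (snd z) \<noteq> 0 \<and>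
    l1norm (fst (snd z)) + l1norm (snd (snd z)) = c_ext (fst z)}"
  have B[measurable]: "B \<in> sets borel"
  proof -
    have "{z :: real \<times> (real ^ 'n) \<times> (real ^ 'n) \<in> space (borel \<Otimes>\<^sub>M borel \<Otimes>\<^sub>M borel). 0 < fst z \<and> snd (snd z) \<noteq> (0 :: real ^ 'n) \<and>
      l1norm (fst (snd z) :: real ^ 'n) + l1norm (snd (snd z)) = c_ext (fst z)} \<in> sets (borel \<Otimes>\<^sub>M borel \<Otimes>\<^sub>M borel)"
      by measurable
    then show ?thesis unfolding borel_prod B_def by simp
  qed
  define Xp where "Xp z = (if 0 < fst z then X (fst z) (fst (snd z)) else 0)" for z :: "real \<times> 'a \<times> (real ^ 'n)"
  have Xp[measurable]: "Xp \<in> borel_measurable (lborel \<Otimes>\<^sub>M (M \<Otimes>\<^sub>M Pm))"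
    unfolding Xp_def[abs_def] by (rule measurable_at_hitting) measurable
  \<comment> \<open>Dropping the weight, which is at most 1, leaves an indicator to which Fubini
    applies.\<close>
  define f where "f z = (indicator {0<..} (fst z) * indicator B (fst z, Xp z, snd (snd z)) :: ennreal)" for z
  have [measurable]: "(\<lambda>z. (fst z, Xp z, snd (snd z))) \<in> (lborel \<Otimes>\<^sub>M (M \<Otimes>\<^sub>M Pm)) \<rightarrow>\<^sub>M borel"
    unfolding borel_prod[symmetric] by measurable
  have f[measurable]: "f \<in> borel_measurable (lborel \<Otimes>\<^sub>M (M \<Otimes>\<^sub>M Pm))" unfolding f_def[abs_def] by measurable
  have ft[measurable]: "(\<lambda>p. f (t, p)) \<in> borel_measurable (M \<Otimes>\<^sub>M Pm)" for t
    by (rule measurable_compose[OF measurable_Pair1' f]) simp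
  have "(\<integral>\<^sup>+\<omega>. \<integral>\<^sup>+y. indicator B (level_jump (\<omega>, y)) \<partial>unit_exponential \<partial>M) =
     (\<integral>\<^sup>+t\<in>{0<..}. \<integral>\<^sup>+\<omega>. \<integral>\<^sup>+v. ennreal (exp (- S t \<omega>) * (1 - exp (- l1norm v))) * indicator B (t, X t \<omega>, v) \<partial>Pm \<partial>M \<partial>lborel)"
    by (rule level_jump_formula) measurable
  also have "\<dots> \<le> (\<integral>\<^sup>+t. \<integral>\<^sup>+\<omega>. \<integral>\<^sup>+v. f (t, \<omega>, v) \<partial>Pm \<partial>M \<partial>lborel)"
  proof (rule nn_integral_mono)
    fix t :: real
    have "ennreal (exp (- S t \<omega>) * (1 - exp (- l1norm v))) \<le> ennreal 1" for \<omega> v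
      by (intro ennreal_leI mult_le_one) (auto simp: l1norm_nonneg)
    then have "ennreal (exp (- S t \<omega>) * (1 - exp (- l1norm v))) * indicator B (t, X t \<omega>, v) \<le> f (t, \<omega>, v)" if "0 < t" for \<omega> v
      using that by (auto simp: f_def Xp_def indicator_def)
    then show "(\<integral>\<^sup>+\<omega>. \<integral>\<^sup>+v. ennreal (exp (- S t \<omega>) * (1 - exp (- l1norm v))) * indicator B (t, X t \<omega>, v) \<partial>Pm \<partial>M) * indicator {0<..} t
        \<le> (\<integral>\<^sup>+\<omega>. \<integral>\<^sup>+v. f (t, \<omega>, v) \<partial>Pm \<partial>M)"
      by (cases "0 < t") (auto intro!: nn_integral_mono)
  qed
  also have "\<dots> = (\<integral>\<^sup>+t. \<integral>\<^sup>+p. f (t, p) \<partial>(M \<Otimes>\<^sub>M Pm) \<partial>lborel)"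
    by (simp only: Pm.nn_integral_fst[OF ft])
  also have "\<dots> = (\<integral>\<^sup>+p. \<integral>\<^sup>+t. f (t, p) \<partial>lborel \<partial>(M \<Otimes>\<^sub>M Pm))"
    using LMP.Fubini[OF f] by simp
  also have "\<dots> = (\<integral>\<^sup>+\<omega>. \<integral>\<^sup>+v. \<integral>\<^sup>+t. f (t, \<omega>, v) \<partial>lborel \<partial>Pm \<partial>M)"
    by (rule Pm.nn_integral_fst[symmetric]) measurable
  also have "\<dots> = (\<integral>\<^sup>+\<omega>. 0 \<partial>M)"
  proof (rule nn_integral_cong_AE)
    show "AE \<omega> in M. (\<integral>\<^sup>+v. \<integral>\<^sup>+t. f (t, \<omega>, v) \<partial>lborel \<partial>Pm) = 0"
      using AE_increasing_path
    proof eventually_elim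
      case (elim \<omega>)
      then interpret increasing_path "\<lambda>t. X t \<omega>" .
      have "(\<integral>\<^sup>+t. f (t, \<omega>, v) \<partial>lborel) = 0" for v
      proof -
        have "\<exists>s. \<forall>t. t \<noteq> s \<longrightarrow> f (t, \<omega>, v) = 0"
        proof (cases "\<exists>s. 0 < s \<and> S s \<omega> + l1norm v = c s")
          case True
          then obtain s where s: "0 < s" "S s \<omega> + l1norm v = c s" by blast
          have "f (t, \<omega>, v) = 0" if "t \<noteq> s" for t
            using first_zero_unique[OF anti s(1) _ s(2), of t] that
            by (auto simp: f_def B_def Xp_def c_ext_def indicator_def)
          then show ?thesis by blast
        next
          case False
          then show ?thesis by (intro exI[of _ 0]) (auto simp: f_def B_def Xp_def c_ext_def indicator_def)
        qed
        then obtain s where s: "\<And>t. t \<noteq> s \<Longrightarrow> f (t, \<omega>, v) = 0" by blast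
        have "(\<integral>\<^sup>+t. f (t, \<omega>, v) \<partial>lborel) = (\<integral>\<^sup>+t. 0 \<partial>(lborel :: real measure))"
          by (rule nn_integral_cong_AE) (use AE_lborel_singleton[of s] in eventually_elim, use s in auto)
        then show ?thesis by simp
      qed
      then show ?case by simp
    qed
  qed
  finally have "(\<integral>\<^sup>+\<omega>. \<integral>\<^sup>+y. indicator B (level_jump (\<omega>, y)) \<partial>unit_exponential \<partial>M) = 0" by simp
  moreover have "(\<lambda>z. indicator B (level_jump z) :: ennreal) \<in> borel_measurable (M \<Otimes>\<^sub>M unit_exponential)" by measurable
  then have "(\<lambda>\<omega>. \<integral>\<^sup>+y. indicator B (level_jump (\<omega>, y)) \<partial>unit_exponential) \<in> borel_measurable M"
    by (rule Ex.borel_measurable_nn_integral_fst)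
  ultimately have "AE \<omega> in M. (\<integral>\<^sup>+y. indicator B (level_jump (\<omega>, y)) \<partial>unit_exponential) = 0"
    by (simp add: nn_integral_0_iff_AE)
  then show ?thesis using AE_increasing_path AE_space
  proof eventually_elim
    case (elim \<omega>)
    show ?case
    proof
      assume \<omega>: "\<omega> \<in> E"
      note p = path_at_passage[OF elim(2) \<omega>]
      show "jmp \<omega> = 0 \<longleftrightarrow> at_S X c \<omega> = c (\<tau> \<omega>)"
      proof
        assume "jmp \<omega> = 0"
        then show "at_S X c \<omega> = c (\<tau> \<omega>)" using p(5-7) by simp
      next
        assume at: "at_S X c \<omega> = c (\<tau> \<omega>)"
        show "jmp \<omega> = 0"
        proof (rule ccontr)
          assume nz: "jmp \<omega> \<noteq> 0"
          have "(\<integral>\<^sup>+y. indicator B (level_jump (\<omega>, y)) \<partial>unit_exponential) =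
            indicator B (\<tau> \<omega>, pre \<omega>, jmp \<omega>) * ennreal (exp (- l1norm (pre \<omega>)) * (1 - exp (- l1norm (jmp \<omega>))))"
          proof (rule level_jump_integral_path[OF elim(2) \<omega>])
            fix y :: real assume y: "0 < y" and ne: "fst (level_jump (\<omega>, y)) \<noteq> \<tau> \<omega>"
            obtain t u v where l: "level_jump (\<omega>, y) = (t, u, v)" by (cases "level_jump (\<omega>, y)")
            have "(t, u, v) \<notin> B"
            proof
              assume "(t, u, v) \<in> B"
              then have "l1norm u + l1norm v = c t" by (simp add: B_def c_ext_def)
              then have "\<tau> \<omega> = t" using level_jump_cases(4)[OF elim(2,3) y l] l1norm_nonneg[of v] by simp
              then show False using ne l by simp
            qed
            then show "indicator B (level_jump (\<omega>, y)) = (0 :: ennreal)" by (simp add: l)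
          qed
          moreover have "(\<tau> \<omega>, pre \<omega>, jmp \<omega>) \<in> B"
            using nz at p(5) passesD(2)[OF \<omega>] by (simp add: B_def c_ext_def)
          moreover have "0 < exp (- l1norm (pre \<omega>)) * (1 - exp (- l1norm (jmp \<omega>)))"
            using nz l1norm_pos[of "jmp \<omega>"] by simp
          ultimately show False using elim(1) by (simp add: ennreal_eq_0_iff)
        qed
      qed
    qed
  qed
qed

text \<open>Passing strictly beyond the boundary and having a nonzero jump at passage differ only by
  jumps that end on the boundary, a null event.\<close>

lemma jump_formula:
  assumes H[measurable]: "H \<in> borel_measurable borel"
  shows "(\<integral>\<^sup>+\<omega>. H (\<tau> \<omega>, pre \<omega>, jmp \<omega>) * indicator {\<omega>\<in>E. jmp \<omega> \<noteq> 0} \<omega> \<partial>M) =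
    (\<integral>\<^sup>+t\<in>{0<..}. \<integral>\<^sup>+\<omega>. \<integral>\<^sup>+v. H (t, X t \<omega>, v) * indicator jump_cond (t, X t \<omega>, v) \<partial>Pm \<partial>M \<partial>lborel)"
  unfolding jump_over_formula[OF H, symmetric]
proof (rule nn_integral_cong_AE)
  show "AE \<omega> in M. H (\<tau> \<omega>, pre \<omega>, jmp \<omega>) * indicator {\<omega>\<in>E. jmp \<omega> \<noteq> 0} \<omega> =
      H (\<tau> \<omega>, pre \<omega>, jmp \<omega>) * indicator {\<omega>\<in>E. c (\<tau> \<omega>) < at_S X c \<omega>} \<omega>"
    using AE_no_jump_onto_boundary AE_increasing_path
  proof eventually_elim
    case (elim \<omega>)
    show ?case
    proof (cases "\<omega> \<in> E")
      case True
      then show ?thesis using elim(1) path_at_passage(7)[OF elim(2) True] by (auto simp: indicator_def)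
    qed simp
  qed
qed

lemma event_measurable:
  assumes A: "A \<in> sets borel"
  shows "{\<omega>\<in>E. (\<tau> \<omega>, pre \<omega>, jmp \<omega>) \<in> A} \<in> sets M"
proof -
  have m: "(\<lambda>\<omega>. (\<tau> \<omega>, pre0 \<omega>, at0 \<omega> - pre0 \<omega>)) \<in> M \<rightarrow>\<^sub>M borel"
    unfolding borel_prod[symmetric] by measurable
  have "{\<omega>\<in>E. (\<tau> \<omega>, pre \<omega>, jmp \<omega>) \<in> A} = E \<inter> ((\<lambda>\<omega>. (\<tau> \<omega>, pre0 \<omega>, at0 \<omega> - pre0 \<omega>)) -` A \<inter> space M)"
    using passesD(1) by (auto simp: on_passes)
  then show ?thesis using measurable_sets[OF m A] by auto
qed

lemma law_at_jump_passage:
  assumes A: "A \<in> sets borel" "A \<subseteq> {0<..} \<times> orthant \<times> (orthant - {0})"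
  shows "emeasure M {\<omega> \<in> E. (\<tau> \<omega>, pre \<omega>, jmp \<omega>) \<in> A} =
          (\<integral>\<^sup>+ t. \<integral>\<^sup>+ u. \<integral>\<^sup>+ v.
             indicator {(t, u, v). (t, u, v) \<in> A \<and> 0 \<le> c t - l1norm u \<and> c t - l1norm u < l1norm v} (t, u, v)
             \<partial>Pm \<partial>distr M borel (X t) \<partial>lborel)"
proof -
  note [measurable] = A(1)
  let ?B = "{(t, u, v). (t, u, v) \<in> A \<and> 0 \<le> c t - l1norm u \<and> c t - l1norm u < l1norm v}"
  have B: "?B = A \<inter> jump_cond" using A(2) by (auto simp: jump_cond_def)
  have "emeasure M {\<omega> \<in> E. (\<tau> \<omega>, pre \<omega>, jmp \<omega>) \<in> A} = (\<integral>\<^sup>+\<omega>. indicator {\<omega> \<in> E. (\<tau> \<omega>, pre \<omega>, jmp \<omega>) \<in> A} \<omega> \<partial>M)"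
    by (rule nn_integral_indicator[symmetric]) (rule event_measurable[OF A(1)])
  also have "\<dots> = (\<integral>\<^sup>+\<omega>. indicator A (\<tau> \<omega>, pre \<omega>, jmp \<omega>) * indicator {\<omega>\<in>E. jmp \<omega> \<noteq> 0} \<omega> \<partial>M)"
    by (rule nn_integral_cong) (use A(2) in \<open>auto simp: indicator_def\<close>)
  also have "\<dots> = (\<integral>\<^sup>+t\<in>{0<..}. \<integral>\<^sup>+\<omega>. \<integral>\<^sup>+v. indicator A (t, X t \<omega>, v) * indicator jump_cond (t, X t \<omega>, v) \<partial>Pm \<partial>M \<partial>lborel)"
    by (rule jump_formula) measurable
  also have "\<dots> = (\<integral>\<^sup>+ t. \<integral>\<^sup>+ u. \<integral>\<^sup>+ v. indicator ?B (t, u, v) \<partial>Pm \<partial>distr M borel (X t) \<partial>lborel)"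
  proof (rule nn_integral_cong)
    fix t :: real
    show "(\<integral>\<^sup>+\<omega>. \<integral>\<^sup>+v. indicator A (t, X t \<omega>, v) * indicator jump_cond (t, X t \<omega>, v) \<partial>Pm \<partial>M) * indicator {0<..} t =
        (\<integral>\<^sup>+ u. \<integral>\<^sup>+ v. indicator ?B (t, u, v) \<partial>Pm \<partial>distr M borel (X t))"
    proof (cases "0 < t")
      case True
      then have [measurable]: "X t \<in> borel_measurable M" by (intro random_vector) simp
      have m: "(\<lambda>p. (t, p)) \<in> borel \<Otimes>\<^sub>M Pm \<rightarrow>\<^sub>M (borel :: (real \<times> (real ^ 'n) \<times> (real ^ 'n)) measure)"
        unfolding borel_prod[symmetric] by measurable
      have "(\<lambda>p. indicator (A \<inter> jump_cond) (t, p) :: ennreal) \<in> borel_measurable (borel \<Otimes>\<^sub>M Pm)"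
        by (rule measurable_compose[OF m]) measurable
      then have "(\<lambda>u. \<integral>\<^sup>+ v. indicator (A \<inter> jump_cond) (t, u, v) \<partial>Pm) \<in> borel_measurable borel"
        using Pm.borel_measurable_nn_integral_fst by simp
      then show ?thesis unfolding B using True
        by (simp add: nn_integral_distr indicator_inter_arith)
    next
      case False
      then have "indicator ?B (t, u, v) = (0 :: ennreal)" for u v using A(2) by (auto simp: indicator_def)
      then show ?thesis using False by simp
    qed
  qed
  finally show ?thesis .
qed

end

subsection \<open>Creeping\<close>

lemma restrict_space_whole: "restrict_space M (space M) = M"
  by (rule measure_eqI)
    (auto simp: sets_restrict_space_iff emeasure_restrict_space dest: sets.sets_into_space[THEN subsetD])

context orthant_levy_process
begin

definition kernel_ext :: "(real \<Rightarrow> real \<Rightarrow> (real ^ 'n) measure) \<Rightarrow> real \<times> real \<Rightarrow> (real ^ 'n) measure" where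
  "kernel_ext K = ext_kernel ({0<..} \<times> UNIV) (\<lambda>(t, s). K t s)"

lemma kernel_ext_eq [simp]: "0 < t \<Longrightarrow> kernel_ext K (t, s) = K t s"
  by (simp add: kernel_ext_def)

lemma halfplane_sets [measurable]: "{0 :: real<..} \<times> (UNIV :: real set) \<in> sets borel"
  by (intro borel_open open_Times) auto

lemma kernel_ext_measurable:
  assumes "cond_family M X K"
  shows "kernel_ext K \<in> borel \<rightarrow>\<^sub>M prob_algebra borel"
  unfolding kernel_ext_def
  by (rule measurable_ext_kernel) (use assms halfplane_sets in \<open>auto simp: cond_family_def\<close>)

lemma kernel_prob:
  assumes "cond_family M X K" "0 < t"
  shows "prob_space (K t s)" "sets (K t s) = sets borel"
  using measurable_space[OF kernel_ext_measurable[OF assms(1)], of "(t, s)"] assms(2)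
  by (auto simp: space_prob_algebra)

lemma cond_family_nn_integral:
  assumes K: "cond_family M X K" and r: "0 < r" and F[measurable]: "F \<in> borel_measurable borel"
  shows "(\<integral>\<^sup>+\<omega>. F (S r \<omega>, X r \<omega>) \<partial>M) = (\<integral>\<^sup>+\<omega>. \<integral>\<^sup>+u. F (S r \<omega>, u) \<partial>K r (S r \<omega>) \<partial>M)"
proof -
  have X[measurable]: "X r \<in> borel_measurable M" using r by (intro random_vector) simp
  have "reg_cond_distr M (space M) (norm_proc X r) (X r) UNIV (K r)" using K r by (auto simp: cond_family_def)
  from reg_cond_distr_nn_integral[OF this _ _ _ _ _ F] finite_measure_axioms X
  show ?thesis by (simp add: restrict_space_whole norm_proc_def[abs_def])
qed

end

context levy_passage
begin

definition "creep = {\<omega>\<in>E. at_S X c \<omega> = c (\<tau> \<omega>)}"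

lemma creep_sets [measurable]: "creep \<in> sets M"
proof -
  have "creep = {\<omega>\<in>space M. \<omega> \<in> E \<and> l1norm (at0 \<omega>) = c_ext (\<tau> \<omega>)}"
    using passesD(1) by (auto simp: creep_def on_passes)
  then show ?thesis by simp
qed

lemma creepD: "\<omega> \<in> creep \<Longrightarrow> \<omega> \<in> E" "\<omega> \<in> creep \<Longrightarrow> \<omega> \<in> space M"
  using passesD(1) by (auto simp: creep_def)

lemma AE_creep: "AE \<omega> in M. \<omega> \<in> creep \<longleftrightarrow> \<omega> \<in> E \<and> jmp \<omega> = 0"
  using AE_no_jump_onto_boundary by eventually_elim (auto simp: creep_def)

lemma creep_law_nn_integral:
  assumes [measurable]: "f \<in> borel_measurable borel"
  shows "(\<integral>\<^sup>+t. f t \<partial>creep_law M X c) = (\<integral>\<^sup>+\<omega>. f (\<tau> \<omega>) * indicator creep \<omega> \<partial>M)"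
  unfolding creep_law_def creep_def[symmetric]
  by (subst nn_integral_distr) (auto simp: nn_integral_restrict_space measurable_restrict_space1)

definition creep_joint_law :: "(real \<times> (real ^ 'n)) measure" where
  "creep_joint_law = distr (restrict_space M creep) borel (\<lambda>\<omega>. (\<tau> \<omega>, pre0 \<omega>))"

lemma sets_creep_joint_law [simp, measurable_cong]: "sets creep_joint_law = sets borel"
  by (simp add: creep_joint_law_def)

lemma tau_pre0_measurable [measurable]: "(\<lambda>\<omega>. (\<tau> \<omega>, pre0 \<omega>)) \<in> M \<rightarrow>\<^sub>M borel"
  unfolding borel_prod[symmetric] by measurable

lemma creep_event:
  assumes C: "C \<in> sets borel"
  shows "{\<omega>\<in>creep. (\<tau> \<omega>, pre \<omega>) \<in> C} = creep \<inter> ((\<lambda>\<omega>. (\<tau> \<omega>, pre0 \<omega>)) -` C \<inter> space M)"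
    and "{\<omega>\<in>creep. (\<tau> \<omega>, pre \<omega>) \<in> C} \<in> sets M"
proof -
  show eq: "{\<omega>\<in>creep. (\<tau> \<omega>, pre \<omega>) \<in> C} = creep \<inter> ((\<lambda>\<omega>. (\<tau> \<omega>, pre0 \<omega>)) -` C \<inter> space M)"
    using creepD by (auto simp: on_passes(1))
  show "{\<omega>\<in>creep. (\<tau> \<omega>, pre \<omega>) \<in> C} \<in> sets M"
    unfolding eq using measurable_sets[OF tau_pre0_measurable C] by auto
qed

lemma creep_joint_law_nn_integral:
  assumes [measurable]: "f \<in> borel_measurable borel"
  shows "(\<integral>\<^sup>+p. f p \<partial>creep_joint_law) = (\<integral>\<^sup>+\<omega>. f (\<tau> \<omega>, pre0 \<omega>) * indicator creep \<omega> \<partial>M)"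
  unfolding creep_joint_law_def
  by (subst nn_integral_distr) (auto simp: nn_integral_restrict_space intro!: measurable_restrict_space1)

lemma finite_creep_joint_law: "finite_measure creep_joint_law"
  unfolding creep_joint_law_def
  by (intro finite_measure.finite_measure_distr finite_measure_restrict_space measurable_restrict_space1)
    (auto simp: finite_measure_axioms)

lemma creep_joint_law_fst: "distr creep_joint_law borel fst = creep_law M X c"
proof -
  have f: "fst \<in> (borel :: (real \<times> (real ^ 'n)) measure) \<rightarrow>\<^sub>M borel" unfolding borel_prod[symmetric] by measurable
  show ?thesis unfolding creep_joint_law_def creep_law_def creep_def[symmetric]
    by (subst distr_distr[OF f]) (auto intro!: measurable_restrict_space1 simp: comp_def)
qed

lemma emeasure_creep_joint_law:
  assumes C: "C \<in> sets borel"
  shows "emeasure creep_joint_law C = emeasure M {\<omega>\<in>creep. (\<tau> \<omega>, pre \<omega>) \<in> C}"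
proof -
  have "emeasure creep_joint_law C = (\<integral>\<^sup>+\<omega>. indicator C (\<tau> \<omega>, pre0 \<omega>) * indicator creep \<omega> \<partial>M)"
    using creep_joint_law_nn_integral[of "indicator C"] C by simp
  also have "\<dots> = (\<integral>\<^sup>+\<omega>. indicator {\<omega>\<in>creep. (\<tau> \<omega>, pre \<omega>) \<in> C} \<omega> \<partial>M)"
    by (rule nn_integral_cong) (auto simp: indicator_def creep_event(1)[OF C])
  also have "\<dots> = emeasure M {\<omega>\<in>creep. (\<tau> \<omega>, pre \<omega>) \<in> C}"
    by (rule nn_integral_indicator[OF creep_event(2)[OF C]])
  finally show ?thesis .
qed

lemma emeasure_creep_event:
  assumes C: "C \<in> sets borel"
  shows "emeasure M {\<omega>\<in>E. (\<tau> \<omega>, pre \<omega>) \<in> C \<and> jmp \<omega> = 0} = emeasure creep_joint_law C"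
  unfolding emeasure_creep_joint_law[OF C]
proof (rule emeasure_eq_AE)
  show "AE \<omega> in M. \<omega> \<in> {\<omega>\<in>E. (\<tau> \<omega>, pre \<omega>) \<in> C \<and> jmp \<omega> = 0} \<longleftrightarrow> \<omega> \<in> {\<omega>\<in>creep. (\<tau> \<omega>, pre \<omega>) \<in> C}"
    using AE_creep by eventually_elim auto
  have "(\<lambda>\<omega>. (\<tau> \<omega>, pre0 \<omega>)) -` C \<inter> space M \<in> sets M" by (rule measurable_sets[OF tau_pre0_measurable C])
  from passes_sets this have "E \<inter> ((\<lambda>\<omega>. (\<tau> \<omega>, pre0 \<omega>)) -` C \<inter> space M) \<in> sets M" by (rule sets.Int)
  moreover have "{\<omega>\<in>space M. at0 \<omega> - pre0 \<omega> = 0} \<in> sets M" by measurable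
  ultimately have "E \<inter> ((\<lambda>\<omega>. (\<tau> \<omega>, pre0 \<omega>)) -` C \<inter> space M) \<inter> {\<omega>\<in>space M. at0 \<omega> - pre0 \<omega> = 0} \<in> sets M"
    by (rule sets.Int)
  also have "E \<inter> ((\<lambda>\<omega>. (\<tau> \<omega>, pre0 \<omega>)) -` C \<inter> space M) \<inter> {\<omega>\<in>space M. at0 \<omega> - pre0 \<omega> = 0} =
      {\<omega>\<in>E. (\<tau> \<omega>, pre \<omega>) \<in> C \<and> jmp \<omega> = 0}"
    using passesD(1) by (auto simp: on_passes)
  finally show "{\<omega>\<in>E. (\<tau> \<omega>, pre \<omega>) \<in> C \<and> jmp \<omega> = 0} \<in> sets M" .
  show "{\<omega>\<in>creep. (\<tau> \<omega>, pre \<omega>) \<in> C} \<in> sets M" by (rule creep_event(2)[OF C])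
qed

text \<open>Both creeping identities reduce to this one condition on the joint law of the passage
  time and the pre-passage value.\<close>

definition disintegrates_creep :: "(real \<Rightarrow> (real ^ 'n) measure) \<Rightarrow> bool" where
  "disintegrates_creep \<kappa> \<longleftrightarrow> (\<forall>C\<in>sets borel.
    emeasure creep_joint_law C = (\<integral>\<^sup>+t. emeasure (\<kappa> t) {u. (t, u) \<in> C} \<partial>creep_law M X c))"

text \<open>Holds at every point of \<open>E\<close> and therefore gives exact measurability of the
  sizes; the jump of S is identified with the norm of the jump of X for increasing paths, that is,
  almost surely.\<close>

lemma jump_S_on_passes:
  assumes "\<omega> \<in> E" shows "pre_S X c \<omega> = l1norm (pre0 \<omega>)" "jump_S X c \<omega> = l1norm (at0 \<omega>) - l1norm (pre0 \<omega>)"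
proof -
  note T = passesD[OF assms]
  have "((\<lambda>r. S r \<omega>) \<longlongrightarrow> l1norm (left_lim (\<lambda>r. X r \<omega>) (\<tau> \<omega>))) (at_left (\<tau> \<omega>))"
    by (intro tendsto_l1norm tendsto_left_lim left_limits T)
  from left_lim_eq[OF this]
  show "pre_S X c \<omega> = l1norm (pre0 \<omega>)" "jump_S X c \<omega> = l1norm (at0 \<omega>) - l1norm (pre0 \<omega>)"
    using T by (simp_all add: pre_S_def jump_S_def jump_def norm_proc_def pre0_def at0_def)
qed

lemma kernel_along_measurable:
  assumes "cond_family M X K"
  shows "(\<lambda>t. kernel_ext K (t, c_ext t)) \<in> borel \<rightarrow>\<^sub>M prob_algebra borel"
proof -
  have "(\<lambda>t. (t, c_ext t)) \<in> borel \<rightarrow>\<^sub>M (borel :: (real \<times> real) measure)"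
    unfolding borel_prod[symmetric] by measurable
  then show ?thesis by (rule measurable_compose[OF _ kernel_ext_measurable[OF assms]])
qed

text \<open>Almost surely the jump of S vanishes exactly when the jump of X does, so conditioning on
  the time and the jump of S over the range with jump 0 is conditioning on the time over the
  creeping event.\<close>

lemma creep_identities:
  assumes K: "cond_family M X K" and dis: "disintegrates_creep (\<lambda>t. K t (c t))"
  shows "creep_joint M X c K" "creep_cond M X c K"
proof -
  show "creep_joint M X c K"
    unfolding creep_joint_def
    using dis emeasure_creep_event by (auto simp: disintegrates_creep_def)
  show "creep_cond M X c K"
    unfolding creep_cond_def reg_cond_distr_def
  proof (intro conjI ballI impI)
    note KM = kernel_along_measurable[OF K]
    have "(\<lambda>y. kernel_ext K (fst y, c_ext (fst y))) \<in> (borel :: (real \<times> real) measure) \<rightarrow>\<^sub>M prob_algebra borel"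
      by (rule measurable_compose[OF _ KM]) (unfold borel_prod[symmetric], measurable)
    then have "(\<lambda>y. kernel_ext K (fst y, c_ext (fst y))) \<in> restrict_space borel ({0<..} \<times> {0::real}) \<rightarrow>\<^sub>M prob_algebra borel"
      by (rule measurable_restrict_space1)
    also have "?this \<longleftrightarrow> (\<lambda>(t, z). K t (c t)) \<in> restrict_space borel ({0<..} \<times> {0::real}) \<rightarrow>\<^sub>M prob_algebra borel"
      by (rule measurable_cong) (auto simp: space_restrict_space c_ext_def)
    finally show "(\<lambda>(t, z). K t (c t)) \<in> restrict_space borel ({0<..} \<times> {0::real}) \<rightarrow>\<^sub>M prob_algebra borel" .
    fix A :: "(real \<times> real) set" and B :: "(real ^ 'n) set"
    assume A[measurable]: "A \<in> sets borel" and B[measurable]: "B \<in> sets borel" and AR: "A \<subseteq> {0<..} \<times> {0}"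
    \<comment> \<open>Since A lies in the slice where the jump of S is 0, the pair A, B amounts to a
      set of times and positions.\<close>
    define C where "C = {p :: real \<times> (real ^ 'n). (fst p, 0) \<in> A \<and> snd p \<in> B}"
    have C: "C \<in> sets borel"
    proof -
      have "(\<lambda>p :: real \<times> (real ^ 'n). (fst p, 0 :: real)) \<in> borel \<rightarrow>\<^sub>M borel"
        "snd \<in> (borel :: (real \<times> (real ^ 'n)) measure) \<rightarrow>\<^sub>M borel"
        unfolding borel_prod[symmetric] by measurable
      from measurable_sets[OF this(1) A] measurable_sets[OF this(2) B]
      have "(\<lambda>p :: real \<times> (real ^ 'n). (fst p, 0)) -` A \<inter> snd -` B \<in> sets borel" by auto
      also have "(\<lambda>p :: real \<times> (real ^ 'n). (fst p, 0)) -` A \<inter> snd -` B = C" by (auto simp: C_def)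
      finally show ?thesis .
    qed
    have A0[measurable]: "{t. (t, 0) \<in> A} \<in> sets borel"
    proof -
      have "(\<lambda>t. (t, 0 :: real)) \<in> borel \<rightarrow>\<^sub>M (borel :: (real \<times> real) measure)" unfolding borel_prod[symmetric] by measurable
      from measurable_sets[OF this A] show ?thesis by (simp add: vimage_def)
    qed
    note KS = measurable_prob_algebraD[OF KM]
    define k where "k t = emeasure (kernel_ext K (t, c_ext t)) B" for t
    have k[measurable]: "k \<in> borel_measurable borel"
      unfolding k_def[abs_def] using measurable_compose[OF KS measurable_emeasure_subprob_algebra[OF B]] by simp
    have kA: "k t = emeasure (K t (c t)) B" if "(t, z) \<in> A" for t z
      using that AR by (auto simp: k_def c_ext_def)
    have ev: "{\<omega>\<in>E. (\<tau> \<omega>, jump_S X c \<omega>) \<in> A \<and> pre \<omega> \<in> B} \<in> sets M"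
    proof -
      have "(\<lambda>\<omega>. (\<tau> \<omega>, l1norm (at0 \<omega>) - l1norm (pre0 \<omega>))) \<in> M \<rightarrow>\<^sub>M borel"
        unfolding borel_prod[symmetric] by measurable
      from sets.Int[OF passes_sets measurable_sets[OF this A]] measurable_sets[OF pre0_measurable B]
      have "E \<inter> ((\<lambda>\<omega>. (\<tau> \<omega>, l1norm (at0 \<omega>) - l1norm (pre0 \<omega>))) -` A \<inter> space M) \<inter> (pre0 -` B \<inter> space M) \<in> sets M"
        by (rule sets.Int)
      also have "E \<inter> ((\<lambda>\<omega>. (\<tau> \<omega>, l1norm (at0 \<omega>) - l1norm (pre0 \<omega>))) -` A \<inter> space M) \<inter> (pre0 -` B \<inter> space M) =
          {\<omega>\<in>E. (\<tau> \<omega>, jump_S X c \<omega>) \<in> A \<and> pre \<omega> \<in> B}"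
        using passesD(1) by (auto simp: on_passes jump_S_on_passes)
      finally show ?thesis .
    qed
    have "emeasure M {\<omega>\<in>E. (\<tau> \<omega>, jump_S X c \<omega>) \<in> A \<and> pre \<omega> \<in> B} =
        emeasure M {\<omega>\<in>creep. (\<tau> \<omega>, pre \<omega>) \<in> C}"
    proof (rule emeasure_eq_AE[OF _ ev])
      show "AE \<omega> in M. \<omega> \<in> {\<omega>\<in>E. (\<tau> \<omega>, jump_S X c \<omega>) \<in> A \<and> pre \<omega> \<in> B} \<longleftrightarrow>
          \<omega> \<in> {\<omega>\<in>creep. (\<tau> \<omega>, pre \<omega>) \<in> C}"
        using AE_creep AE_increasing_path
      proof eventually_elim
        case (elim \<omega>)
        show ?case
        proof (cases "\<omega> \<in> E")
          case True
          have "jump_S X c \<omega> = 0 \<longleftrightarrow> jmp \<omega> = 0" using path_at_passage(4)[OF elim(2) True] by simp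
          then show ?thesis using elim(1) True AR by (auto simp: C_def)
        qed (use elim in auto)
      qed
      show "{\<omega>\<in>creep. (\<tau> \<omega>, pre \<omega>) \<in> C} \<in> sets M" by (rule creep_event(2)[OF C])
    qed
    also have "\<dots> = (\<integral>\<^sup>+t. emeasure (K t (c t)) {u. (t, u) \<in> C} \<partial>creep_law M X c)"
      using dis C emeasure_creep_joint_law[OF C] by (simp add: disintegrates_creep_def)
    also have "\<dots> = (\<integral>\<^sup>+t. k t * indicator {t. (t, 0) \<in> A} t \<partial>creep_law M X c)"
      by (rule nn_integral_cong) (auto simp: C_def indicator_def kA)
    also have "\<dots> = (\<integral>\<^sup>+\<omega>. k (\<tau> \<omega>) * indicator {t. (t, 0) \<in> A} (\<tau> \<omega>) * indicator creep \<omega> \<partial>M)"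
      by (rule creep_law_nn_integral) measurable
    also have "\<dots> = (\<integral>\<^sup>+\<omega>. k (\<tau> \<omega>) * indicator A (\<tau> \<omega>, jump_S X c \<omega>) * indicator E \<omega> \<partial>M)"
    proof (rule nn_integral_cong_AE)
      show "AE \<omega> in M. k (\<tau> \<omega>) * indicator {t. (t, 0) \<in> A} (\<tau> \<omega>) * indicator creep \<omega> =
          k (\<tau> \<omega>) * indicator A (\<tau> \<omega>, jump_S X c \<omega>) * indicator E \<omega>"
        using AE_creep AE_increasing_path
      proof eventually_elim
        case (elim \<omega>)
        show ?case
        proof (cases "\<omega> \<in> E")
          case True
          have "jump_S X c \<omega> = 0 \<longleftrightarrow> jmp \<omega> = 0" using path_at_passage(4)[OF elim(2) True] by simp
          then show ?thesis using elim(1) True AR by (auto simp: indicator_def)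
        qed (use elim in auto)
      qed
    qed
    also have "\<dots> = (\<integral>\<^sup>+\<omega>. k (\<tau> \<omega>) * indicator A (\<tau> \<omega>, jump_S X c \<omega>) \<partial>restrict_space M E)"
      by (simp add: nn_integral_restrict_space)
    also have "\<dots> = (\<integral>\<^sup>+y. k (fst y) * indicator A y \<partial>distr (restrict_space M E) borel (\<lambda>\<omega>. (\<tau> \<omega>, jump_S X c \<omega>)))"
    proof -
      have "(\<lambda>\<omega>. (\<tau> \<omega>, l1norm (at0 \<omega>) - l1norm (pre0 \<omega>))) \<in> M \<rightarrow>\<^sub>M borel"
        unfolding borel_prod[symmetric] by measurable
      then have "(\<lambda>\<omega>. (\<tau> \<omega>, l1norm (at0 \<omega>) - l1norm (pre0 \<omega>))) \<in> restrict_space M E \<rightarrow>\<^sub>M borel"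
        by (rule measurable_restrict_space1)
      also have "?this \<longleftrightarrow> (\<lambda>\<omega>. (\<tau> \<omega>, jump_S X c \<omega>)) \<in> restrict_space M E \<rightarrow>\<^sub>M borel"
        by (rule measurable_cong) (auto simp: space_restrict_space jump_S_on_passes)
      finally have m1: "(\<lambda>\<omega>. (\<tau> \<omega>, jump_S X c \<omega>)) \<in> restrict_space M E \<rightarrow>\<^sub>M borel" .
      have [measurable]: "fst \<in> (borel :: (real \<times> real) measure) \<rightarrow>\<^sub>M borel" unfolding borel_prod[symmetric] by measurable
      have m2: "(\<lambda>y. k (fst y) * indicator A y) \<in> borel_measurable borel" by measurable
      show ?thesis by (subst nn_integral_distr[OF m1]) (use m2 in simp_all)
    qed
    also have "\<dots> = (\<integral>\<^sup>+y. emeasure (case y of (t, z) \<Rightarrow> K t (c t)) B * indicator A y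
        \<partial>distr (restrict_space M E) borel (\<lambda>\<omega>. (\<tau> \<omega>, jump_S X c \<omega>)))"
      by (rule nn_integral_cong) (auto simp: indicator_def kA)
    finally show "emeasure M {\<omega>\<in>E. (\<tau> \<omega>, jump_S X c \<omega>) \<in> A \<and> pre \<omega> \<in> B} =
        (\<integral>\<^sup>+y. emeasure (case y of (t, z) \<Rightarrow> K t (c t)) B * indicator A y
          \<partial>distr (restrict_space M E) borel (\<lambda>\<omega>. (\<tau> \<omega>, jump_S X c \<omega>)))" .
  qed
qed

text \<open>S(t) = c(t) forces the passage to happen at t, as the left limit is at most S(t). Hence
  the mass of the creeping law at t is the probability of S(t) = c(t).\<close>

lemma AE_creep_at:
  assumes t: "0 < t"
  shows "AE \<omega> in M. \<omega> \<in> creep \<and> \<tau> \<omega> = t \<and> pre \<omega> \<in> B \<longleftrightarrow> S t \<omega> = c t \<and> X t \<omega> \<in> B"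
  using AE_increasing_path AE_creep AE_space
proof eventually_elim
  case (elim \<omega>)
  interpret increasing_path "\<lambda>t. X t \<omega>" by fact
  have X: "X t \<omega> = pre \<omega>" if "\<omega> \<in> creep" "\<tau> \<omega> = t"
    using elim(2) that by (simp add: jump_X_def jump_def pre_X_def)
  show ?case
  proof
    assume "\<omega> \<in> creep \<and> \<tau> \<omega> = t \<and> pre \<omega> \<in> B"
    then show "S t \<omega> = c t \<and> X t \<omega> \<in> B" using X by (auto simp: creep_def at_S_def norm_proc_def)
  next
    assume a: "S t \<omega> = c t \<and> X t \<omega> \<in> B"
    have "l1norm (left_lim (\<lambda>r. X r \<omega>) t) \<le> S t \<omega>"
      using l1norm_jump[OF t] l1norm_nonneg[of "jump (\<lambda>r. X r \<omega>) t"] by simp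
    then have e: "\<omega> \<in> E \<and> \<tau> \<omega> = t"
      using a by (subst passes_tau_eq_iff[where X=X and \<omega>=\<omega> and M=M, OF elim(1,3) t]) simp
    then have "\<omega> \<in> creep" using a by (simp add: creep_def at_S_def norm_proc_def)
    then show "\<omega> \<in> creep \<and> \<tau> \<omega> = t \<and> pre \<omega> \<in> B" using e a X by auto
  qed
qed

text \<open>At an atom \<open>t\<close> of the creeping law the disintegration kernel is already determined, and there it
  agrees with conditioning \<open>X(t)\<close> on the event \<open>S(t) = c(t)\<close> of positive probability.\<close>

lemma creep_version_exists:
  assumes K: "cond_family M X K"
  shows "\<exists>K'. cond_family M X K' \<and> (\<forall>t>0. \<forall>s. s \<noteq> c t \<longrightarrow> K' t s = K t s) \<and>
    creep_joint M X c K' \<and> creep_cond M X c K'"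
proof -
  obtain \<kappa> where \<kappa>: "\<kappa> \<in> borel \<rightarrow>\<^sub>M prob_algebra borel"
    and dis: "\<And>C. C \<in> sets borel \<Longrightarrow> emeasure creep_joint_law C =
      (\<integral>\<^sup>+t. emeasure (\<kappa> t) {u. (t, u) \<in> C} \<partial>distr creep_joint_law borel fst)"
    using disintegration[OF finite_creep_joint_law sets_creep_joint_law] by blast
  note dis = dis[unfolded creep_joint_law_fst]
  \<comment> \<open>The kernel is changed on the graph of c only; what has to be checked is that it
    still gives the conditional law of X(t) given S(t).\<close>
  define K' where "K' t s = (if s = c t then \<kappa> t else K t s)" for t s
  have K'c: "K' t (c t) = \<kappa> t" for t by (simp add: K'_def)
  define Kb where "Kb p = (if snd p = c_ext (fst p) then \<kappa> (fst p) else kernel_ext K p)" for p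
  have Kb: "Kb \<in> borel \<rightarrow>\<^sub>M prob_algebra borel"
  proof -
    have f[measurable]: "fst \<in> (borel :: (real \<times> real) measure) \<rightarrow>\<^sub>M borel" "snd \<in> (borel :: (real \<times> real) measure) \<rightarrow>\<^sub>M borel"
      unfolding borel_prod[symmetric] by measurable
    show ?thesis unfolding Kb_def[abs_def]
      by (rule measurable_If[OF measurable_compose[OF f(1) \<kappa>] kernel_ext_measurable[OF K]]) measurable
  qed
  have Kb_eq: "Kb (t, s) = K' t s" if "0 < t" for t s using that by (simp add: Kb_def K'_def c_ext_def)
  have cf: "cond_family M X K'"
    unfolding cond_family_def
  proof (intro conjI allI impI)
    have "Kb \<in> restrict_space borel ({0<..} \<times> UNIV) \<rightarrow>\<^sub>M prob_algebra borel" by (rule measurable_restrict_space1[OF Kb])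
    also have "?this \<longleftrightarrow> (\<lambda>(t, s). K' t s) \<in> restrict_space borel ({0<..} \<times> UNIV) \<rightarrow>\<^sub>M prob_algebra borel"
      by (rule measurable_cong) (auto simp: space_restrict_space Kb_eq)
    finally show "(\<lambda>(t, s). K' t s) \<in> restrict_space borel ({0<..} \<times> UNIV) \<rightarrow>\<^sub>M prob_algebra borel" .
    fix t :: real assume t: "0 < t"
    have X[measurable]: "X t \<in> borel_measurable M" using t by (intro random_vector) simp
    have KM: "K' t \<in> borel \<rightarrow>\<^sub>M prob_algebra borel"
    proof -
      have "Pair t \<in> borel \<rightarrow>\<^sub>M (borel :: (real \<times> real) measure)" unfolding borel_prod[symmetric] by measurable
      from measurable_compose[OF this Kb] show ?thesis using t by (simp add: Kb_eq)
    qed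
    have K1: "K t \<in> borel \<rightarrow>\<^sub>M prob_algebra borel"
    proof -
      have "Pair t \<in> borel \<rightarrow>\<^sub>M (borel :: (real \<times> real) measure)" unfolding borel_prod[symmetric] by measurable
      from measurable_compose[OF this kernel_ext_measurable[OF K]] show ?thesis using t by simp
    qed
    have rc: "reg_cond_distr M (space M) (norm_proc X t) (X t) UNIV (K t)" using K t by (auto simp: cond_family_def)
    define L where "L = distr M borel (norm_proc X t)"
    have np[measurable]: "norm_proc X t \<in> borel_measurable M" unfolding norm_proc_def[abs_def] by measurable
    have law: "emeasure M {\<omega>\<in>space M. norm_proc X t \<omega> \<in> A \<and> X t \<omega> \<in> B} =
        (\<integral>\<^sup>+y. emeasure (K t y) B * indicator A y \<partial>L)" if "A \<in> sets borel" "B \<in> sets borel" for A B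
      using rc that by (auto simp: reg_cond_distr_def restrict_space_whole L_def)
    \<comment> \<open>The change matters only if S(t) = c(t) has positive probability; in that case
      both kernels describe X(t) on this event.\<close>
    have atom: "emeasure (\<kappa> t) B * emeasure L {c t} = emeasure (K t (c t)) B * emeasure L {c t}"
      if B[measurable]: "B \<in> sets borel" for B
    proof -
      have at: "emeasure (\<kappa> t) B' * emeasure (creep_law M X c) {t} = emeasure (K t (c t)) B' * emeasure L {c t}"
        if B'[measurable]: "B' \<in> sets borel" for B'
      proof -
        have TB: "{t} \<times> B' \<in> sets borel" by (simp add: borel_Times)
        have "emeasure (\<kappa> t) B' * emeasure (creep_law M X c) {t} =
            (\<integral>\<^sup>+t'. emeasure (\<kappa> t) B' * indicator {t} t' \<partial>creep_law M X c)"
          by (subst nn_integral_cmult) (auto simp: creep_law_def)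
        also have "\<dots> = (\<integral>\<^sup>+t'. emeasure (\<kappa> t') {u. (t', u) \<in> {t} \<times> B'} \<partial>creep_law M X c)"
          by (rule nn_integral_cong) (auto simp: indicator_def)
        also have "\<dots> = emeasure M {\<omega>\<in>creep. (\<tau> \<omega>, pre \<omega>) \<in> {t} \<times> B'}"
          unfolding dis[OF TB, symmetric] by (rule emeasure_creep_joint_law[OF TB])
        also have "\<dots> = emeasure M {\<omega>\<in>space M. norm_proc X t \<omega> \<in> {c t} \<and> X t \<omega> \<in> B'}"
        proof (rule emeasure_eq_AE)
          show "AE \<omega> in M. \<omega> \<in> {\<omega>\<in>creep. (\<tau> \<omega>, pre \<omega>) \<in> {t} \<times> B'} \<longleftrightarrow>
              \<omega> \<in> {\<omega>\<in>space M. norm_proc X t \<omega> \<in> {c t} \<and> X t \<omega> \<in> B'}"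
            using AE_creep_at[OF t, of B'] AE_space by eventually_elim (auto simp: norm_proc_def)
          show "{\<omega>\<in>creep. (\<tau> \<omega>, pre \<omega>) \<in> {t} \<times> B'} \<in> sets M" by (rule creep_event(2)[OF TB])
        qed measurable
        also have "\<dots> = (\<integral>\<^sup>+y. emeasure (K t y) B' * indicator {c t} y \<partial>L)" by (rule law) auto
        also have "\<dots> = (\<integral>\<^sup>+y. emeasure (K t (c t)) B' * indicator {c t} y \<partial>L)"
          by (rule nn_integral_cong) (auto simp: indicator_def)
        also have "\<dots> = emeasure (K t (c t)) B' * emeasure L {c t}"
          by (subst nn_integral_cmult) (auto simp: L_def)
        finally show ?thesis .
      qed
      \<comment> \<open>Taking B' to be the whole space equates the mass of the creeping law at t
        with that of the law of S(t) at c t.\<close>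
      have "emeasure (\<kappa> t) UNIV = 1" "emeasure (K t (c t)) UNIV = 1"
        using measurable_space[OF \<kappa>, of t] measurable_space[OF K1, of "c t"] in_space_prob_algebra by force+
      then have "emeasure (creep_law M X c) {t} = emeasure L {c t}" using at[of UNIV] by simp
      then show ?thesis using at[OF B] by simp
    qed
    show "reg_cond_distr M (space M) (norm_proc X t) (X t) UNIV (K' t)"
      unfolding reg_cond_distr_def restrict_space_whole restrict_space_whole[of borel, simplified]
    proof (intro conjI ballI impI KM)
      fix A :: "real set" and B :: "(real ^ 'n) set" assume A[measurable]: "A \<in> sets borel" and B[measurable]: "B \<in> sets borel"
      have m: "(\<lambda>y. emeasure (K'' y) B) \<in> borel_measurable borel" if "K'' \<in> borel \<rightarrow>\<^sub>M prob_algebra borel"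
        for K'' :: "real \<Rightarrow> (real ^ 'n) measure"
        using measurable_compose[OF measurable_prob_algebraD[OF that] measurable_emeasure_subprob_algebra[OF B]] by simp
      note [measurable] = m[OF K1] m[OF KM]
      \<comment> \<open>Separating the single value c t leaves a part on which \<open>K'\<close> and
        \<open>K\<close> agree.\<close>
      have split: "(\<integral>\<^sup>+y. emeasure (K'' y) B * indicator A y \<partial>L) =
          (\<integral>\<^sup>+y. emeasure (K'' y) B * indicator (A - {c t}) y \<partial>L) + emeasure (K'' (c t)) B * emeasure L {c t} * indicator A (c t)"
        if "K'' \<in> borel \<rightarrow>\<^sub>M prob_algebra borel" for K'' :: "real \<Rightarrow> (real ^ 'n) measure"
      proof -
        note [measurable] = m[OF that]
        have "(\<integral>\<^sup>+y. emeasure (K'' y) B * indicator A y \<partial>L) =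
          (\<integral>\<^sup>+y. emeasure (K'' y) B * indicator (A - {c t}) y + emeasure (K'' (c t)) B * indicator A (c t) * indicator {c t} y \<partial>L)"
          by (rule nn_integral_cong) (auto simp: indicator_def)
        also have "\<dots> = (\<integral>\<^sup>+y. emeasure (K'' y) B * indicator (A - {c t}) y \<partial>L) +
            emeasure (K'' (c t)) B * indicator A (c t) * emeasure L {c t}"
          by (subst nn_integral_add) (auto simp: L_def nn_integral_cmult)
        finally show ?thesis by (simp add: mult_ac)
      qed
      have "(\<integral>\<^sup>+y. emeasure (K' t y) B * indicator (A - {c t}) y \<partial>L) = (\<integral>\<^sup>+y. emeasure (K t y) B * indicator (A - {c t}) y \<partial>L)"
        by (rule nn_integral_cong) (auto simp: K'_def indicator_def)
      then show "emeasure M {\<omega>\<in>space M. norm_proc X t \<omega> \<in> A \<and> X t \<omega> \<in> B} =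
          (\<integral>\<^sup>+y. emeasure (K' t y) B * indicator A y \<partial>distr M borel (norm_proc X t))"
        unfolding law[OF A B] L_def[symmetric] split[OF K1] split[OF KM] K'c atom[OF B] by simp
    qed
  qed
  moreover have "disintegrates_creep (\<lambda>t. K' t (c t))" using dis by (simp add: disintegrates_creep_def K'c)
  ultimately show ?thesis using creep_identities[of K'] by (intro exI[of _ K']) (auto simp: K'_def)
qed

end

section \<open>Grid approximation of the law at creeping\<close>

context levy_passage
begin

lemma AE_creep_law_pos: "AE t in creep_law M X c. 0 < t"
  unfolding creep_law_def creep_def[symmetric]
  by (subst AE_distr_iff) (use passesD(2)[OF creepD(1)] in \<open>auto intro!: measurable_restrict_space1 AE_I2 simp: space_restrict_space\<close>)

text \<open>Passage over c happens between the consecutive grid times r and r'; f tests the time, G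
  the position before passage, and \<open>\<zeta>\<close> the last increment. Starting at Suc k
  keeps r positive, where c and the kernels are under control.\<close>

definition grid_cell :: "(real \<Rightarrow> real) \<Rightarrow> (real \<Rightarrow> real) \<Rightarrow> (real \<Rightarrow> real ^ 'n \<Rightarrow> ennreal) \<Rightarrow> nat \<Rightarrow> nat \<Rightarrow> 'a \<Rightarrow> ennreal" where
  "grid_cell f \<zeta> G n k \<omega> = (let r = Suc k / Suc n; r' = Suc (Suc k) / Suc n in
    indicator {\<omega>. S r \<omega> < c r \<and> c r' \<le> S r' \<omega>} \<omega> * ennreal (f r * \<zeta> (l1norm (X r' \<omega> - X r \<omega>))) * G r (X r \<omega>))"

lemma grid_cell_measurable [measurable]:
  assumes \<zeta>[measurable]: "\<zeta> \<in> borel_measurable borel" and G: "\<And>r. 0 < r \<Longrightarrow> G r \<in> borel_measurable borel"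
  shows "grid_cell f \<zeta> G n k \<in> borel_measurable M"
proof -
  have [measurable]: "X (Suc k / Suc n) \<in> borel_measurable M" "X (Suc (Suc k) / Suc n) \<in> borel_measurable M"
    by (intro random_vector; simp)+
  have [measurable]: "G (Suc k / Suc n) \<in> borel_measurable borel" by (rule G) simp
  show ?thesis unfolding grid_cell_def[abs_def] Let_def by measurable
qed

text \<open>The crossing event and the last increment involve only S(r) and an independent copy of
  X(h). Integrating the copy out leaves a function of S(r), so a test function of X(r) may be
  exchanged for its conditional expectation given S(r).\<close>

lemma grid_cell_cong_integral:
  assumes \<zeta>[measurable]: "\<zeta> \<in> borel_measurable borel"
    and G: "\<And>r. 0 < r \<Longrightarrow> G r \<in> borel_measurable borel" and G': "\<And>r. 0 < r \<Longrightarrow> G' r \<in> borel_measurable borel"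
    and eq: "\<And>r \<Phi>. 0 < r \<Longrightarrow> \<Phi> \<in> borel_measurable borel \<Longrightarrow>
      (\<integral>\<^sup>+\<omega>. \<Phi> (S r \<omega>) * G r (X r \<omega>) \<partial>M) = (\<integral>\<^sup>+\<omega>. \<Phi> (S r \<omega>) * G' r (X r \<omega>) \<partial>M)"
  shows "(\<integral>\<^sup>+\<omega>. grid_cell f \<zeta> G n k \<omega> \<partial>M) = (\<integral>\<^sup>+\<omega>. grid_cell f \<zeta> G' n k \<omega> \<partial>M)"
proof -
  define r where "r = real (Suc k) / real (Suc n)"
  define h where "h = 1 / real (Suc n)"
  have r: "0 < r" and h: "0 < h" by (simp_all add: r_def h_def)
  have rh: "real (Suc (Suc k)) / real (Suc n) = r + h"
    by (simp add: r_def h_def add_divide_distrib[symmetric])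
  have [measurable]: "X h \<in> borel_measurable M" using h by (intro random_vector) simp
  define \<Phi> where "\<Phi> s = (\<integral>\<^sup>+\<omega>. (if s < c r \<and> c (r + h) \<le> s + l1norm (X h \<omega>) then 1 else 0) *
      ennreal (f r * \<zeta> (l1norm (X h \<omega>))) \<partial>M)" for s
  have \<Phi>: "\<Phi> \<in> borel_measurable borel"
    unfolding \<Phi>_def[abs_def] by (rule borel_measurable_nn_integral) measurable
  have grid_cell: "(\<integral>\<^sup>+\<omega>. grid_cell f \<zeta> G n k \<omega> \<partial>M) = (\<integral>\<^sup>+\<omega>. \<Phi> (S r \<omega>) * G r (X r \<omega>) \<partial>M)"
    if G: "G r \<in> borel_measurable borel" for G :: "real \<Rightarrow> real ^ 'n \<Rightarrow> ennreal"
  proof -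
    note [measurable] = G
    define H where "H p = (if l1norm (fst p) < c r \<and> c (r + h) \<le> l1norm (fst p) + l1norm (snd p) then 1 else 0) *
        ennreal (f r * \<zeta> (l1norm (snd p))) * G r (fst p)" for p :: "(real ^ 'n) \<times> (real ^ 'n)"
    have H: "H \<in> borel_measurable borel" unfolding H_def[abs_def] borel_prod[symmetric] by measurable
    have "(\<integral>\<^sup>+\<omega>. grid_cell f \<zeta> G n k \<omega> \<partial>M) = (\<integral>\<^sup>+\<omega>. H (X r \<omega>, X (r + h) \<omega> - X r \<omega>) \<partial>M)"
    proof (rule nn_integral_cong_AE)
      show "AE \<omega> in M. grid_cell f \<zeta> G n k \<omega> = H (X r \<omega>, X (r + h) \<omega> - X r \<omega>)"
        using AE_increasing_path
      proof eventually_elim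
        case (elim \<omega>)
        interpret increasing_path "\<lambda>t. X t \<omega>" by fact
        have "S r \<omega> + l1norm (X (r + h) \<omega> - X r \<omega>) = S (r + h) \<omega>"
          using l1norm_diff[OF nonneg[of r] incr[of r "r + h"]] r h by simp
        then show ?case
          unfolding grid_cell_def Let_def rh r_def[symmetric] H_def fst_conv snd_conv by (auto simp: indicator_def)
      qed
    qed
    also have "\<dots> = (\<integral>\<^sup>+\<omega>. \<integral>\<^sup>+\<omega>'. H (X r \<omega>, X h \<omega>') \<partial>M \<partial>M)"
      using r h by (intro increment_nn_integral H) auto
    also have "\<dots> = (\<integral>\<^sup>+\<omega>. \<Phi> (S r \<omega>) * G r (X r \<omega>) \<partial>M)"
      unfolding H_def \<Phi>_def fst_conv snd_conv by (intro nn_integral_cong nn_integral_multc) measurable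
    finally show ?thesis .
  qed
  show ?thesis using grid_cell[of G, OF G[OF r]] grid_cell[of G', OF G'[OF r]] eq[OF r \<Phi>] by simp
qed

text \<open>Touching the boundary is passage, so only the cell that contains the passage time
  contributes. Index 1, the cell adjacent to time 0, is left out.\<close>

lemma grid_cell_sum:
  assumes path: "increasing_path (\<lambda>t. X t \<omega>)" and \<omega>: "\<omega> \<in> space M"
  shows "(\<Sum>k. grid_cell f \<zeta> G n k \<omega>) = (if \<omega> \<in> E \<and> 2 \<le> grid_index n (\<tau> \<omega>)
    then ennreal (f (grid_lo n (\<tau> \<omega>)) * \<zeta> (l1norm (X (grid_hi n (\<tau> \<omega>)) \<omega> - X (grid_lo n (\<tau> \<omega>)) \<omega>))) *
      G (grid_lo n (\<tau> \<omega>)) (X (grid_lo n (\<tau> \<omega>)) \<omega>) else 0)"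
proof -
  have iff: "S (Suc k / Suc n) \<omega> < c (Suc k / Suc n) \<and> c (Suc (Suc k) / Suc n) \<le> S (Suc (Suc k) / Suc n) \<omega> \<longleftrightarrow>
      \<omega> \<in> E \<and> grid_index n (\<tau> \<omega>) = Suc (Suc k)" for k
  proof -
    define r r' where "r = real (Suc k) / real (Suc n)" and "r' = real (Suc (Suc k)) / real (Suc n)"
    have r: "0 < r" "0 < r'" by (simp_all add: r_def r'_def)
    have le: "first_passage (norm_proc X) c \<omega> \<le> ereal s \<longleftrightarrow> c s \<le> S s \<omega>" if "0 < s" for s
      using increasing_path.passage_le_iff[OF path cont anti that] by (simp add: first_passage_eq[of X \<omega>, OF path])
    have "S r \<omega> < c r \<and> c r' \<le> S r' \<omega> \<longleftrightarrow>
        ereal r < first_passage (norm_proc X) c \<omega> \<and> first_passage (norm_proc X) c \<omega> \<le> ereal r'"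
      using le[OF r(1)] le[OF r(2)] by (auto simp: not_le[symmetric])
    also have "\<dots> \<longleftrightarrow> \<omega> \<in> E \<and> r < \<tau> \<omega> \<and> \<tau> \<omega> \<le> r'"
    proof
      assume a: "ereal r < first_passage (norm_proc X) c \<omega> \<and> first_passage (norm_proc X) c \<omega> \<le> ereal r'"
      then have "0 < first_passage (norm_proc X) c \<omega>" using r(1) by (auto intro: less_trans[of 0 "ereal r"])
      moreover have "first_passage (norm_proc X) c \<omega> < \<infinity>" using a by (auto intro: le_less_trans[of _ "ereal r'"])
      ultimately have "\<omega> \<in> E" using \<omega> by (simp add: passes_def)
      then show "\<omega> \<in> E \<and> r < \<tau> \<omega> \<and> \<tau> \<omega> \<le> r'" using a passesD(3) by fastforce
    next
      assume "\<omega> \<in> E \<and> r < \<tau> \<omega> \<and> \<tau> \<omega> \<le> r'"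
      then show "ereal r < first_passage (norm_proc X) c \<omega> \<and> first_passage (norm_proc X) c \<omega> \<le> ereal r'"
        using passesD(3)[of \<omega> M X c] by simp
    qed
    finally show ?thesis unfolding r_def r'_def grid_index_eq_Suc .
  qed
  show ?thesis
  proof (cases "\<omega> \<in> E \<and> 2 \<le> grid_index n (\<tau> \<omega>)")
    case True
    then obtain k where k: "grid_index n (\<tau> \<omega>) = Suc (Suc k)"
      using le_Suc_ex[of 2 "grid_index n (\<tau> \<omega>)"] by auto
    have "(\<Sum>j. grid_cell f \<zeta> G n j \<omega>) = (\<Sum>j\<in>{k}. grid_cell f \<zeta> G n j \<omega>)"
      by (rule suminf_finite) (use iff k in \<open>auto simp: grid_cell_def Let_def indicator_def\<close>)
    also have "\<dots> = grid_cell f \<zeta> G n k \<omega>" by simp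
    also have "\<dots> = ennreal (f (Suc k / Suc n) * \<zeta> (l1norm (X (Suc (Suc k) / Suc n) \<omega> - X (Suc k / Suc n) \<omega>))) *
        G (Suc k / Suc n) (X (Suc k / Suc n) \<omega>)"
      using iff[of k] True k by (simp add: grid_cell_def Let_def del: of_nat_Suc)
    finally show ?thesis using True by (simp add: grid_lo_def grid_hi_def k del: of_nat_Suc)
  next
    case False
    then have "grid_cell f \<zeta> G n k \<omega> = 0" for k using iff[of k] by (auto simp: grid_cell_def Let_def indicator_def)
    then show ?thesis using False by auto
  qed
qed

lemma grid_cell_sum_tendsto:
  assumes path: "increasing_path (\<lambda>t. X t \<omega>)" and \<omega>: "\<omega> \<in> E"
    and f: "continuous_on UNIV f" and \<zeta>: "continuous_on UNIV \<zeta>"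
    and G: "(\<lambda>n. G (grid_lo n (\<tau> \<omega>)) (X (grid_lo n (\<tau> \<omega>)) \<omega>)) \<longlonglongrightarrow> g"
    and fin: "g \<noteq> \<infinity>"
  shows "(\<lambda>n. \<Sum>k. grid_cell f \<zeta> G n k \<omega>) \<longlonglongrightarrow> ennreal (f (\<tau> \<omega>) * \<zeta> (l1norm (at0 \<omega> - pre0 \<omega>))) * g"
proof -
  interpret increasing_path "\<lambda>t. X t \<omega>" by fact
  note T = passesD(1,2)[OF \<omega>]
  \<comment> \<open>As the passage time is positive, it eventually leaves the excluded first
    cell.\<close>
  have "\<forall>\<^sub>F n in sequentially. 0 < grid_lo n (\<tau> \<omega>)" by (rule order_tendstoD(1)[OF grid_lo_tendsto[OF T(2)] T(2)])
  then have ev: "\<forall>\<^sub>F n in sequentially. (\<Sum>k. grid_cell f \<zeta> G n k \<omega>) =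
      ennreal (f (grid_lo n (\<tau> \<omega>)) * \<zeta> (l1norm (X (grid_hi n (\<tau> \<omega>)) \<omega> - X (grid_lo n (\<tau> \<omega>)) \<omega>))) *
      G (grid_lo n (\<tau> \<omega>)) (X (grid_lo n (\<tau> \<omega>)) \<omega>)"
  proof eventually_elim
    case (elim n)
    then have "2 \<le> grid_index n (\<tau> \<omega>)" by (auto simp: grid_lo_def zero_less_divide_iff)
    then show ?case using \<omega> by (simp add: grid_cell_sum[OF path T(1)])
  qed
  have lo: "(\<lambda>n. X (grid_lo n (\<tau> \<omega>)) \<omega>) \<longlonglongrightarrow> pre0 \<omega>"
    using tendsto_grid_lo[OF left_limit[OF T(2)] T(2)] T(2) by (simp add: pre0_def)
  have hi: "(\<lambda>n. X (grid_hi n (\<tau> \<omega>)) \<omega>) \<longlonglongrightarrow> at0 \<omega>"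
    using tendsto_grid_hi[OF right_cts T(2)] T(2) by (simp add: at0_def)
  have "(\<lambda>n. f (grid_lo n (\<tau> \<omega>))) \<longlonglongrightarrow> f (\<tau> \<omega>)"
    by (rule continuous_on_tendsto_compose[OF f grid_lo_tendsto[OF T(2)]]) auto
  moreover have "(\<lambda>n. \<zeta> (l1norm (X (grid_hi n (\<tau> \<omega>)) \<omega> - X (grid_lo n (\<tau> \<omega>)) \<omega>))) \<longlonglongrightarrow>
      \<zeta> (l1norm (at0 \<omega> - pre0 \<omega>))"
    by (rule continuous_on_tendsto_compose[OF \<zeta>]) (auto intro!: tendsto_l1norm tendsto_diff hi lo)
  ultimately have "(\<lambda>n. ennreal (f (grid_lo n (\<tau> \<omega>)) * \<zeta> (l1norm (X (grid_hi n (\<tau> \<omega>)) \<omega> - X (grid_lo n (\<tau> \<omega>)) \<omega>)))) \<longlonglongrightarrow>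
      ennreal (f (\<tau> \<omega>) * \<zeta> (l1norm (at0 \<omega> - pre0 \<omega>)))"
    by (intro tendsto_ennrealI tendsto_mult)
  then have "(\<lambda>n. ennreal (f (grid_lo n (\<tau> \<omega>)) * \<zeta> (l1norm (X (grid_hi n (\<tau> \<omega>)) \<omega> - X (grid_lo n (\<tau> \<omega>)) \<omega>))) *
      G (grid_lo n (\<tau> \<omega>)) (X (grid_lo n (\<tau> \<omega>)) \<omega>)) \<longlonglongrightarrow> ennreal (f (\<tau> \<omega>) * \<zeta> (l1norm (at0 \<omega> - pre0 \<omega>))) * g"
    using G by (rule tendsto_mult_ennreal) (use fin in auto)
  then show ?thesis using ev by (rule tendsto_cong[THEN iffD2, rotated])
qed

text \<open>Dominated convergence with bound 1. The set A allows for test functions G that converge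
  on part of \<open>E\<close> only.\<close>

lemma grid_cell_sum_integral_tendsto:
  assumes f: "continuous_on UNIV f" "\<And>x. f x \<in> {0..1}" and \<zeta>: "continuous_on UNIV \<zeta>" "\<And>x. \<zeta> x \<in> {0..1}"
    and Gm: "\<And>r. 0 < r \<Longrightarrow> G r \<in> borel_measurable borel" and G1: "\<And>r u. 0 < r \<Longrightarrow> G r u \<le> 1"
    and A[measurable]: "A \<in> sets M" "A \<subseteq> E" and g[measurable]: "g \<in> borel_measurable M" and g1: "\<And>\<omega>. g \<omega> \<le> 1"
    and lim: "AE \<omega> in M. \<omega> \<in> A \<longrightarrow> (\<lambda>n. G (grid_lo n (\<tau> \<omega>)) (X (grid_lo n (\<tau> \<omega>)) \<omega>)) \<longlonglongrightarrow> g \<omega>"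
  shows "(\<lambda>n. \<integral>\<^sup>+\<omega>. (\<Sum>k. grid_cell f \<zeta> G n k \<omega>) * indicator A \<omega> \<partial>M) \<longlonglongrightarrow>
    (\<integral>\<^sup>+\<omega>. ennreal (f (\<tau> \<omega>) * \<zeta> (l1norm (at0 \<omega> - pre0 \<omega>))) * g \<omega> * indicator A \<omega> \<partial>M)"
proof (rule nn_integral_dominated_convergence[where w="\<lambda>_. 1"])
  have [measurable]: "f \<in> borel_measurable borel" "\<zeta> \<in> borel_measurable borel"
    using f(1) \<zeta>(1) by (auto intro: borel_measurable_continuous_onI)
  have [measurable]: "grid_cell f \<zeta> G n k \<in> borel_measurable M" for n k by (rule grid_cell_measurable) (auto intro: Gm)
  show "(\<lambda>\<omega>. (\<Sum>k. grid_cell f \<zeta> G n k \<omega>) * indicator A \<omega>) \<in> borel_measurable M" for n by measurable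
  show "(\<lambda>\<omega>. ennreal (f (\<tau> \<omega>) * \<zeta> (l1norm (at0 \<omega> - pre0 \<omega>))) * g \<omega> * indicator A \<omega>) \<in> borel_measurable M"
    by measurable
  show "(\<integral>\<^sup>+\<omega>. 1 \<partial>M) < \<infinity>" by (simp add: emeasure_space_1)
  show "AE \<omega> in M. (\<Sum>k. grid_cell f \<zeta> G n k \<omega>) * indicator A \<omega> \<le> 1" for n
    using AE_increasing_path AE_space
  proof eventually_elim
    case (elim \<omega>)
    have "(\<Sum>k. grid_cell f \<zeta> G n k \<omega>) \<le> 1"
    proof (cases "\<omega> \<in> E \<and> 2 \<le> grid_index n (\<tau> \<omega>)")
      case True
      then have lo: "0 < grid_lo n (\<tau> \<omega>)" by (simp add: grid_lo_def)
      have "f a * \<zeta> b \<le> 1" for a b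
        using f(2)[of a] \<zeta>(2)[of b] by (intro mult_le_one) auto
      then have "ennreal (f a * \<zeta> b) * G (grid_lo n (\<tau> \<omega>)) u \<le> 1 * 1" for a b u
        by (intro mult_mono G1[OF lo]) (auto simp: ennreal_le_1)
      then show ?thesis using True by (simp add: grid_cell_sum[OF elim])
    next
      case False
      then show ?thesis by (simp only: grid_cell_sum[OF elim] if_False) simp
    qed
    then show ?case by (simp add: indicator_def)
  qed
  show "AE \<omega> in M. (\<lambda>n. (\<Sum>k. grid_cell f \<zeta> G n k \<omega>) * indicator A \<omega>) \<longlonglongrightarrow>
      ennreal (f (\<tau> \<omega>) * \<zeta> (l1norm (at0 \<omega> - pre0 \<omega>))) * g \<omega> * indicator A \<omega>"
    using AE_increasing_path lim
  proof eventually_elim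
    case (elim \<omega>)
    show ?case
    proof (cases "\<omega> \<in> A")
      case True
      have "g \<omega> \<noteq> \<infinity>" using g1[of \<omega>] by (auto simp: top_unique)
      then show ?thesis using grid_cell_sum_tendsto[OF elim(1) subsetD[OF A(2) True] f(1) \<zeta>(1)] elim(2) True by simp
    qed simp
  qed
qed measurable

text \<open>While creeping, S at \<open>grid_lo\<close> stays strictly below S(tau-) = c(tau) and
  tends to it, and \<open>grid_lo\<close> tends to tau from strictly below: this is the mode of
  approach in \<open>cont_along\<close>.\<close>

lemma cont_along_kernel_limit:
  assumes K: "cond_family M X K" and ca: "cont_along M X c K"
    and g: "continuous_on UNIV g" "\<And>x :: real ^ 'n. g x \<in> {0..1}"
  shows "AE \<omega> in M. \<omega> \<in> creep \<longrightarrow>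
    (\<lambda>n. \<integral>\<^sup>+u. ennreal (g u) \<partial>K (grid_lo n (\<tau> \<omega>)) (S (grid_lo n (\<tau> \<omega>)) \<omega>)) \<longlonglongrightarrow>
      (\<integral>\<^sup>+u. ennreal (g u) \<partial>kernel_ext K (\<tau> \<omega>, c_ext (\<tau> \<omega>)))"
proof -
  have [measurable]: "g \<in> borel_measurable borel" using g(1) by (rule borel_measurable_continuous_onI)
  have conv: "(\<integral>\<^sup>+u. ennreal (g u) \<partial>K r s) = ennreal (\<integral>u. g u \<partial>K r s)" if "0 < r" for r s
  proof -
    interpret Kp: prob_space "K r s" by (rule kernel_prob[OF K that])
    note [measurable_cong] = kernel_prob(2)[OF K that, of s]
    have "integrable (K r s) g"
      by (rule Kp.integrable_const_bound[where B=1]) (use g(2) in auto)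
    then show ?thesis using g(2) by (intro nn_integral_eq_integral) auto
  qed
  have "bounded (range g)" by (rule boundedI[of _ 1]) (use g(2) in auto)
  then have "AE t in creep_law M X c.
      ((\<lambda>(r, y). \<integral>u. g u \<partial>K r y) \<longlongrightarrow> (\<integral>u. g u \<partial>K t (c t))) (at (t, c t) within ({0<..<t} \<times> {..<c t}))"
    using ca g(1) unfolding cont_along_def by (auto elim!: eventually_mono)
  then have "AE \<omega> in restrict_space M creep.
      ((\<lambda>(r, y). \<integral>u. g u \<partial>K r y) \<longlongrightarrow> (\<integral>u. g u \<partial>K (\<tau> \<omega>) (c (\<tau> \<omega>)))) (at (\<tau> \<omega>, c (\<tau> \<omega>)) within ({0<..<\<tau> \<omega>} \<times> {..<c (\<tau> \<omega>)}))"
    unfolding creep_law_def creep_def[symmetric]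
    by (rule AE_distrD[rotated]) (auto intro: measurable_restrict_space1)
  then have "AE \<omega> in M. \<omega> \<in> creep \<longrightarrow>
      ((\<lambda>(r, y). \<integral>u. g u \<partial>K r y) \<longlongrightarrow> (\<integral>u. g u \<partial>K (\<tau> \<omega>) (c (\<tau> \<omega>)))) (at (\<tau> \<omega>, c (\<tau> \<omega>)) within ({0<..<\<tau> \<omega>} \<times> {..<c (\<tau> \<omega>)}))"
    by (subst (asm) AE_restrict_space_iff) auto
  then show ?thesis using AE_increasing_path AE_creep
  proof eventually_elim
    case (elim \<omega>)
    show ?case
    proof
      assume cr: "\<omega> \<in> creep"
      interpret increasing_path "\<lambda>t. X t \<omega>" by fact
      have e: "\<omega> \<in> E" and j: "jmp \<omega> = 0" using elim(3) cr by auto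
      define T where "T = \<tau> \<omega>"
      have T: "0 < T" using passesD(2)[OF e] by (simp add: T_def)
      have cT: "l1norm (left_lim (\<lambda>r. X r \<omega>) T) = c T"
        using path_at_passage(5)[OF elim(2) e] cr j by (simp add: creep_def pre_X_def T_def)
      have lo0: "\<forall>\<^sub>F n in sequentially. 0 < grid_lo n T" by (rule order_tendstoD(1)[OF grid_lo_tendsto[OF T] T])
      have "(\<lambda>n. (grid_lo n T, S (grid_lo n T) \<omega>)) \<longlonglongrightarrow> (T, c T)"
        unfolding cT[symmetric] by (intro tendsto_Pair grid_lo_tendsto[OF T] tendsto_grid_lo[OF tendsto_l1norm T] left_limit[OF T])
      moreover have "\<forall>\<^sub>F n in sequentially. (grid_lo n T, S (grid_lo n T) \<omega>) \<in> {0<..<T} \<times> {..<c T} \<and>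
          (grid_lo n T, S (grid_lo n T) \<omega>) \<noteq> (T, c T)"
        using lo0
      proof eventually_elim
        case (elim n)
        then show ?case using grid_bounds(2)[OF T, of n] l1norm_left_lim_strict[of "grid_lo n T" T] cT by auto
      qed
      ultimately have fl: "filterlim (\<lambda>n. (grid_lo n T, S (grid_lo n T) \<omega>)) (at (T, c T) within ({0<..<T} \<times> {..<c T})) sequentially"
        by (simp add: filterlim_at)
      have "((\<lambda>(r, y). \<integral>u. g u \<partial>K r y) \<longlongrightarrow> (\<integral>u. g u \<partial>K T (c T))) (at (T, c T) within ({0<..<T} \<times> {..<c T}))"
        using elim(1) cr by (simp add: T_def)
      from filterlim_compose[OF this fl]
      have "(\<lambda>n. \<integral>u. g u \<partial>K (grid_lo n T) (S (grid_lo n T) \<omega>)) \<longlonglongrightarrow> (\<integral>u. g u \<partial>K T (c T))" by simp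
      then have "(\<lambda>n. ennreal (\<integral>u. g u \<partial>K (grid_lo n T) (S (grid_lo n T) \<omega>))) \<longlonglongrightarrow> ennreal (\<integral>u. g u \<partial>K T (c T))"
        by (rule tendsto_ennrealI)
      moreover have "\<forall>\<^sub>F n in sequentially. ennreal (\<integral>u. g u \<partial>K (grid_lo n T) (S (grid_lo n T) \<omega>)) =
          (\<integral>\<^sup>+u. ennreal (g u) \<partial>K (grid_lo n T) (S (grid_lo n T) \<omega>))"
        using lo0 by eventually_elim (simp add: conv)
      ultimately have "(\<lambda>n. \<integral>\<^sup>+u. ennreal (g u) \<partial>K (grid_lo n T) (S (grid_lo n T) \<omega>)) \<longlonglongrightarrow> ennreal (\<integral>u. g u \<partial>K T (c T))"
        by (rule Lim_transform_eventually)
      then show "(\<lambda>n. \<integral>\<^sup>+u. ennreal (g u) \<partial>K (grid_lo n (\<tau> \<omega>)) (S (grid_lo n (\<tau> \<omega>)) \<omega>)) \<longlonglongrightarrow>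
          (\<integral>\<^sup>+u. ennreal (g u) \<partial>kernel_ext K (\<tau> \<omega>, c_ext (\<tau> \<omega>)))"
        using T by (simp add: T_def c_ext_def conv)
    qed
  qed
qed

text \<open>Away from the creeping event the kernels need not converge; the cut-off \<open>\<zeta>\<close> of the last grid
  increment removes the jumps larger than \<open>1 / Suc m\<close>, and the rest vanishes as \<open>m\<close> tends to infinity.\<close>

lemma creep_kernel_identity:
  assumes K: "cond_family M X K" and ca: "cont_along M X c K"
    and f: "continuous_on UNIV f" "\<And>x. f x \<in> {0..1}" and g: "continuous_on UNIV g" "\<And>x. g x \<in> {0..1}"
  shows "(\<integral>\<^sup>+\<omega>. ennreal (f (\<tau> \<omega>)) * ennreal (g (pre0 \<omega>)) * indicator creep \<omega> \<partial>M) =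
    (\<integral>\<^sup>+\<omega>. ennreal (f (\<tau> \<omega>)) * (\<integral>\<^sup>+u. ennreal (g u) \<partial>kernel_ext K (\<tau> \<omega>, c_ext (\<tau> \<omega>))) * indicator creep \<omega> \<partial>M)"
    (is "?a = ?b")
proof -
  have [measurable]: "f \<in> borel_measurable borel" "g \<in> borel_measurable borel"
    using f(1) g(1) by (auto intro: borel_measurable_continuous_onI)
  \<comment> \<open>\<open>G1\<close> tests X itself, \<open>G2\<close> replaces the test by its
    conditional expectation given S.\<close>
  define G1 where "G1 r u = ennreal (g u)" for r :: real and u
  define G2 where "G2 r u = (\<integral>\<^sup>+u'. ennreal (g u') \<partial>kernel_ext K (r, l1norm u))" for r and u :: "real ^ 'n"
  define gk where "gk \<omega> = (\<integral>\<^sup>+u. ennreal (g u) \<partial>kernel_ext K (\<tau> \<omega>, c_ext (\<tau> \<omega>)))" for \<omega>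
  define \<zeta> where "\<zeta> m x = max 0 (1 - real (Suc m) * \<bar>x\<bar>)" for m :: nat and x :: real
  have \<zeta>: "continuous_on UNIV (\<zeta> m)" "\<zeta> m x \<in> {0..1}" for m x
    unfolding \<zeta>_def by (auto intro!: continuous_intros)
  have [measurable]: "\<zeta> m \<in> borel_measurable borel" for m by (rule borel_measurable_continuous_onI[OF \<zeta>(1)])
  have gi: "(\<lambda>N. \<integral>\<^sup>+u. ennreal (g u) \<partial>N) \<in> borel_measurable (subprob_algebra borel)"
    by (rule nn_integral_measurable_subprob_algebra) measurable
  note KS = measurable_prob_algebraD[OF kernel_ext_measurable[OF K]]
  have le1: "(\<integral>\<^sup>+u. ennreal (g u) \<partial>kernel_ext K p) \<le> 1" for p
  proof -
    interpret Kp: prob_space "kernel_ext K p"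
      using measurable_space[OF kernel_ext_measurable[OF K], of p] by (simp add: space_prob_algebra)
    have "(\<integral>\<^sup>+u. ennreal (g u) \<partial>kernel_ext K p) \<le> (\<integral>\<^sup>+u. 1 \<partial>kernel_ext K p)"
      using g(2) by (intro nn_integral_mono) (auto simp: ennreal_le_1)
    then show ?thesis by (simp add: Kp.emeasure_space_1)
  qed
  have G2m: "G2 r \<in> borel_measurable borel" for r
  proof -
    have [measurable]: "(\<lambda>u. (r, l1norm u)) \<in> (borel :: (real ^ 'n) measure) \<rightarrow>\<^sub>M borel"
      unfolding borel_prod[symmetric] by measurable
    show ?thesis unfolding G2_def[abs_def]
      by (rule measurable_compose[OF measurable_compose[OF _ KS] gi]) measurable
  qed
  have gkm[measurable]: "gk \<in> borel_measurable M"
    unfolding gk_def[abs_def]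
    by (rule measurable_compose[OF measurable_compose[OF tau_measurable measurable_prob_algebraD[OF kernel_along_measurable[OF K]]] gi])
  \<comment> \<open>Before the limit the exchange is exact on every cell, since only S at a fixed
    time is conditioned on.\<close>
  have swap: "(\<integral>\<^sup>+\<omega>. (\<Sum>k. grid_cell f (\<zeta> m) G1 n k \<omega>) \<partial>M) = (\<integral>\<^sup>+\<omega>. (\<Sum>k. grid_cell f (\<zeta> m) G2 n k \<omega>) \<partial>M)" for m n
  proof -
    have [measurable]: "grid_cell f (\<zeta> m) G1 n k \<in> borel_measurable M" "grid_cell f (\<zeta> m) G2 n k \<in> borel_measurable M" for k
      by (rule grid_cell_measurable; simp add: G1_def[abs_def] G2m)+
    have "(\<integral>\<^sup>+\<omega>. grid_cell f (\<zeta> m) G1 n k \<omega> \<partial>M) = (\<integral>\<^sup>+\<omega>. grid_cell f (\<zeta> m) G2 n k \<omega> \<partial>M)" for k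
    proof (rule grid_cell_cong_integral)
      fix r :: real and \<Phi> :: "real \<Rightarrow> ennreal" assume r: "0 < r" and [measurable]: "\<Phi> \<in> borel_measurable borel"
      have F: "(\<lambda>p. \<Phi> (fst p) * ennreal (g (snd p))) \<in> borel_measurable borel"
        unfolding borel_prod[symmetric] by measurable
      have "(\<integral>\<^sup>+\<omega>. \<Phi> (S r \<omega>) * G1 r (X r \<omega>) \<partial>M) = (\<integral>\<^sup>+\<omega>. \<integral>\<^sup>+u. \<Phi> (S r \<omega>) * ennreal (g u) \<partial>K r (S r \<omega>) \<partial>M)"
        using cond_family_nn_integral[OF K r F] by (simp add: G1_def)
      also have "\<dots> = (\<integral>\<^sup>+\<omega>. \<Phi> (S r \<omega>) * G2 r (X r \<omega>) \<partial>M)"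
      proof (rule nn_integral_cong)
        fix \<omega>
        note [measurable_cong] = kernel_prob(2)[OF K r, of "S r \<omega>"]
        have "(\<lambda>u. ennreal (g u)) \<in> borel_measurable (K r (S r \<omega>))" by measurable
        then show "(\<integral>\<^sup>+u. \<Phi> (S r \<omega>) * ennreal (g u) \<partial>K r (S r \<omega>)) = \<Phi> (S r \<omega>) * G2 r (X r \<omega>)"
          using r by (simp add: nn_integral_cmult G2_def)
      qed
      finally show "(\<integral>\<^sup>+\<omega>. \<Phi> (S r \<omega>) * G1 r (X r \<omega>) \<partial>M) = (\<integral>\<^sup>+\<omega>. \<Phi> (S r \<omega>) * G2 r (X r \<omega>) \<partial>M)" .
    qed (auto simp: G1_def[abs_def] G2m)
    then show ?thesis by (simp add: nn_integral_suminf)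
  qed
  \<comment> \<open>\<open>R m\<close> is what the cut-off leaves of the passages by a jump, and
    \<open>A m\<close> is the limit of the sums with \<open>G1\<close>. Both \<open>?a\<close> and
    \<open>?b\<close> turn out to be at most \<open>A m\<close>, and at least \<open>A m\<close> up
    to \<open>R m\<close>.\<close>
  define R where "R m = (\<integral>\<^sup>+\<omega>. ennreal (f (\<tau> \<omega>) * \<zeta> m (l1norm (at0 \<omega> - pre0 \<omega>))) * 1 * indicator (E - creep) \<omega> \<partial>M)" for m
  define A where "A m = (\<integral>\<^sup>+\<omega>. ennreal (f (\<tau> \<omega>) * \<zeta> m (l1norm (at0 \<omega> - pre0 \<omega>))) * ennreal (g (pre0 \<omega>)) * indicator E \<omega> \<partial>M)" for m
  have \<zeta>0: "AE \<omega> in M. \<omega> \<in> creep \<longrightarrow> (\<forall>m. \<zeta> m (l1norm (at0 \<omega> - pre0 \<omega>)) = 1)"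
    using AE_creep by eventually_elim (auto simp: on_passes \<zeta>_def)
  have limA: "(\<lambda>n. \<integral>\<^sup>+\<omega>. (\<Sum>k. grid_cell f (\<zeta> m) G1 n k \<omega>) * indicator E \<omega> \<partial>M) \<longlonglongrightarrow> A m" for m
    unfolding A_def
  proof (rule grid_cell_sum_integral_tendsto[OF f \<zeta>])
    show "AE \<omega> in M. \<omega> \<in> E \<longrightarrow> (\<lambda>n. G1 (grid_lo n (\<tau> \<omega>)) (X (grid_lo n (\<tau> \<omega>)) \<omega>)) \<longlonglongrightarrow> ennreal (g (pre0 \<omega>))"
      using AE_increasing_path
    proof eventually_elim
      case (elim \<omega>)
      interpret increasing_path "\<lambda>t. X t \<omega>" by fact
      show ?case
      proof
        assume e: "\<omega> \<in> E"
        note T = passesD(1,2)[OF e]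
        have "(\<lambda>n. X (grid_lo n (\<tau> \<omega>)) \<omega>) \<longlonglongrightarrow> pre0 \<omega>"
          using tendsto_grid_lo[OF left_limit[OF T(2)] T(2)] T(2) by (simp add: pre0_def)
        then have "(\<lambda>n. g (X (grid_lo n (\<tau> \<omega>)) \<omega>)) \<longlonglongrightarrow> g (pre0 \<omega>)"
          by (rule continuous_on_tendsto_compose[OF g(1)]) auto
        then show "(\<lambda>n. G1 (grid_lo n (\<tau> \<omega>)) (X (grid_lo n (\<tau> \<omega>)) \<omega>)) \<longlonglongrightarrow> ennreal (g (pre0 \<omega>))"
          unfolding G1_def by (rule tendsto_ennrealI)
      qed
    qed
  qed (use g(2) in \<open>auto simp: G1_def[abs_def] ennreal_le_1\<close>)
  have sumE: "(\<integral>\<^sup>+\<omega>. (\<Sum>k. grid_cell f (\<zeta> m) G n k \<omega>) * indicator E \<omega> \<partial>M) = (\<integral>\<^sup>+\<omega>. (\<Sum>k. grid_cell f (\<zeta> m) G n k \<omega>) \<partial>M)" for m n G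
  proof (rule nn_integral_cong_AE)
    show "AE \<omega> in M. (\<Sum>k. grid_cell f (\<zeta> m) G n k \<omega>) * indicator E \<omega> = (\<Sum>k. grid_cell f (\<zeta> m) G n k \<omega>)"
      using AE_increasing_path AE_space
    proof eventually_elim
      case (elim \<omega>)
      show ?case unfolding grid_cell_sum[OF elim] by (simp add: indicator_def)
    qed
  qed
  have limC: "(\<lambda>n. \<integral>\<^sup>+\<omega>. (\<Sum>k. grid_cell f (\<zeta> m) G2 n k \<omega>) * indicator creep \<omega> \<partial>M) \<longlonglongrightarrow> ?b" for m
  proof -
    have "(\<lambda>n. \<integral>\<^sup>+\<omega>. (\<Sum>k. grid_cell f (\<zeta> m) G2 n k \<omega>) * indicator creep \<omega> \<partial>M) \<longlonglongrightarrow>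
      (\<integral>\<^sup>+\<omega>. ennreal (f (\<tau> \<omega>) * \<zeta> m (l1norm (at0 \<omega> - pre0 \<omega>))) * gk \<omega> * indicator creep \<omega> \<partial>M)"
    proof (rule grid_cell_sum_integral_tendsto[OF f \<zeta>])
      show "AE \<omega> in M. \<omega> \<in> creep \<longrightarrow> (\<lambda>n. G2 (grid_lo n (\<tau> \<omega>)) (X (grid_lo n (\<tau> \<omega>)) \<omega>)) \<longlonglongrightarrow> gk \<omega>"
        using cont_along_kernel_limit[OF K ca g]
      proof eventually_elim
        case (elim \<omega>)
        show ?case
        proof
          assume cr: "\<omega> \<in> creep"
          have T: "0 < \<tau> \<omega>" using passesD(2)[OF creepD(1)[OF cr]] .
          have "\<forall>\<^sub>F n in sequentially. 0 < grid_lo n (\<tau> \<omega>)" by (rule order_tendstoD(1)[OF grid_lo_tendsto[OF T] T])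
          then have "\<forall>\<^sub>F n in sequentially. (\<integral>\<^sup>+u. ennreal (g u) \<partial>K (grid_lo n (\<tau> \<omega>)) (S (grid_lo n (\<tau> \<omega>)) \<omega>)) =
              G2 (grid_lo n (\<tau> \<omega>)) (X (grid_lo n (\<tau> \<omega>)) \<omega>)"
            by eventually_elim (simp add: G2_def)
          then show "(\<lambda>n. G2 (grid_lo n (\<tau> \<omega>)) (X (grid_lo n (\<tau> \<omega>)) \<omega>)) \<longlonglongrightarrow> gk \<omega>"
            using elim cr unfolding gk_def by (auto intro: Lim_transform_eventually)
        qed
      qed
      show "creep \<subseteq> E" using creepD by blast
      show "G2 r u \<le> 1" "gk \<omega> \<le> 1" for r u \<omega> unfolding G2_def gk_def by (rule le1)+
    qed (simp_all add: G2m)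
    also have "(\<integral>\<^sup>+\<omega>. ennreal (f (\<tau> \<omega>) * \<zeta> m (l1norm (at0 \<omega> - pre0 \<omega>))) * gk \<omega> * indicator creep \<omega> \<partial>M) = ?b"
      by (rule nn_integral_cong_AE) (use \<zeta>0 in eventually_elim, auto simp: indicator_def gk_def)
    finally show ?thesis .
  qed
  have limN: "(\<lambda>n. \<integral>\<^sup>+\<omega>. (\<Sum>k. grid_cell f (\<zeta> m) (\<lambda>_ _. 1) n k \<omega>) * indicator (E - creep) \<omega> \<partial>M) \<longlonglongrightarrow> R m" for m
    unfolding R_def by (rule grid_cell_sum_integral_tendsto[OF f \<zeta>]) auto
  \<comment> \<open>On creeping the kernels converge; on the other passages \<open>G2\<close> is
    bounded by 1 and the cut-off yields \<open>R m\<close>.\<close>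
  have up: "A m \<le> ?b + R m" for m
  proof (rule LIMSEQ_le[OF limA tendsto_add[OF limC[of m] limN[of m]]], intro exI[of _ 0] allI impI)
    fix n
    have [measurable]: "grid_cell f (\<zeta> m) G2 n k \<in> borel_measurable M" "grid_cell f (\<zeta> m) (\<lambda>_ _. 1) n k \<in> borel_measurable M" for k
      by (rule grid_cell_measurable; simp add: G2m)+
    have "(\<integral>\<^sup>+\<omega>. (\<Sum>k. grid_cell f (\<zeta> m) G1 n k \<omega>) * indicator E \<omega> \<partial>M) = (\<integral>\<^sup>+\<omega>. (\<Sum>k. grid_cell f (\<zeta> m) G2 n k \<omega>) * indicator E \<omega> \<partial>M)"
      by (simp add: sumE swap)
    also have "\<dots> \<le> (\<integral>\<^sup>+\<omega>. (\<Sum>k. grid_cell f (\<zeta> m) G2 n k \<omega>) * indicator creep \<omega> +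
        (\<Sum>k. grid_cell f (\<zeta> m) (\<lambda>_ _. 1) n k \<omega>) * indicator (E - creep) \<omega> \<partial>M)"
    proof (rule nn_integral_mono)
      fix \<omega>
      have "grid_cell f (\<zeta> m) G2 n k \<omega> \<le> grid_cell f (\<zeta> m) (\<lambda>_ _. 1) n k \<omega>" for k
        unfolding grid_cell_def Let_def by (intro mult_left_mono) (auto simp: G2_def le1 simp del: kernel_ext_eq)
      then have "(\<Sum>k. grid_cell f (\<zeta> m) G2 n k \<omega>) \<le> (\<Sum>k. grid_cell f (\<zeta> m) (\<lambda>_ _. 1) n k \<omega>)"
        by (intro suminf_le) auto
      then show "(\<Sum>k. grid_cell f (\<zeta> m) G2 n k \<omega>) * indicator E \<omega> \<le> (\<Sum>k. grid_cell f (\<zeta> m) G2 n k \<omega>) * indicator creep \<omega> +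
          (\<Sum>k. grid_cell f (\<zeta> m) (\<lambda>_ _. 1) n k \<omega>) * indicator (E - creep) \<omega>"
        by (auto simp: indicator_def)
    qed
    also have "\<dots> = (\<integral>\<^sup>+\<omega>. (\<Sum>k. grid_cell f (\<zeta> m) G2 n k \<omega>) * indicator creep \<omega> \<partial>M) +
        (\<integral>\<^sup>+\<omega>. (\<Sum>k. grid_cell f (\<zeta> m) (\<lambda>_ _. 1) n k \<omega>) * indicator (E - creep) \<omega> \<partial>M)"
      by (rule nn_integral_add) measurable
    finally show "(\<integral>\<^sup>+\<omega>. (\<Sum>k. grid_cell f (\<zeta> m) G1 n k \<omega>) * indicator E \<omega> \<partial>M) \<le> \<dots>" .
  qed
  \<comment> \<open>Dropping the passages by a jump can only decrease the sums.\<close>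
  have low: "?b \<le> A m" for m
  proof (rule LIMSEQ_le[OF limC limA[of m]], intro exI[of _ 0] allI impI)
    fix n
    have "(\<integral>\<^sup>+\<omega>. (\<Sum>k. grid_cell f (\<zeta> m) G2 n k \<omega>) * indicator creep \<omega> \<partial>M) \<le> (\<integral>\<^sup>+\<omega>. (\<Sum>k. grid_cell f (\<zeta> m) G2 n k \<omega>) \<partial>M)"
      by (intro nn_integral_mono) (simp add: indicator_def)
    then show "(\<integral>\<^sup>+\<omega>. (\<Sum>k. grid_cell f (\<zeta> m) G2 n k \<omega>) * indicator creep \<omega> \<partial>M) \<le> (\<integral>\<^sup>+\<omega>. (\<Sum>k. grid_cell f (\<zeta> m) G1 n k \<omega>) * indicator E \<omega> \<partial>M)"
      by (simp add: sumE swap)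
  qed
  have aA: "?a \<le> A m" for m
    unfolding A_def
    by (rule nn_integral_mono_AE) (use \<zeta>0 in eventually_elim, auto simp: indicator_def dest: creepD)
  have Aa: "A m \<le> ?a + R m" for m
  proof -
    have "A m \<le> (\<integral>\<^sup>+\<omega>. ennreal (f (\<tau> \<omega>)) * ennreal (g (pre0 \<omega>)) * indicator creep \<omega> +
        ennreal (f (\<tau> \<omega>) * \<zeta> m (l1norm (at0 \<omega> - pre0 \<omega>))) * 1 * indicator (E - creep) \<omega> \<partial>M)"
      unfolding A_def
    proof (rule nn_integral_mono_AE)
      show "AE \<omega> in M. ennreal (f (\<tau> \<omega>) * \<zeta> m (l1norm (at0 \<omega> - pre0 \<omega>))) * ennreal (g (pre0 \<omega>)) * indicator E \<omega> \<le>
          ennreal (f (\<tau> \<omega>)) * ennreal (g (pre0 \<omega>)) * indicator creep \<omega> +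
          ennreal (f (\<tau> \<omega>) * \<zeta> m (l1norm (at0 \<omega> - pre0 \<omega>))) * 1 * indicator (E - creep) \<omega>"
        using \<zeta>0
      proof eventually_elim
        case (elim \<omega>)
        have "ennreal (g (pre0 \<omega>)) \<le> 1" using g(2)[of "pre0 \<omega>"] by (simp add: ennreal_le_1)
        then have "ennreal (f (\<tau> \<omega>) * \<zeta> m (l1norm (at0 \<omega> - pre0 \<omega>))) * ennreal (g (pre0 \<omega>)) \<le>
            ennreal (f (\<tau> \<omega>) * \<zeta> m (l1norm (at0 \<omega> - pre0 \<omega>))) * 1" by (intro mult_left_mono) auto
        then show ?case using elim by (auto simp: indicator_def)
      qed
    qed
    also have "\<dots> = ?a + R m" unfolding R_def by (rule nn_integral_add) measurable
    finally show ?thesis .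
  qed
  \<comment> \<open>A fixed nonzero jump is cut off for all large m.\<close>
  have R0: "R \<longlonglongrightarrow> 0"
  proof -
    have "(\<lambda>m. R m) \<longlonglongrightarrow> (\<integral>\<^sup>+\<omega>. 0 \<partial>M)"
      unfolding R_def
    proof (rule nn_integral_dominated_convergence[where w="\<lambda>_. 1"])
      show "(\<integral>\<^sup>+\<omega>. 1 \<partial>M) < \<infinity>" by (simp add: emeasure_space_1)
      show "AE \<omega> in M. ennreal (f (\<tau> \<omega>) * \<zeta> m (l1norm (at0 \<omega> - pre0 \<omega>))) * 1 * indicator (E - creep) \<omega> \<le> 1" for m
      proof (rule AE_I2)
        fix \<omega>
        have "f (\<tau> \<omega>) * \<zeta> m (l1norm (at0 \<omega> - pre0 \<omega>)) \<le> 1"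
          using f(2)[of "\<tau> \<omega>"] \<zeta>(2)[of m "l1norm (at0 \<omega> - pre0 \<omega>)"] by (intro mult_le_one) auto
        then show "ennreal (f (\<tau> \<omega>) * \<zeta> m (l1norm (at0 \<omega> - pre0 \<omega>))) * 1 * indicator (E - creep) \<omega> \<le> 1"
          by (simp add: indicator_def ennreal_le_1)
      qed
      show "AE \<omega> in M. (\<lambda>m. ennreal (f (\<tau> \<omega>) * \<zeta> m (l1norm (at0 \<omega> - pre0 \<omega>))) * 1 * indicator (E - creep) \<omega>) \<longlonglongrightarrow> 0"
        using AE_creep
      proof eventually_elim
        case (elim \<omega>)
        show ?case
        proof (cases "\<omega> \<in> E - creep")
          case True
          then have j: "0 < l1norm (at0 \<omega> - pre0 \<omega>)" using elim by (simp add: on_passes l1norm_pos)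
          obtain N where N: "1 < real N * l1norm (at0 \<omega> - pre0 \<omega>)" using reals_Archimedean3[OF j] by blast
          have "\<zeta> m (l1norm (at0 \<omega> - pre0 \<omega>)) = 0" if "N \<le> m" for m
          proof -
            have "real N * l1norm (at0 \<omega> - pre0 \<omega>) \<le> real (Suc m) * l1norm (at0 \<omega> - pre0 \<omega>)"
              using that j by (intro mult_right_mono) auto
            then have "1 - real (Suc m) * l1norm (at0 \<omega> - pre0 \<omega>) \<le> 0" using N by linarith
            then show ?thesis using j by (simp add: \<zeta>_def del: of_nat_Suc)
          qed
          then have "\<forall>\<^sub>F m in sequentially. ennreal (f (\<tau> \<omega>) * \<zeta> m (l1norm (at0 \<omega> - pre0 \<omega>))) * 1 * indicator (E - creep) \<omega> = 0"
            by (intro eventually_sequentiallyI[of N]) simp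
          then show ?thesis by (rule tendsto_eventually)
        qed simp
      qed
    qed measurable
    then show ?thesis by simp
  qed
  show ?thesis
  proof (rule antisym)
    have "(\<lambda>m. ?b + R m) \<longlonglongrightarrow> ?b + 0" by (intro tendsto_add tendsto_const R0)
    then show "?a \<le> ?b" using order_trans[OF aA up] by (intro LIMSEQ_le_const[of "\<lambda>m. ?b + R m"]) auto
    have "(\<lambda>m. ?a + R m) \<longlonglongrightarrow> ?a + 0" by (intro tendsto_add tendsto_const R0)
    then show "?b \<le> ?a" using order_trans[OF low Aa] by (intro LIMSEQ_le_const[of "\<lambda>m. ?a + R m"]) auto
  qed
qed

text \<open>The law of the pair under creeping is compared with the creeping law of the time
  followed by the kernel \<open>K t (c t)\<close>; for product test functions the equality of
  integrals is the preceding kernel identity.\<close>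

lemma cont_along_disintegrates:
  assumes K: "cond_family M X K" and ca: "cont_along M X c K"
  shows "disintegrates_creep (\<lambda>t. K t (c t))"
proof -
  define \<kappa> where "\<kappa> t = kernel_ext K (t, c_ext t)" for t
  have \<kappa>: "\<kappa> \<in> borel \<rightarrow>\<^sub>M prob_algebra borel" unfolding \<kappa>_def[abs_def] by (rule kernel_along_measurable[OF K])
  note \<kappa>S = measurable_prob_algebraD[OF \<kappa>]
  have s\<kappa>[simp, measurable_cong]: "sets (\<kappa> t) = sets borel" for t
    using measurable_space[OF \<kappa>, of t] by (simp add: space_prob_algebra)
  have [simp]: "space (\<kappa> t) = UNIV" for t using sets_eq_imp_space_eq[OF s\<kappa>[of t]] by simp
  define J where "J t = distr (\<kappa> t) borel (Pair t)" for t
  have J: "J \<in> borel \<rightarrow>\<^sub>M subprob_algebra borel"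
    unfolding J_def[abs_def] by (rule measurable_distr2[OF _ \<kappa>S]) (simp add: borel_prod case_prod_beta')
  have J': "J \<in> creep_law M X c \<rightarrow>\<^sub>M subprob_algebra borel"
    using J by (simp add: creep_law_def cong: measurable_cong_sets)
  have Pr: "Pair t \<in> \<kappa> t' \<rightarrow>\<^sub>M borel" for t :: real and t'
  proof -
    have "Pair t \<in> (borel :: (real ^ 'n) measure) \<rightarrow>\<^sub>M borel" unfolding borel_prod[symmetric] by measurable
    then show ?thesis by (simp cong: measurable_cong_sets)
  qed
  define \<nu> where "\<nu> = creep_law M X c \<bind> J"
  have ne: "space (creep_law M X c) \<noteq> {}" by (simp add: creep_law_def)
  have "creep_joint_law = \<nu>"
  proof (rule finite_measure_eqI_continuous_prod[OF finite_creep_joint_law sets_creep_joint_law])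
    show "sets \<nu> = sets borel"
      unfolding \<nu>_def by (rule sets_bind[OF _ ne]) (simp add: J_def)
    fix f :: "real \<Rightarrow> real" and g :: "real ^ 'n \<Rightarrow> real"
    assume f: "continuous_on UNIV f" "\<And>x. 0 \<le> f x" "\<And>x. f x \<le> 1" and g: "continuous_on UNIV g" "\<And>x. 0 \<le> g x" "\<And>x. g x \<le> 1"
    have [measurable]: "f \<in> borel_measurable borel" "g \<in> borel_measurable borel"
      using f(1) g(1) by (auto intro: borel_measurable_continuous_onI)
    have F: "(\<lambda>z. ennreal (f (fst z)) * ennreal (g (snd z))) \<in> borel_measurable borel"
      unfolding borel_prod[symmetric] by measurable
    have "(\<integral>\<^sup>+z. ennreal (f (fst z)) * ennreal (g (snd z)) \<partial>\<nu>) =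
        (\<integral>\<^sup>+t. \<integral>\<^sup>+z. ennreal (f (fst z)) * ennreal (g (snd z)) \<partial>J t \<partial>creep_law M X c)"
      unfolding \<nu>_def by (rule nn_integral_bind[OF F J'])
    also have "\<dots> = (\<integral>\<^sup>+t. ennreal (f t) * (\<integral>\<^sup>+u. ennreal (g u) \<partial>\<kappa> t) \<partial>creep_law M X c)"
      unfolding J_def using F by (simp add: nn_integral_distr Pr nn_integral_cmult)
    also have "\<dots> = (\<integral>\<^sup>+\<omega>. ennreal (f (\<tau> \<omega>)) * (\<integral>\<^sup>+u. ennreal (g u) \<partial>\<kappa> (\<tau> \<omega>)) * indicator creep \<omega> \<partial>M)"
    proof (rule creep_law_nn_integral)
      have [measurable]: "(\<lambda>t. \<integral>\<^sup>+u. ennreal (g u) \<partial>\<kappa> t) \<in> borel_measurable borel"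
        by (rule measurable_compose[OF \<kappa>S nn_integral_measurable_subprob_algebra]) measurable
      show "(\<lambda>t. ennreal (f t) * (\<integral>\<^sup>+u. ennreal (g u) \<partial>\<kappa> t)) \<in> borel_measurable borel" by measurable
    qed
    also have "\<dots> = (\<integral>\<^sup>+\<omega>. ennreal (f (\<tau> \<omega>)) * ennreal (g (pre0 \<omega>)) * indicator creep \<omega> \<partial>M)"
      unfolding \<kappa>_def by (rule creep_kernel_identity[OF K ca, symmetric]) (use f g in auto)
    also have "\<dots> = (\<integral>\<^sup>+z. ennreal (f (fst z)) * ennreal (g (snd z)) \<partial>creep_joint_law)"
      by (subst creep_joint_law_nn_integral[OF F]) simp
    finally show "(\<integral>\<^sup>+z. ennreal (f (fst z)) * ennreal (g (snd z)) \<partial>creep_joint_law) =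
        (\<integral>\<^sup>+z. ennreal (f (fst z)) * ennreal (g (snd z)) \<partial>\<nu>)" by simp
  qed
  then show ?thesis
    unfolding disintegrates_creep_def
  proof (intro ballI)
    fix C :: "(real \<times> (real ^ 'n)) set" assume C: "C \<in> sets borel"
    assume "creep_joint_law = \<nu>"
    then have "emeasure creep_joint_law C = (\<integral>\<^sup>+t. emeasure (J t) C \<partial>creep_law M X c)"
      unfolding \<nu>_def by (simp add: emeasure_bind[OF ne J' C])
    also have "\<dots> = (\<integral>\<^sup>+t. emeasure (K t (c t)) {u. (t, u) \<in> C} \<partial>creep_law M X c)"
    proof (rule nn_integral_cong_AE)
      show "AE t in creep_law M X c. emeasure (J t) C = emeasure (K t (c t)) {u. (t, u) \<in> C}"
        using AE_creep_law_pos
      proof eventually_elim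
        case (elim t)
        have "emeasure (J t) C = emeasure (\<kappa> t) {u. (t, u) \<in> C}"
          unfolding J_def emeasure_distr[OF Pr C] by (simp add: vimage_def)
        also have "\<kappa> t = K t (c t)" using elim by (simp add: \<kappa>_def c_ext_def)
        finally show ?case .
      qed
    qed
    finally show "emeasure creep_joint_law C = (\<integral>\<^sup>+t. emeasure (K t (c t)) {u. (t, u) \<in> C} \<partial>creep_law M X c)" .
  qed
qed

end

subsection \<open>Conditioning on the sizes of the undershoot and of the jump\<close>

text \<open>Finite intersections of a countable base, the empty one giving the whole space.
  Countability lets kernels that agree almost everywhere on each generator agree on all generators
  off a single null set.\<close>

lemma countable_Int_stable_generator:
  obtains G :: "'a::second_countable_topology set set"
  where "countable G" "Int_stable G" "UNIV \<in> G" "sets borel = sigma_sets UNIV G"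
proof -
  obtain B :: "'a set set" where B: "countable B" "topological_basis B"
    using ex_countable_basis by blast
  define G where "G = Inter ` {F. finite F \<and> F \<subseteq> B}"
  have "B \<subseteq> G"
  proof
    fix b assume "b \<in> B"
    then show "b \<in> G" unfolding G_def by (intro image_eqI[of _ _ "{b}"]) auto
  qed
  have sB: "sets borel = sigma_sets UNIV B"
    unfolding borel_eq_countable_basis[OF B] by (rule sets_measure_of) simp
  show ?thesis
  proof (rule that)
    show "countable G" unfolding G_def using countable_Collect_finite_subset[OF B(1)] by (intro countable_image)
    show "UNIV \<in> G" unfolding G_def by (intro image_eqI[of _ _ "{}"]) auto
    show "Int_stable G"
    proof (rule Int_stableI)
      fix a b assume "a \<in> G" "b \<in> G"
      then obtain F F' where "finite F" "F \<subseteq> B" "a = \<Inter>F" "finite F'" "F' \<subseteq> B" "b = \<Inter>F'" by (auto simp: G_def)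
      then show "a \<inter> b \<in> G" unfolding G_def by (intro image_eqI[of _ _ "F \<union> F'"]) auto
    qed
    show "sets borel = sigma_sets UNIV G"
    proof (rule antisym)
      show "sets borel \<subseteq> sigma_sets UNIV G" unfolding sB by (rule sigma_sets_mono') fact
      have "G \<subseteq> sets borel"
      proof
        fix g assume "g \<in> G"
        then obtain F where F: "finite F" "F \<subseteq> B" "g = \<Inter>F" by (auto simp: G_def)
        then have "open g" using topological_basis_open[OF B(2)] by (auto intro!: open_Inter)
        then show "g \<in> sets borel" by simp
      qed
      then show "sigma_sets UNIV G \<subseteq> sets borel" using sets.sigma_sets_subset[of G borel] by simp
    qed
  qed
qed

context orthant_levy_process
begin

lemma emeasure_norm_levy_tail: "emeasure (norm_levy Pm) {a<..} = emeasure Pm {v. a < l1norm v}"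
  unfolding norm_levy_def by (subst emeasure_distr) (auto simp: vimage_def)

text \<open>Multiplication by the tail mass, finite for a > 0 and nonzero by assumption, clears the
  normalisation of \<open>nu\<close>.\<close>

lemma nu_nn_integral:
  assumes a: "0 < a" and nz: "emeasure (norm_levy Pm) {a<..} \<noteq> 0" and f[measurable]: "f \<in> borel_measurable borel"
  shows "(\<integral>\<^sup>+v. f v * indicator {a<..} (l1norm v) \<partial>Pm) = emeasure (norm_levy Pm) {a<..} * (\<integral>\<^sup>+v. f v \<partial>nu Pm a)"
proof -
  define m where "m = emeasure (norm_levy Pm) {a<..}"
  have m: "m \<noteq> 0" "m \<noteq> \<infinity>" using nz tail_finite[OF a] by (auto simp: m_def emeasure_norm_levy_tail)
  have "m * (\<integral>\<^sup>+v. f v \<partial>nu Pm a) = m * (\<integral>\<^sup>+v. indicator {v. a < l1norm v} v / m * f v \<partial>Pm)"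
    unfolding nu_def m_def by (subst nn_integral_density) auto
  also have "\<dots> = (\<integral>\<^sup>+v. m * (indicator {v. a < l1norm v} v / m * f v) \<partial>Pm)"
    by (rule nn_integral_cmult[symmetric]) measurable
  also have "\<dots> = (\<integral>\<^sup>+v. f v * indicator {a<..} (l1norm v) \<partial>Pm)"
  proof (rule nn_integral_cong)
    fix v :: "real ^ 'n"
    have "m / m = 1" using m by (simp add: less_top[symmetric])
    then show "m * (indicator {v. a < l1norm v} v / m * f v) = f v * indicator {a<..} (l1norm v)"
      by (auto simp: indicator_def ennreal_times_divide mult.assoc[symmetric])
  qed
  finally show ?thesis by (simp add: m_def)
qed

lemma finite_nu: assumes a: "0 < a" shows "finite_measure (nu Pm a)"
proof (rule finite_measureI)
  have s: "space (nu Pm a) = UNIV" "sets (nu Pm a) = sets borel" by (simp_all add: nu_def)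
  show "emeasure (nu Pm a) (space (nu Pm a)) \<noteq> \<infinity>"
  proof (cases "emeasure (norm_levy Pm) {a<..} = 0")
    case True
    \<comment> \<open>Here the density of \<open>nu\<close> is infinite on the tail, but the tail is
      a null set.\<close>
    have "emeasure Pm {v. a < l1norm v} = 0" using True by (simp add: emeasure_norm_levy_tail)
    then have "AE v in Pm. \<not> a < l1norm v"
      by (intro AE_I[of _ _ "{v. a < l1norm v}"]) auto
    then have "(\<integral>\<^sup>+v. indicator {v. a < l1norm v} v / emeasure (norm_levy Pm) {a<..} \<partial>Pm) = (\<integral>\<^sup>+v. 0 \<partial>Pm)"
      by (intro nn_integral_cong_AE) (auto elim!: eventually_mono)
    then show ?thesis unfolding s by (simp add: nu_def emeasure_density)
  next
    case False
    have "emeasure (norm_levy Pm) {a<..} * (\<integral>\<^sup>+v. 1 \<partial>nu Pm a) = (\<integral>\<^sup>+v. 1 * indicator {a<..} (l1norm v) \<partial>Pm)"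
      by (rule nu_nn_integral[OF a False, symmetric]) simp
    also have "\<dots> = (\<integral>\<^sup>+v. indicator {v. a < l1norm v} v \<partial>Pm)"
      by (rule nn_integral_cong) (auto simp: indicator_def)
    also have "\<dots> = emeasure Pm {v. a < l1norm v}" by (rule nn_integral_indicator) simp
    finally have "emeasure (norm_levy Pm) {a<..} * emeasure (nu Pm a) UNIV < \<infinity>"
      using tail_finite[OF a] s by simp
    then show ?thesis using False s by (auto simp: ennreal_mult_less_top)
  qed
qed

text \<open>If the tail beyond \<open>a\<close> is null, then \<open>nu Pm a\<close> is the zero measure and both sides vanish.\<close>

lemma levy_kernel_nn_integral:
  assumes a: "0 < a" and rc: "reg_cond_distr (nu Pm a) (space (nu Pm a)) l1norm (\<lambda>v. v) {a<..} \<kappa>"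
    and F[measurable]: "F \<in> borel_measurable borel"
  shows "(\<integral>\<^sup>+v. F (l1norm v, v) * indicator {a<..} (l1norm v) \<partial>Pm) =
    (\<integral>\<^sup>+v. (\<integral>\<^sup>+w. F (l1norm v, w) \<partial>\<kappa> (l1norm v)) * indicator {a<..} (l1norm v) \<partial>Pm)"
proof (cases "emeasure (norm_levy Pm) {a<..} = 0")
  case True
  have "emeasure Pm {v. a < l1norm v} = 0" using True by (simp add: emeasure_norm_levy_tail)
  then have "AE v in Pm. \<not> a < l1norm v"
    by (intro AE_I[of _ _ "{v. a < l1norm v}"]) auto
  then show ?thesis by (intro nn_integral_cong_AE) (auto elim!: eventually_mono)
next
  case False
  have s[simp]: "space (nu Pm a) = UNIV" and s'[measurable_cong]: "sets (nu Pm a) = sets borel" by (simp_all add: nu_def)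
  have \<kappa>: "ext_kernel {a<..} \<kappa> \<in> borel \<rightarrow>\<^sub>M prob_algebra borel"
    using rc by (intro measurable_ext_kernel) (auto simp: reg_cond_distr_def)
  note \<kappa>S = measurable_prob_algebraD[OF \<kappa>]
  have F1: "(\<lambda>v. F (l1norm v, v)) \<in> borel_measurable borel"
  proof -
    have [measurable]: "(\<lambda>v. (l1norm v, v)) \<in> (borel :: (real ^ 'n) measure) \<rightarrow>\<^sub>M borel"
      unfolding borel_prod[symmetric] by measurable
    show ?thesis by measurable
  qed
  have F': "F \<in> borel_measurable (borel \<Otimes>\<^sub>M borel)" by (simp add: borel_prod)
  have F2': "(\<lambda>z. \<integral>\<^sup>+w. F (z, w) \<partial>ext_kernel {a<..} \<kappa> z) \<in> borel_measurable borel"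
    using nn_integral_measurable_subprob_algebra2[OF _ \<kappa>S, of "\<lambda>z w. F (z, w)"] F' by (simp add: case_prod_beta')
  define F2 where "F2 v = (\<integral>\<^sup>+w. F (l1norm v, w) \<partial>ext_kernel {a<..} \<kappa> (l1norm v))" for v :: "real ^ 'n"
  have F2: "F2 \<in> borel_measurable borel"
    unfolding F2_def[abs_def] by (rule measurable_compose[OF borel_measurable_l1norm F2'])
  have F1I: "(\<lambda>v. F (l1norm v, v) * indicator {a<..} (l1norm v)) \<in> borel_measurable borel"
    and F2I: "(\<lambda>v. F2 v * indicator {a<..} (l1norm v)) \<in> borel_measurable borel"
    using F1 F2 by measurable
  have eq: "(\<integral>\<^sup>+v. F (l1norm v, v) * indicator {a<..} (l1norm v) \<partial>nu Pm a) =
      (\<integral>\<^sup>+v. (\<integral>\<^sup>+w. F (l1norm v, w) \<partial>\<kappa> (l1norm v)) * indicator {a<..} (l1norm v) \<partial>nu Pm a)"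
    using reg_cond_distr_nn_integral[OF rc finite_nu[OF a] _ _ _ _ F]
    by (simp add: restrict_space_whole[of "nu Pm a", simplified])
  also have "\<dots> = (\<integral>\<^sup>+v. F2 v * indicator {a<..} (l1norm v) \<partial>nu Pm a)"
    by (rule nn_integral_cong) (auto simp: F2_def indicator_def)
  finally have eq: "(\<integral>\<^sup>+v. F (l1norm v, v) * indicator {a<..} (l1norm v) \<partial>nu Pm a) =
      (\<integral>\<^sup>+v. F2 v * indicator {a<..} (l1norm v) \<partial>nu Pm a)" .
  \<comment> \<open>One indicator comes from the range of the conditional law, the other from the
    density of \<open>nu\<close>.\<close>
  have "(\<integral>\<^sup>+v. F (l1norm v, v) * indicator {a<..} (l1norm v) * indicator {a<..} (l1norm v) \<partial>Pm) =
      (\<integral>\<^sup>+v. F2 v * indicator {a<..} (l1norm v) * indicator {a<..} (l1norm v) \<partial>Pm)"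
    using eq nu_nn_integral[OF a False F1I] nu_nn_integral[OF a False F2I]
    by simp
  moreover have "x * indicator {a<..} y * indicator {a<..} y = x * (indicator {a<..} y :: ennreal)" for x and y :: real
    by (simp add: indicator_def)
  ultimately have "(\<integral>\<^sup>+v. F (l1norm v, v) * indicator {a<..} (l1norm v) \<partial>Pm) =
      (\<integral>\<^sup>+v. F2 v * indicator {a<..} (l1norm v) \<partial>Pm)" by simp
  also have "\<dots> = (\<integral>\<^sup>+v. (\<integral>\<^sup>+w. F (l1norm v, w) \<partial>\<kappa> (l1norm v)) * indicator {a<..} (l1norm v) \<partial>Pm)"
    by (rule nn_integral_cong) (auto simp: F2_def indicator_def)
  finally show ?thesis .
qed

text \<open>Beyond the larger threshold both kernels disintegrate the same measure
  \<open>Pm\<close>, since the normalising constants cancel. They agree almost everywhere on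
  countably many generating sets, hence as measures.\<close>

lemma levy_kernel_unique:
  assumes a: "0 < a" and rc: "reg_cond_distr (nu Pm a) (space (nu Pm a)) l1norm (\<lambda>v. v) {a<..} \<kappa>"
    and b: "0 < b" and rc': "reg_cond_distr (nu Pm b) (space (nu Pm b)) l1norm (\<lambda>v. v) {b<..} \<kappa>'"
  shows "AE z in norm_levy Pm. a < z \<longrightarrow> b < z \<longrightarrow> \<kappa> z = \<kappa>' z"
proof -
  define m where "m = max a b"
  have m: "0 < m" "a \<le> m" "b \<le> m" using a by (auto simp: m_def)
  \<comment> \<open>The law of the norm beyond both thresholds; it is finite, which the comparison
    of densities requires.\<close>
  define Q where "Q = density (norm_levy Pm) (indicator {m<..})"
  have [measurable_cong, simp]: "sets Q = sets borel" by (simp add: Q_def norm_levy_def)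
  have Qint: "(\<integral>\<^sup>+z. h z \<partial>Q) = (\<integral>\<^sup>+v. h (l1norm v) * indicator {m<..} (l1norm v) \<partial>Pm)"
    if [measurable]: "h \<in> borel_measurable borel" for h
    unfolding Q_def norm_levy_def by (simp add: nn_integral_density nn_integral_distr mult.commute)
  interpret Q: finite_measure Q
  proof (rule finite_measureI)
    have "emeasure Q (space Q) = (\<integral>\<^sup>+z. 1 \<partial>Q)" by simp
    also have "\<dots> = (\<integral>\<^sup>+v. indicator {v. m < l1norm v} v \<partial>Pm)"
      by (subst Qint, simp) (rule nn_integral_cong, auto simp: indicator_def)
    also have "\<dots> = emeasure Pm {v. m < l1norm v}" by (rule nn_integral_indicator) simp
    also have "\<dots> < \<infinity>" by (rule tail_finite[OF m(1)])
    finally show "emeasure Q (space Q) \<noteq> \<infinity>" by simp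
  qed
  have k: "ext_kernel {a<..} \<kappa> \<in> borel \<rightarrow>\<^sub>M prob_algebra borel"
    using rc by (intro measurable_ext_kernel) (auto simp: reg_cond_distr_def)
  have k': "ext_kernel {b<..} \<kappa>' \<in> borel \<rightarrow>\<^sub>M prob_algebra borel"
    using rc' by (intro measurable_ext_kernel) (auto simp: reg_cond_distr_def)
  have val: "(\<integral>\<^sup>+z\<in>A. emeasure (ext_kernel {d<..} \<mu> z) B \<partial>Q) = (\<integral>\<^sup>+v. indicator A (l1norm v) * indicator B v * indicator {m<..} (l1norm v) \<partial>Pm)"
    if d: "0 < d" "d \<le> m" and r: "reg_cond_distr (nu Pm d) (space (nu Pm d)) l1norm (\<lambda>v. v) {d<..} \<mu>"
      and A[measurable]: "A \<in> sets borel" and B[measurable]: "B \<in> sets borel" for d \<mu> A B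
  proof -
    have kd: "ext_kernel {d<..} \<mu> \<in> borel \<rightarrow>\<^sub>M prob_algebra borel"
      using r by (intro measurable_ext_kernel) (auto simp: reg_cond_distr_def)
    have sk: "sets (ext_kernel {d<..} \<mu> z) = sets borel" for z
      using measurable_space[OF kd, of z] by (simp add: space_prob_algebra)
    have [measurable]: "(\<lambda>z. emeasure (ext_kernel {d<..} \<mu> z) B) \<in> borel_measurable borel"
      using measurable_compose[OF measurable_prob_algebraD[OF kd] measurable_emeasure_subprob_algebra[OF B]] by simp
    define F where "F p = (indicator A (fst p) * indicator {m<..} (fst p) * indicator B (snd p) :: ennreal)" for p :: "real \<times> (real ^ 'n)"
    have F: "F \<in> borel_measurable borel" unfolding F_def[abs_def] borel_prod[symmetric] by measurable
    have "(\<integral>\<^sup>+v. indicator A (l1norm v) * indicator B v * indicator {m<..} (l1norm v) \<partial>Pm) =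
        (\<integral>\<^sup>+v. F (l1norm v, v) * indicator {d<..} (l1norm v) \<partial>Pm)"
      by (rule nn_integral_cong) (use d in \<open>auto simp: F_def indicator_def\<close>)
    also have "\<dots> = (\<integral>\<^sup>+v. (\<integral>\<^sup>+w. F (l1norm v, w) \<partial>\<mu> (l1norm v)) * indicator {d<..} (l1norm v) \<partial>Pm)"
      by (rule levy_kernel_nn_integral[OF d(1) r F])
    also have "\<dots> = (\<integral>\<^sup>+v. (emeasure (ext_kernel {d<..} \<mu> (l1norm v)) B * indicator A (l1norm v)) * indicator {m<..} (l1norm v) \<partial>Pm)"
    proof (rule nn_integral_cong)
      fix v :: "real ^ 'n"
      show "(\<integral>\<^sup>+w. F (l1norm v, w) \<partial>\<mu> (l1norm v)) * indicator {d<..} (l1norm v) =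
          (emeasure (ext_kernel {d<..} \<mu> (l1norm v)) B * indicator A (l1norm v)) * indicator {m<..} (l1norm v)"
      proof (cases "d < l1norm v")
        case True
        then have "sets (\<mu> (l1norm v)) = sets borel" using sk[of "l1norm v"] by simp
        then have "(\<integral>\<^sup>+w. F (l1norm v, w) \<partial>\<mu> (l1norm v)) = indicator A (l1norm v) * indicator {m<..} (l1norm v) * emeasure (\<mu> (l1norm v)) B"
          unfolding F_def fst_conv snd_conv using B by (subst nn_integral_cmult) auto
        then show ?thesis using True by (simp add: mult_ac)
      qed (use d in \<open>auto simp: indicator_def\<close>)
    qed
    also have "\<dots> = (\<integral>\<^sup>+z\<in>A. emeasure (ext_kernel {d<..} \<mu> z) B \<partial>Q)" by (rule Qint[symmetric]) measurable
    finally show ?thesis by simp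
  qed
  obtain G :: "(real ^ 'n) set set" where G: "countable G" "Int_stable G" "UNIV \<in> G" "sets borel = sigma_sets UNIV G"
    using countable_Int_stable_generator by blast
  have "AE z in Q. emeasure (ext_kernel {a<..} \<kappa> z) B = emeasure (ext_kernel {b<..} \<kappa>' z) B" if "B \<in> G" for B
  proof -
    have B[measurable]: "B \<in> sets borel" using that unfolding G(4) by (rule sigma_sets.Basic)
    have m1[measurable]: "(\<lambda>z. emeasure (ext_kernel {a<..} \<kappa> z) B) \<in> borel_measurable borel"
      using measurable_compose[OF measurable_prob_algebraD[OF k] measurable_emeasure_subprob_algebra[OF B]] by simp
    have m2[measurable]: "(\<lambda>z. emeasure (ext_kernel {b<..} \<kappa>' z) B) \<in> borel_measurable borel"
      using measurable_compose[OF measurable_prob_algebraD[OF k'] measurable_emeasure_subprob_algebra[OF B]] by simp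
    have le1: "emeasure (p z) B \<le> 1" if "p \<in> borel \<rightarrow>\<^sub>M prob_algebra borel" for p :: "real \<Rightarrow> (real ^ 'n) measure" and z
    proof -
      interpret P: prob_space "p z" using measurable_space[OF that, of z] by (simp add: space_prob_algebra)
      show ?thesis by (rule P.emeasure_le_1)
    qed
    have fin: "(\<integral>\<^sup>+z. emeasure (p z) B \<partial>Q) < \<infinity>" if "p \<in> borel \<rightarrow>\<^sub>M prob_algebra borel" for p :: "real \<Rightarrow> (real ^ 'n) measure"
    proof -
      have "(\<integral>\<^sup>+z. emeasure (p z) B \<partial>Q) \<le> (\<integral>\<^sup>+z. 1 \<partial>Q)" by (intro nn_integral_mono le1[OF that])
      also have "\<dots> < \<infinity>" using Q.emeasure_finite[of "space Q"] by (simp add: less_top[symmetric])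
      finally show ?thesis .
    qed
    have eq: "(\<integral>\<^sup>+z\<in>A. emeasure (ext_kernel {a<..} \<kappa> z) B \<partial>Q) = (\<integral>\<^sup>+z\<in>A. emeasure (ext_kernel {b<..} \<kappa>' z) B \<partial>Q)"
      if "A \<in> sets Q" for A
      using val[OF a m(2) rc _ B, of A] val[OF b m(3) rc' _ B, of A] that by simp
    have "AE z in Q. emeasure (ext_kernel {a<..} \<kappa> z) B \<le> emeasure (ext_kernel {b<..} \<kappa>' z) B"
      by (rule AE_le_of_density_le[OF Q.finite_measure_axioms _ _ fin[OF k']]) (auto simp: eq)
    moreover have "AE z in Q. emeasure (ext_kernel {b<..} \<kappa>' z) B \<le> emeasure (ext_kernel {a<..} \<kappa> z) B"
      by (rule AE_le_of_density_le[OF Q.finite_measure_axioms _ _ fin[OF k]]) (auto simp: eq)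
    ultimately show ?thesis by eventually_elim (rule antisym)
  qed
  then have "AE z in Q. \<forall>B\<in>G. emeasure (ext_kernel {a<..} \<kappa> z) B = emeasure (ext_kernel {b<..} \<kappa>' z) B"
    by (subst AE_ball_countable[OF G(1)]) auto
  then have "AE z in Q. ext_kernel {a<..} \<kappa> z = ext_kernel {b<..} \<kappa>' z"
  proof eventually_elim
    case (elim z)
    interpret A: prob_space "ext_kernel {a<..} \<kappa> z"
      using measurable_space[OF k, of z] by (simp add: space_prob_algebra)
    have s: "sets (ext_kernel {a<..} \<kappa> z) = sets borel" "sets (ext_kernel {b<..} \<kappa>' z) = sets borel"
      using measurable_space[OF k, of z] measurable_space[OF k', of z] by (simp_all add: space_prob_algebra)
    show ?case
    proof (rule measure_eqI_generator_eq[OF G(2), of UNIV _ _ "\<lambda>_. UNIV"])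
      show "emeasure (ext_kernel {a<..} \<kappa> z) UNIV \<noteq> \<infinity>" by simp
    qed (use elim G s in auto)
  qed
  then show ?thesis
    unfolding Q_def by (subst (asm) AE_density) (auto simp: norm_levy_def m_def elim!: eventually_mono)
qed

end

context levy_passage
begin

text \<open>Under the product of the law of X(t) and \<open>Pm\<close> the two vectors can be
  conditioned on their norms separately, X(t) by \<open>K\<close> and v by \<open>\<kappa>\<close>;
  therefore the joint conditional law is a product.\<close>

lemma kernel_product_integral:
  assumes K: "cond_family M X K" and t: "0 < t" and a: "0 < a"
    and rc: "reg_cond_distr (nu Pm a) (space (nu Pm a)) l1norm (\<lambda>v. v) {a<..} \<kappa>"
    and A[measurable]: "A \<in> sets borel" and Aa: "\<And>s z. (s, z) \<in> A \<Longrightarrow> a < z" and B[measurable]: "B \<in> sets borel"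
  shows "(\<integral>\<^sup>+\<omega>. \<integral>\<^sup>+v. indicator A (S t \<omega>, l1norm v) * indicator B (X t \<omega>, v) \<partial>Pm \<partial>M) =
    (\<integral>\<^sup>+\<omega>. \<integral>\<^sup>+v. indicator A (S t \<omega>, l1norm v) * emeasure (K t (S t \<omega>) \<Otimes>\<^sub>M \<kappa> (l1norm v)) B \<partial>Pm \<partial>M)"
proof -
  have A'[measurable]: "A \<in> sets (borel \<Otimes>\<^sub>M borel)" and B'[measurable]: "B \<in> sets (borel \<Otimes>\<^sub>M borel)"
    unfolding borel_prod by (rule A, rule B)
  define \<kappa>e where "\<kappa>e = ext_kernel {a<..} \<kappa>"
  have \<kappa>e: "\<kappa>e \<in> borel \<rightarrow>\<^sub>M prob_algebra borel"
    unfolding \<kappa>e_def using rc by (intro measurable_ext_kernel) (auto simp: reg_cond_distr_def)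
  note \<kappa>S = measurable_prob_algebraD[OF \<kappa>e]
  have \<kappa>p: "prob_space (\<kappa>e z)" "sets (\<kappa>e z) = sets borel" for z
    using measurable_space[OF \<kappa>e, of z] by (auto simp: space_prob_algebra)
  define F where "F p = (\<integral>\<^sup>+v. indicator A (fst p, l1norm v) * indicator B (snd p, v) \<partial>Pm)" for p :: "real \<times> (real ^ 'n)"
  have F: "F \<in> borel_measurable borel"
    unfolding F_def[abs_def] borel_prod[symmetric] by (rule Pm.borel_measurable_nn_integral) measurable
  have "(\<integral>\<^sup>+\<omega>. \<integral>\<^sup>+v. indicator A (S t \<omega>, l1norm v) * indicator B (X t \<omega>, v) \<partial>Pm \<partial>M) = (\<integral>\<^sup>+\<omega>. F (S t \<omega>, X t \<omega>) \<partial>M)"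
    by (simp add: F_def)
  also have "\<dots> = (\<integral>\<^sup>+\<omega>. \<integral>\<^sup>+u. F (S t \<omega>, u) \<partial>K t (S t \<omega>) \<partial>M)" by (rule cond_family_nn_integral[OF K t F])
  also have "\<dots> = (\<integral>\<^sup>+\<omega>. \<integral>\<^sup>+v. indicator A (S t \<omega>, l1norm v) * emeasure (K t (S t \<omega>) \<Otimes>\<^sub>M \<kappa> (l1norm v)) B \<partial>Pm \<partial>M)"
  proof (rule nn_integral_cong)
    fix \<omega>
    define s where "s = S t \<omega>"
    interpret Kp: prob_space "K t s" by (rule kernel_prob[OF K t])
    interpret KP: pair_sigma_finite "K t s" Pm ..
    note sK[measurable_cong, simp] = kernel_prob(2)[OF K t, of s]
    define W where "W p = (\<integral>\<^sup>+w. indicator B (fst p, w) \<partial>\<kappa>e (l1norm (snd p)))" for p :: "(real ^ 'n) \<times> (real ^ 'n)"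
    have W[measurable]: "W \<in> borel_measurable (borel \<Otimes>\<^sub>M borel)"
    proof -
      have "(\<lambda>p. \<kappa>e (l1norm (snd p))) \<in> (borel :: (real ^ 'n) measure) \<Otimes>\<^sub>M (borel :: (real ^ 'n) measure) \<rightarrow>\<^sub>M subprob_algebra borel"
        by (rule measurable_compose[OF _ \<kappa>S]) measurable
      from nn_integral_measurable_subprob_algebra2[OF _ this, of "\<lambda>p w. indicator B (fst p, w)"]
      show ?thesis unfolding W_def[abs_def] by (simp add: case_prod_beta')
    qed
    have "F (s, u) = (\<integral>\<^sup>+v. indicator A (s, l1norm v) * W (u, v) \<partial>Pm)" for u
    proof -
      define H where "H p = (indicator A (s, fst p) * indicator B (u, snd p) :: ennreal)" for p :: "real \<times> (real ^ 'n)"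
      have H: "H \<in> borel_measurable borel" unfolding H_def[abs_def] borel_prod[symmetric] by measurable
      have "F (s, u) = (\<integral>\<^sup>+v. H (l1norm v, v) * indicator {a<..} (l1norm v) \<partial>Pm)"
        unfolding F_def fst_conv snd_conv H_def by (rule nn_integral_cong) (use Aa in \<open>auto simp: indicator_def\<close>)
      also have "\<dots> = (\<integral>\<^sup>+v. (\<integral>\<^sup>+w. H (l1norm v, w) \<partial>\<kappa> (l1norm v)) * indicator {a<..} (l1norm v) \<partial>Pm)"
        by (rule levy_kernel_nn_integral[OF a rc H])
      also have "\<dots> = (\<integral>\<^sup>+v. indicator A (s, l1norm v) * W (u, v) \<partial>Pm)"
      proof (rule nn_integral_cong)
        fix v :: "real ^ 'n"
        show "(\<integral>\<^sup>+w. H (l1norm v, w) \<partial>\<kappa> (l1norm v)) * indicator {a<..} (l1norm v) = indicator A (s, l1norm v) * W (u, v)"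
        proof (cases "a < l1norm v")
          case True
          then have eq: "\<kappa>e (l1norm v) = \<kappa> (l1norm v)" by (simp add: \<kappa>e_def)
          note [measurable_cong] = \<kappa>p(2)[of "l1norm v", unfolded eq]
          have "(\<lambda>w. indicator B (u, w) :: ennreal) \<in> borel_measurable (\<kappa> (l1norm v))" by measurable
          then show ?thesis using True unfolding H_def W_def fst_conv snd_conv eq by (simp add: nn_integral_cmult)
        next
          case False
          then show ?thesis using Aa by (auto simp: indicator_def)
        qed
      qed
      finally show ?thesis .
    qed
    then have "(\<integral>\<^sup>+u. F (s, u) \<partial>K t s) = (\<integral>\<^sup>+u. \<integral>\<^sup>+v. indicator A (s, l1norm v) * W (u, v) \<partial>Pm \<partial>K t s)" by simp
    \<comment> \<open>The exchange puts the integral over u innermost, where it combines with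
      \<open>W\<close> into the product measure.\<close>
    also have "\<dots> = (\<integral>\<^sup>+v. \<integral>\<^sup>+u. indicator A (s, l1norm v) * W (u, v) \<partial>K t s \<partial>Pm)"
    proof (rule KP.Fubini'[symmetric])
      have "sets (K t s \<Otimes>\<^sub>M Pm) = sets (borel \<Otimes>\<^sub>M borel)" by (intro sets_pair_measure_cong) auto
      moreover have "(\<lambda>(u, v). indicator A (s, l1norm v) * W (u, v)) \<in> borel_measurable (borel \<Otimes>\<^sub>M borel)" by measurable
      ultimately show "(\<lambda>(u, v). indicator A (s, l1norm v) * W (u, v)) \<in> borel_measurable (K t s \<Otimes>\<^sub>M Pm)"
        using measurable_cong_sets[OF _ refl] by blast
    qed
    also have "\<dots> = (\<integral>\<^sup>+v. indicator A (s, l1norm v) * emeasure (K t s \<Otimes>\<^sub>M \<kappa> (l1norm v)) B \<partial>Pm)"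
    proof (rule nn_integral_cong)
      fix v :: "real ^ 'n"
      show "(\<integral>\<^sup>+u. indicator A (s, l1norm v) * W (u, v) \<partial>K t s) =
          indicator A (s, l1norm v) * emeasure (K t s \<Otimes>\<^sub>M \<kappa> (l1norm v)) B"
      proof (cases "(s, l1norm v) \<in> A")
        case True
        then have eq: "\<kappa>e (l1norm v) = \<kappa> (l1norm v)" using Aa by (simp add: \<kappa>e_def)
        interpret \<kappa>v: prob_space "\<kappa> (l1norm v)" using \<kappa>p(1)[of "l1norm v"] unfolding eq .
        have s\<kappa>: "sets (\<kappa> (l1norm v)) = sets borel" using \<kappa>p(2)[of "l1norm v"] unfolding eq .
        have "sets (K t s \<Otimes>\<^sub>M \<kappa> (l1norm v)) = sets (borel \<Otimes>\<^sub>M borel)" using s\<kappa> by (intro sets_pair_measure_cong) auto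
        then have BK: "B \<in> sets (K t s \<Otimes>\<^sub>M \<kappa> (l1norm v))" using B' by simp
        then have "emeasure (K t s \<Otimes>\<^sub>M \<kappa> (l1norm v)) B = (\<integral>\<^sup>+u. W (u, v) \<partial>K t s)"
          unfolding W_def fst_conv snd_conv eq by (rule \<kappa>v.emeasure_pair_measure)
        then show ?thesis using True by simp
      qed simp
    qed
    finally show "(\<integral>\<^sup>+u. F (S t \<omega>, u) \<partial>K t (S t \<omega>)) =
        (\<integral>\<^sup>+v. indicator A (S t \<omega>, l1norm v) * emeasure (K t (S t \<omega>) \<Otimes>\<^sub>M \<kappa> (l1norm v)) B \<partial>Pm)"
      by (simp add: s_def)
  qed
  finally show ?thesis .
qed

text \<open>The condition a < z is present because \<open>\<kappa>\<close> is a conditional law for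
  norms above a.\<close>

definition size_range :: "real \<Rightarrow> (real \<times> real \<times> real) set" where
  "size_range a = {(t, s, z). 0 < t \<and> 0 \<le> s \<and> s \<le> c t \<and> c t - s < z \<and> a < z}"

lemma size_range_sets [measurable]: "size_range a \<in> sets borel"
proof -
  have "{p :: real \<times> real \<times> real \<in> space (borel \<Otimes>\<^sub>M borel \<Otimes>\<^sub>M borel). 0 < fst p \<and> 0 \<le> fst (snd p) \<and> fst (snd p) \<le> c_ext (fst p) \<and>
      c_ext (fst p) - fst (snd p) < snd (snd p) \<and> a < snd (snd p)} \<in> sets (borel \<Otimes>\<^sub>M borel \<Otimes>\<^sub>M borel)"
    by measurable
  also have "{p :: real \<times> real \<times> real \<in> space (borel \<Otimes>\<^sub>M borel \<Otimes>\<^sub>M borel). 0 < fst p \<and> 0 \<le> fst (snd p) \<and> fst (snd p) \<le> c_ext (fst p) \<and>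
      c_ext (fst p) - fst (snd p) < snd (snd p) \<and> a < snd (snd p)} = size_range a"
    by (auto simp: size_range_def c_ext_def space_pair_measure)
  finally show ?thesis unfolding borel_prod .
qed

text \<open>The sizes are functions of the triple of time, position and jump. The jump formula leads
  to an integral over these three, the conditioning is carried out there under the product measure,
  and the same formula leads back.\<close>

lemma sizes_conditional:
  assumes K: "cond_family M X K" and a: "0 < a"
    and rc: "reg_cond_distr (nu Pm a) (space (nu Pm a)) l1norm (\<lambda>v. v) {a<..} \<kappa>"
  shows "reg_cond_distr M E (\<lambda>\<omega>. (\<tau> \<omega>, pre_S X c \<omega>, jump_S X c \<omega>)) (\<lambda>\<omega>. (pre \<omega>, jmp \<omega>))
    (size_range a) (\<lambda>(t, s, z). K t s \<Otimes>\<^sub>M \<kappa> z)"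
  unfolding reg_cond_distr_def
proof (intro conjI ballI impI)
  define \<kappa>e where "\<kappa>e = ext_kernel {a<..} \<kappa>"
  have \<kappa>e: "\<kappa>e \<in> borel \<rightarrow>\<^sub>M prob_algebra borel"
    unfolding \<kappa>e_def using rc by (intro measurable_ext_kernel) (auto simp: reg_cond_distr_def)
  define L where "L p = kernel_ext K (fst p, fst (snd p)) \<Otimes>\<^sub>M \<kappa>e (snd (snd p))" for p
  have prj[measurable]: "(\<lambda>p. (fst p, fst (snd p))) \<in> (borel :: (real \<times> real \<times> real) measure) \<rightarrow>\<^sub>M borel"
    "(\<lambda>p. snd (snd p)) \<in> (borel :: (real \<times> real \<times> real) measure) \<rightarrow>\<^sub>M borel"
    "(\<lambda>p. fst p) \<in> (borel :: (real \<times> real \<times> real) measure) \<rightarrow>\<^sub>M borel"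
    unfolding borel_prod[symmetric] by measurable
  have L: "L \<in> borel \<rightarrow>\<^sub>M prob_algebra borel"
    unfolding L_def[abs_def] borel_prod[symmetric, where ?'a="real ^ 'n" and ?'b="real ^ 'n"]
    by (rule measurable_pair_prob[OF measurable_compose[OF prj(1) kernel_ext_measurable[OF K]] measurable_compose[OF prj(2) \<kappa>e]])
  have L_eq: "L (t, s, z) = K t s \<Otimes>\<^sub>M \<kappa> z" if "(t, s, z) \<in> size_range a" for t s z
    using that by (simp add: L_def \<kappa>e_def size_range_def)
  have "L \<in> restrict_space borel (size_range a) \<rightarrow>\<^sub>M prob_algebra borel" by (rule measurable_restrict_space1[OF L])
  also have "?this \<longleftrightarrow> (\<lambda>(t, s, z). K t s \<Otimes>\<^sub>M \<kappa> z) \<in> restrict_space borel (size_range a) \<rightarrow>\<^sub>M prob_algebra borel"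
    by (rule measurable_cong) (auto simp: space_restrict_space L_eq)
  finally show "(\<lambda>(t, s, z). K t s \<Otimes>\<^sub>M \<kappa> z) \<in> restrict_space borel (size_range a) \<rightarrow>\<^sub>M prob_algebra borel" .
  fix A :: "(real \<times> real \<times> real) set" and B :: "((real ^ 'n) \<times> (real ^ 'n)) set"
  assume A[measurable]: "A \<in> sets borel" and B[measurable]: "B \<in> sets borel" and AR: "A \<subseteq> size_range a"
  define k where "k p = emeasure (L p) B" for p
  have k[measurable]: "k \<in> borel_measurable borel"
    unfolding k_def[abs_def]
    using measurable_compose[OF measurable_prob_algebraD[OF L] measurable_emeasure_subprob_algebra[OF B]] by simp
  define \<sigma> where "\<sigma> p = (fst p, l1norm (fst (snd p)), l1norm (snd (snd p)))" for p :: "real \<times> (real ^ 'n) \<times> (real ^ 'n)"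
  have \<sigma>[measurable]: "\<sigma> \<in> borel \<rightarrow>\<^sub>M borel" unfolding \<sigma>_def[abs_def] borel_prod[symmetric] by measurable
  have sn[measurable]: "snd \<in> (borel :: (real \<times> (real ^ 'n) \<times> (real ^ 'n)) measure) \<rightarrow>\<^sub>M borel"
    unfolding borel_prod[symmetric] by measurable
  \<comment> \<open>\<open>H1\<close> tests the event itself, \<open>H2\<close> its conditional
    probability given the sizes.\<close>
  define H1 where "H1 p = (indicator A (\<sigma> p) * indicator B (snd p) :: ennreal)" for p
  define H2 where "H2 p = k (\<sigma> p) * indicator A (\<sigma> p)" for p
  have H1[measurable]: "H1 \<in> borel_measurable borel" unfolding H1_def[abs_def] by measurable
  have H2[measurable]: "H2 \<in> borel_measurable borel" unfolding H2_def[abs_def] by measurable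
  have sizes0: "(\<lambda>\<omega>. (\<tau> \<omega>, l1norm (pre0 \<omega>), l1norm (at0 \<omega>) - l1norm (pre0 \<omega>))) \<in> M \<rightarrow>\<^sub>M borel"
    unfolding borel_prod[symmetric] by measurable
  have pj0: "(\<lambda>\<omega>. (pre0 \<omega>, at0 \<omega> - pre0 \<omega>)) \<in> M \<rightarrow>\<^sub>M borel"
    unfolding borel_prod[symmetric] by measurable
  have ev: "{\<omega> \<in> E. (\<tau> \<omega>, pre_S X c \<omega>, jump_S X c \<omega>) \<in> A \<and> (pre \<omega>, jmp \<omega>) \<in> B} \<in> sets M"
  proof -
    have "(E \<inter> ((\<lambda>\<omega>. (\<tau> \<omega>, l1norm (pre0 \<omega>), l1norm (at0 \<omega>) - l1norm (pre0 \<omega>))) -` A \<inter> space M)) \<inter>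
        ((\<lambda>\<omega>. (pre0 \<omega>, at0 \<omega> - pre0 \<omega>)) -` B \<inter> space M) \<in> sets M"
      using passes_sets measurable_sets[OF sizes0 A] measurable_sets[OF pj0 B] by blast
    also have "(E \<inter> ((\<lambda>\<omega>. (\<tau> \<omega>, l1norm (pre0 \<omega>), l1norm (at0 \<omega>) - l1norm (pre0 \<omega>))) -` A \<inter> space M)) \<inter>
        ((\<lambda>\<omega>. (pre0 \<omega>, at0 \<omega> - pre0 \<omega>)) -` B \<inter> space M) =
        {\<omega> \<in> E. (\<tau> \<omega>, pre_S X c \<omega>, jump_S X c \<omega>) \<in> A \<and> (pre \<omega>, jmp \<omega>) \<in> B}"
      using passesD(1) by (auto simp: on_passes jump_S_on_passes)
    finally show ?thesis .
  qed
  have sizes: "\<sigma> (\<tau> \<omega>, pre \<omega>, jmp \<omega>) = (\<tau> \<omega>, pre_S X c \<omega>, jump_S X c \<omega>)"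
    if "increasing_path (\<lambda>t. X t \<omega>)" "\<omega> \<in> E" for \<omega>
    using path_at_passage(3,4)[OF that] by (simp add: \<sigma>_def)
  \<comment> \<open>On \<open>size_range\<close> with a > 0 the jump is nonzero and the triple lies
    in \<open>jump_cond\<close>, so both cut-offs in the jump formula are automatic.\<close>
  have nz: "jmp \<omega> \<noteq> 0" if "\<sigma> (\<tau> \<omega>, pre \<omega>, jmp \<omega>) \<in> A" for \<omega>
    using subsetD[OF AR that] a by (auto simp: \<sigma>_def size_range_def)
  have jc: "p \<in> jump_cond" if "\<sigma> p \<in> A" for p
    using subsetD[OF AR that] by (cases p) (auto simp: \<sigma>_def size_range_def jump_cond_def)
  have "emeasure M {\<omega> \<in> E. (\<tau> \<omega>, pre_S X c \<omega>, jump_S X c \<omega>) \<in> A \<and> (pre \<omega>, jmp \<omega>) \<in> B} =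
      (\<integral>\<^sup>+\<omega>. indicator {\<omega> \<in> E. (\<tau> \<omega>, pre_S X c \<omega>, jump_S X c \<omega>) \<in> A \<and> (pre \<omega>, jmp \<omega>) \<in> B} \<omega> \<partial>M)"
    by (rule nn_integral_indicator[OF ev, symmetric])
  also have "\<dots> = (\<integral>\<^sup>+\<omega>. H1 (\<tau> \<omega>, pre \<omega>, jmp \<omega>) * indicator {\<omega>\<in>E. jmp \<omega> \<noteq> 0} \<omega> \<partial>M)"
  proof (rule nn_integral_cong_AE)
    show "AE \<omega> in M. indicator {\<omega> \<in> E. (\<tau> \<omega>, pre_S X c \<omega>, jump_S X c \<omega>) \<in> A \<and> (pre \<omega>, jmp \<omega>) \<in> B} \<omega> =
        H1 (\<tau> \<omega>, pre \<omega>, jmp \<omega>) * indicator {\<omega>\<in>E. jmp \<omega> \<noteq> 0} \<omega>"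
      using AE_increasing_path
    proof eventually_elim
      case (elim \<omega>)
      show ?case
      proof (cases "\<omega> \<in> E")
        case True
        then show ?thesis using nz[of \<omega>] by (auto simp: H1_def sizes[OF elim True] indicator_def)
      qed simp
    qed
  qed
  also have "\<dots> = (\<integral>\<^sup>+t\<in>{0<..}. \<integral>\<^sup>+\<omega>. \<integral>\<^sup>+v. H1 (t, X t \<omega>, v) * indicator jump_cond (t, X t \<omega>, v) \<partial>Pm \<partial>M \<partial>lborel)"
    by (rule jump_formula[OF H1])
  also have "\<dots> = (\<integral>\<^sup>+t\<in>{0<..}. \<integral>\<^sup>+\<omega>. \<integral>\<^sup>+v. H2 (t, X t \<omega>, v) * indicator jump_cond (t, X t \<omega>, v) \<partial>Pm \<partial>M \<partial>lborel)"
  proof (rule nn_integral_cong)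
    fix t :: real
    have 1: "H1 (t, u, v) * indicator jump_cond (t, u, v) = indicator {(s, z). (t, s, z) \<in> A} (l1norm u, l1norm v) * indicator B (u, v)" for u v
      using jc[of "(t, u, v)"] by (auto simp: H1_def indicator_def \<sigma>_def)
    have 2: "H2 (t, u, v) * indicator jump_cond (t, u, v) =
        indicator {(s, z). (t, s, z) \<in> A} (l1norm u, l1norm v) * emeasure (K t (l1norm u) \<Otimes>\<^sub>M \<kappa> (l1norm v)) B" for u v
      using jc[of "(t, u, v)"] AR by (auto simp: H2_def indicator_def \<sigma>_def k_def L_eq)
    have sec: "{(s, z). (t, s, z) \<in> A} \<in> sets borel"
    proof -
      have "Pair t \<in> (borel :: (real \<times> real) measure) \<rightarrow>\<^sub>M borel" unfolding borel_prod[symmetric] by measurable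
      from measurable_sets[OF this A] show ?thesis by (simp add: vimage_def case_prod_beta')
    qed
    have "(\<integral>\<^sup>+\<omega>. \<integral>\<^sup>+v. H1 (t, X t \<omega>, v) * indicator jump_cond (t, X t \<omega>, v) \<partial>Pm \<partial>M) =
        (\<integral>\<^sup>+\<omega>. \<integral>\<^sup>+v. H2 (t, X t \<omega>, v) * indicator jump_cond (t, X t \<omega>, v) \<partial>Pm \<partial>M)" if "0 < t"
      unfolding 1 2 by (rule kernel_product_integral[OF K that a rc sec _ B]) (use AR in \<open>auto simp: size_range_def\<close>)
    then show "(\<integral>\<^sup>+\<omega>. \<integral>\<^sup>+v. H1 (t, X t \<omega>, v) * indicator jump_cond (t, X t \<omega>, v) \<partial>Pm \<partial>M) * indicator {0<..} t =
        (\<integral>\<^sup>+\<omega>. \<integral>\<^sup>+v. H2 (t, X t \<omega>, v) * indicator jump_cond (t, X t \<omega>, v) \<partial>Pm \<partial>M) * indicator {0<..} t"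
      by (simp add: indicator_def)
  qed
  also have "\<dots> = (\<integral>\<^sup>+\<omega>. H2 (\<tau> \<omega>, pre \<omega>, jmp \<omega>) * indicator {\<omega>\<in>E. jmp \<omega> \<noteq> 0} \<omega> \<partial>M)"
    by (rule jump_formula[OF H2, symmetric])
  also have "\<dots> = (\<integral>\<^sup>+\<omega>. k (\<tau> \<omega>, pre_S X c \<omega>, jump_S X c \<omega>) * indicator A (\<tau> \<omega>, pre_S X c \<omega>, jump_S X c \<omega>) * indicator E \<omega> \<partial>M)"
  proof (rule nn_integral_cong_AE)
    show "AE \<omega> in M. H2 (\<tau> \<omega>, pre \<omega>, jmp \<omega>) * indicator {\<omega>\<in>E. jmp \<omega> \<noteq> 0} \<omega> =
        k (\<tau> \<omega>, pre_S X c \<omega>, jump_S X c \<omega>) * indicator A (\<tau> \<omega>, pre_S X c \<omega>, jump_S X c \<omega>) * indicator E \<omega>"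
      using AE_increasing_path
    proof eventually_elim
      case (elim \<omega>)
      show ?case
      proof (cases "\<omega> \<in> E")
        case True
        then show ?thesis using nz[of \<omega>] by (auto simp: H2_def sizes[OF elim True] indicator_def)
      qed simp
    qed
  qed
  also have "\<dots> = (\<integral>\<^sup>+\<omega>. k (\<tau> \<omega>, pre_S X c \<omega>, jump_S X c \<omega>) * indicator A (\<tau> \<omega>, pre_S X c \<omega>, jump_S X c \<omega>) \<partial>restrict_space M E)"
    by (simp add: nn_integral_restrict_space)
  also have "\<dots> = (\<integral>\<^sup>+y. k y * indicator A y \<partial>distr (restrict_space M E) borel (\<lambda>\<omega>. (\<tau> \<omega>, pre_S X c \<omega>, jump_S X c \<omega>)))"
  proof -
    have "(\<lambda>\<omega>. (\<tau> \<omega>, l1norm (pre0 \<omega>), l1norm (at0 \<omega>) - l1norm (pre0 \<omega>))) \<in> restrict_space M E \<rightarrow>\<^sub>M borel"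
      by (rule measurable_restrict_space1[OF sizes0])
    also have "?this \<longleftrightarrow> (\<lambda>\<omega>. (\<tau> \<omega>, pre_S X c \<omega>, jump_S X c \<omega>)) \<in> restrict_space M E \<rightarrow>\<^sub>M borel"
      by (rule measurable_cong) (auto simp: space_restrict_space jump_S_on_passes)
    finally have m1: "(\<lambda>\<omega>. (\<tau> \<omega>, pre_S X c \<omega>, jump_S X c \<omega>)) \<in> restrict_space M E \<rightarrow>\<^sub>M borel" .
    have m2: "(\<lambda>y. k y * indicator A y) \<in> borel_measurable borel" by measurable
    show ?thesis by (subst nn_integral_distr[OF m1]) (use m2 in simp_all)
  qed
  also have "\<dots> = (\<integral>\<^sup>+y. emeasure (case y of (t, s, z) \<Rightarrow> K t s \<Otimes>\<^sub>M \<kappa> z) B * indicator A y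
      \<partial>distr (restrict_space M E) borel (\<lambda>\<omega>. (\<tau> \<omega>, pre_S X c \<omega>, jump_S X c \<omega>)))"
    by (rule nn_integral_cong) (use AR in \<open>auto simp: indicator_def k_def L_eq\<close>)
  finally show "emeasure M {\<omega> \<in> E. (\<tau> \<omega>, pre_S X c \<omega>, jump_S X c \<omega>) \<in> A \<and> (pre \<omega>, jmp \<omega>) \<in> B} =
      (\<integral>\<^sup>+y. emeasure (case y of (t, s, z) \<Rightarrow> K t s \<Otimes>\<^sub>M \<kappa> z) B * indicator A y
        \<partial>distr (restrict_space M E) borel (\<lambda>\<omega>. (\<tau> \<omega>, pre_S X c \<omega>, jump_S X c \<omega>)))" .
qed

end

theorem theorem3p1:
  fixes M :: "'a measure" and X :: "real \<Rightarrow> 'a \<Rightarrow> real ^ 'n" and Pm :: "(real ^ 'n) measure"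
    and c :: "real \<Rightarrow> real" and c0 :: ereal
  assumes levy: "orthant_levy_process M X Pm"
    and c_cont: "continuous_on {0<..} c"
    and c_mono: "antimono_on {0<..} c"
    and c_zero: "((\<lambda>t. ereal (c t)) \<longlongrightarrow> c0) (at_right 0)" "0 < c0"
    and infinite: "emeasure (norm_levy Pm) {0<..} = \<infinity>"
  shows
    \<comment> \<open>1), first identity\<close>
    "(\<forall>A\<in>sets borel. A \<subseteq> {0<..} \<times> orthant \<times> (orthant - {0}) \<longrightarrow>
        emeasure M {\<omega> \<in> passes M X c. (tau X c \<omega>, pre_X X c \<omega>, jump_X X c \<omega>) \<in> A} =
          (\<integral>\<^sup>+ t. \<integral>\<^sup>+ u. \<integral>\<^sup>+ v.
             indicator {(t, u, v). (t, u, v) \<in> A \<and> 0 \<le> c t - l1norm u \<and> c t - l1norm u < l1norm v} (t, u, v)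
             \<partial>Pm \<partial>distr M borel (X t) \<partial>lborel))
     \<and> \<comment> \<open>1), second identity, and 2), last identity\<close>
     (\<forall>K. cond_family M X K \<longrightarrow>
        (cont_along M X c K \<longrightarrow> creep_joint M X c K \<and> creep_cond M X c K) \<and>
        (\<exists>K'. cond_family M X K' \<and> (\<forall>t>0. \<forall>s. s \<noteq> c t \<longrightarrow> K' t s = K t s) \<and>
              creep_joint M X c K' \<and> creep_cond M X c K'))
     \<and> \<comment> \<open>2), first identity\<close>
     (\<forall>K a \<kappa>. cond_family M X K \<longrightarrow> 0 < a \<longrightarrow>
        reg_cond_distr (nu Pm a) (space (nu Pm a)) l1norm (\<lambda>v. v) {a<..} \<kappa> \<longrightarrow>
        reg_cond_distr M (passes M X c)
          (\<lambda>\<omega>. (tau X c \<omega>, pre_S X c \<omega>, jump_S X c \<omega>))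
          (\<lambda>\<omega>. (pre_X X c \<omega>, jump_X X c \<omega>))
          {(t, s, z). 0 < t \<and> 0 \<le> s \<and> s \<le> c t \<and> c t - s < z \<and> a < z}
          (\<lambda>(t, s, z). K t s \<Otimes>\<^sub>M \<kappa> z))
     \<and> \<comment> \<open>2), independence of the choice of a\<close>
     (\<forall>a b \<kappa> \<kappa>'. 0 < a \<longrightarrow> 0 < b \<longrightarrow>
        reg_cond_distr (nu Pm a) (space (nu Pm a)) l1norm (\<lambda>v. v) {a<..} \<kappa> \<longrightarrow>
        reg_cond_distr (nu Pm b) (space (nu Pm b)) l1norm (\<lambda>v. v) {b<..} \<kappa>' \<longrightarrow>
        (AE z in norm_levy Pm. a < z \<longrightarrow> b < z \<longrightarrow> \<kappa> z = \<kappa>' z))"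
proof -
  interpret levy_passage M X Pm c
    by (intro levy_passage.intro infinite_activity.intro infinite_activity_axioms.intro boundary.intro levy infinite c_cont c_mono)
  show ?thesis
  proof (intro conjI allI ballI impI)
    fix K assume K: "cond_family M X K"
    show "creep_joint M X c K" "creep_cond M X c K" if "cont_along M X c K"
      using creep_identities[OF K cont_along_disintegrates[OF K that]] by auto
    show "\<exists>K'. cond_family M X K' \<and> (\<forall>t>0. \<forall>s. s \<noteq> c t \<longrightarrow> K' t s = K t s) \<and>
        creep_joint M X c K' \<and> creep_cond M X c K'"
      by (rule creep_version_exists[OF K])
  qed (use law_at_jump_passage sizes_conditional[unfolded size_range_def] levy_kernel_unique in \<open>simp_all\<close>)
qed

end
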